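(* Let $\mathcal{M}\subset\mathcal{B}(\mathfrak{H})$ be a finite-dimensional von Neumann algebra, and let $\mathcal{L}_\gamma=\mathcal{L}_A+\gamma\mathcal{L}_S$, $\gamma>0$, be quantum Markov semigroup generators on $\mathcal{M}$ such that $\exp(t\mathcal{L}_\gamma)$ is a second-order lift of $\exp(t\mathcal{L}_O)$ (in the sense defined in the context), with associated full-rank state $\sigma$. Let $K_1,K_2\ge0$ be constants such that for all $Y\in\mathcal{F}(\mathcal{L}_S)$, $$\|(\mathrm{id}-E_S)\mathcal{L}_A^\star(-\mathcal{L}_S)^{-1}\mathcal{L}_AY\|_{2,\sigma}\le K_1\|\mathcal{L}_O(Y)\|_{2,\sigma}+K_2\sqrt{\mathcal{E}_{\mathcal{L}_O}(Y)}.$$ Then there are constants $C_0,C_1>0$, independent of $\gamma$, with $$C_0=\Theta(\lambda_O^{-1}),\qquad C_1=\Theta\Big(\big(\lambda_S^{-1}+1+\lambda_S^{-1/2}(K_1+K_2\lambda_O^{-1/2})\big)^2\Big),$$ such that for every $\gamma>0$, every $X\in\mathcal{M}$ with $E_{\mathcal{F}}(X)=0$ and every $t\ge0$, $$\|e^{t\mathcal{L}_\gamma}(X)\|_{2,\sigma}\le Ce^{-\nu t}\|X\|_{2,\sigma},\qquad C=\mathcal{O}(1),\quad\nu=\frac{\gamma}{\gamma^2C_0+C_1}.$$ Choosing $\gamma=\gamma_{\max}:=\sqrt{C_1/C_0}$ gives $$\sup_{\gamma>0}\nu(\mathcal{L}_\gamma)\ \ge\ \nu(\mathcal{L}_{\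gamma_{\max}})=\Omega\left(\frac{\lambda_O^{1/2}}{\lambda_S^{-1}+1+\lambda_S^{-1/2}(K_1+K_2\lambda_O^{-1/2})}\right).$$
   Context: Notation. $\mathfrak{H}$ is a finite-dimensional Hilbert space and $\mathcal{M}\subset\mathcal{B}(\mathfrak{H})$ a von Neumann algebra. $\mathcal{D}_+(\mathcal{M})$ is the set of full-rank density operators in $\mathcal{M}$. A quantum Markov semigroup (QMS) on $\mathcal{M}$ is a semigroup $\exp(t\mathcal{L})$ of completely positive unital maps $\mathcal{M}\to\mathcal{M}$. $\Phi^\dag$ is the Hilbert–Schmidt adjoint; $\sigma$ is invariant if $\mathcal{L}^\dag(\sigma)=0$. For $\sigma\in\mathcal{D}_+(\mathcal{M})$ the KMS inner product is $\langle X,Y\rangle_{\sigma,1/2}=\mathrm{tr}(\sigma^{1/2}X^*\sigma^{1/2}Y)$, with induced norm $\|\cdot\|_{2,\sigma}$; $\Phi^\star$ is the adjoint for this inner product; $\mathcal{L}$ is $\sigma$-KMS detailed balanced if $\mathcal{L}=\mathcal{L}^\star$. $\mathcal{F}(\mathcal{L})=\ker\mathcal{L}$. $\mathcal{E}_{\mathcal{L}}(X)=-\langle X,\mathcal{L}X\rangle_{\sigma,1/2}$. Second-order lift. One is given a family $\mathcal{L}_\gamma=\mathcal{L}_A+\gamma\mathcal{L}_S$, each $\mathcal{L}_\gamma$ ($\gamma>0$) being a QMS generator on $\mathcal{M}$, with $\mathcal{L}_A,\mathcal{L}_S$ independent of $\gamma$. Let $E_S$, $E_{\mathcal{F}}$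 be the conditional expectations with respect to $\sigma$ (equivalently the KMS-orthogonal projections) from $\mathcal{M}$ onto $\mathcal{F}(\mathcal{L}_S)$ and $\mathcal{F}(\mathcal{L}_\gamma)$; under (A) below, $\mathcal{F}(\mathcal{L}_\gamma)=\ker\mathcal{L}_A\cap\ker\mathcal{L}_S$ does not depend on $\gamma$. Set $\mathcal{L}_O:=-(\mathcal{L}_AE_S)^\star(-\mathcal{L}_S)^{-1}\mathcal{L}_AE_S$ on $\mathcal{F}(\mathcal{L}_S)$, with $(-\mathcal{L}_S)^{-1}$ the pseudoinverse. $\exp(t\mathcal{L}_\gamma)$ is a second-order lift of $\exp(t\mathcal{L}_O)$ if: (A) for some $\sigma\in\mathcal{D}_+(\mathcal{M})$: $\mathcal{L}_S=\mathcal{L}_S^\star$ and $\mathcal{L}_A=-\mathcal{L}_A^\star$; (B) $\dim\mathcal{F}(\mathcal{L}_S)>\dim\mathcal{F}(\mathcal{L}_\gamma)$; (C) $E_S\mathcal{L}_AE_S=0$; (D) $\mathcal{L}_O$ generates a QMS on $\mathcal{F}(\mathcal{L}_S)$ that is $\sigma_o$-KMS detailed balanced for some full-rank invariant state $\sigma_o\in\mathcal{D}_+(\mathcal{F}(\mathcal{L}_S))$, with $\langle X,\mathcal{L}_OY\rangle_{\sigma,1/2}=\langle X,\mathcal{L}_OY\rangle_{\sigma_o,1/2}$ for all $X,Y\in\mathcal{F}(\mathcal{L}_S)$. Spectral gaps: $\lambda_O:=\inf\frac{-\langle X,\mathcal{L}_OX\rangle_{\sigma,1/2}}{\|X-E_O(X)\|_{2,\sigma}^2}$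 over $X\in\mathcal{F}(\mathcal{L}_S)$ with $X\ne E_O(X)$, where $E_O$ is the conditional expectation from $\mathcal{M}$ onto $\ker\mathcal{L}_O\subset\mathcal{F}(\mathcal{L}_S)$; $\lambda_S:=\inf\frac{-\langle X,\mathcal{L}_SX\rangle_{\sigma,1/2}}{\|X-E_S(X)\|_{2,\sigma}^2}$ over $X\in\mathcal{M}$ with $X\neq E_S(X)$. Asymptotic notation: $\mathcal{O},\Omega,\Theta$ have universal implied constants. $\nu(\mathcal{L}_\gamma)$ denotes the $L^2$ convergence rate of $\exp(t\mathcal{L}_\gamma)$, i.e. the supremum of the rates $\nu$ for which $\|e^{t\mathcal{L}_\gamma}X\|_{2,\sigma}\le Ce^{-\nu t}\|X\|_{2,\sigma}$ holds for all $t\geq 0$ and all $X$ with $E_{\mathcal{F}}(X)=0$, with prefactor $C$ bounded by the universal constant in the displayed estimate. *)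

theory Defs
  imports
    "Jordan_Normal_Form.Schur_Decomposition"
    "Jordan_Normal_Form.VS_Connect"
    "HOL-Library.Extended_Real"
    Complex_Main
begin

text \<open>The Hilbert space is \<open>\<complex>\<^sup>n\<close> and operators on it are \<open>n \<times> n\<close> complex matrices; \<open>n\<close> is a number
  rather than a type, so that constants can be chosen uniformly in the dimension.  Linear maps on
  an algebra \<open>M\<close> of matrices are functions on matrices whose values outside \<open>M\<close> are irrelevant.
  On \<^typ>\<open>complex\<close>, the relation \<open>0 \<le> z\<close> means that \<open>z\<close> is real and nonnegative.\<close>

type_synonym cmat = "complex mat"
type_synonym superop = "cmat \<Rightarrow> cmat"

definition trace :: "cmat \<Rightarrow> complex" where
  "trace A = (\<Sum>i<dim_row A. A $$ (i, i))"

definition psd :: "nat \<Rightarrow> cmat \<Rightarrow> bool" where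
  "psd n A \<longleftrightarrow> A \<in> carrier_mat n n \<and> (\<forall>v\<in>carrier_vec n. 0 \<le> (A *\<^sub>v v) \<bullet>c v)"

definition mat_sqrt :: "nat \<Rightarrow> cmat \<Rightarrow> cmat" where
  "mat_sqrt n A = (THE B. psd n B \<and> B * B = A)"


section \<open>Von Neumann algebras, states, quantum Markov semigroups\<close>

definition commutant :: "nat \<Rightarrow> cmat set \<Rightarrow> cmat set" where
  "commutant n M = {Y \<in> carrier_mat n n. \<forall>X\<in>M. X * Y = Y * X}"

definition von_neumann_algebra :: "nat \<Rightarrow> cmat set \<Rightarrow> bool" where
  "von_neumann_algebra n M \<longleftrightarrow>
     M \<subseteq> carrier_mat n n \<and> (\<forall>X\<in>M. mat_adjoint X \<in> M) \<and> commutant n (commutant n M) = M"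

definition full_rank_densities :: "nat \<Rightarrow> cmat set \<Rightarrow> cmat set" where
  "full_rank_densities n M = {\<sigma> \<in> M. psd n \<sigma> \<and> trace \<sigma> = 1 \<and> invertible_mat \<sigma>}"

definition linear_on :: "cmat set \<Rightarrow> superop \<Rightarrow> bool" where
  "linear_on M \<Phi> \<longleftrightarrow> (\<forall>X\<in>M. \<Phi> X \<in> M) \<and>
     (\<forall>X\<in>M. \<forall>Y\<in>M. \<Phi> (X + Y) = \<Phi> X + \<Phi> Y) \<and>
     (\<forall>c. \<forall>X\<in>M. \<Phi> (c \<cdot>\<^sub>m X) = c \<cdot>\<^sub>m \<Phi> X)"

text \<open>Positivity of the block operator \<open>(A i j)\<close>, \<open>i, j < k\<close>, on the \<open>k\<close>-fold direct sum
  of \<open>\<complex>\<^sup>n\<close>.\<close>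

definition block_psd :: "nat \<Rightarrow> nat \<Rightarrow> (nat \<Rightarrow> nat \<Rightarrow> cmat) \<Rightarrow> bool" where
  "block_psd n k A \<longleftrightarrow> (\<forall>v. (\<forall>i<k. v i \<in> carrier_vec n) \<longrightarrow>
     0 \<le> (\<Sum>i<k. \<Sum>j<k. (A i j *\<^sub>v v j) \<bullet>c v i))"

definition completely_positive :: "nat \<Rightarrow> cmat set \<Rightarrow> superop \<Rightarrow> bool" where
  "completely_positive n M \<Phi> \<longleftrightarrow> linear_on M \<Phi> \<and>
     (\<forall>k A. (\<forall>i<k. \<forall>j<k. A i j \<in> M) \<longrightarrow> block_psd n k A \<longrightarrow> block_psd n k (\<lambda>i j. \<Phi> (A i j)))"

definition super_exp :: "nat \<Rightarrow> real \<Rightarrow> superop \<Rightarrow> superop" where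
  "super_exp n t L X =
     mat n n (\<lambda>(i, j). \<Sum>m. complex_of_real (t ^ m / fact m) * ((L ^^ m) X $$ (i, j)))"

definition qms_generator :: "nat \<Rightarrow> cmat set \<Rightarrow> superop \<Rightarrow> bool" where
  "qms_generator n M L \<longleftrightarrow> linear_on M L \<and>
     (\<forall>t\<ge>0. completely_positive n M (super_exp n t L) \<and> super_exp n t L (1\<^sub>m n) = 1\<^sub>m n)"

definition fixed_algebra :: "nat \<Rightarrow> cmat set \<Rightarrow> superop \<Rightarrow> cmat set" where
  "fixed_algebra n M L = {X \<in> M. L X = 0\<^sub>m n n}"

definition cdim :: "nat \<Rightarrow> cmat set \<Rightarrow> nat" where
  "cdim n V = vectorspace.dim class_ring (module_mat TYPE(complex) n n\<lparr>carrier := V\<rparr>)"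


section \<open>Inner products, adjoints, conditional expectations\<close>

definition hs_inner :: "cmat \<Rightarrow> cmat \<Rightarrow> complex" where
  "hs_inner X Y = trace (mat_adjoint X * Y)"

definition kms_inner :: "nat \<Rightarrow> cmat \<Rightarrow> cmat \<Rightarrow> cmat \<Rightarrow> complex" where
  "kms_inner n \<sigma> X Y = trace (mat_sqrt n \<sigma> * mat_adjoint X * mat_sqrt n \<sigma> * Y)"

definition kms_norm :: "nat \<Rightarrow> cmat \<Rightarrow> cmat \<Rightarrow> real" where
  "kms_norm n \<sigma> X = sqrt (Re (kms_inner n \<sigma> X X))"

definition adjoint_on :: "(cmat \<Rightarrow> cmat \<Rightarrow> complex) \<Rightarrow> cmat set \<Rightarrow> superop \<Rightarrow> superop" where
  "adjoint_on ip M \<Phi> X = (THE Z. Z \<in> M \<and> (\<forall>Y\<in>M. ip Z Y = ip X (\<Phi> Y)))"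

abbreviation hs_adjoint :: "cmat set \<Rightarrow> superop \<Rightarrow> superop" where
  "hs_adjoint \<equiv> adjoint_on hs_inner"

abbreviation kms_adjoint :: "nat \<Rightarrow> cmat \<Rightarrow> cmat set \<Rightarrow> superop \<Rightarrow> superop" where
  "kms_adjoint n \<sigma> \<equiv> adjoint_on (kms_inner n \<sigma>)"

definition kms_detailed_balanced :: "nat \<Rightarrow> cmat \<Rightarrow> cmat set \<Rightarrow> superop \<Rightarrow> bool" where
  "kms_detailed_balanced n \<sigma> M L \<longleftrightarrow> (\<forall>X\<in>M. L X = kms_adjoint n \<sigma> M L X)"

text \<open>For the fixed point algebra \<open>V\<close> of a quantum Markov semigroup with full-rank invariant state
  \<open>\<sigma>\<close>, the \<open>\<sigma>\<close>-preserving conditional expectation onto \<open>V\<close> is the orthogonal projection onto \<open>V\<close>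
  for the KMS inner product, which is how it is defined here.\<close>

definition cond_exp :: "nat \<Rightarrow> cmat \<Rightarrow> cmat set \<Rightarrow> superop" where
  "cond_exp n \<sigma> V X = (THE Z. Z \<in> V \<and> (\<forall>Y\<in>V. kms_inner n \<sigma> Y (X - Z) = 0))"

text \<open>Moore--Penrose pseudoinverse for the KMS inner product: the value at \<open>X\<close> is the least squares
  solution \<open>Z\<close> of \<open>\<Phi> Z = X\<close> that is orthogonal to the kernel of \<open>\<Phi>\<close>.\<close>

definition pseudoinverse :: "nat \<Rightarrow> cmat \<Rightarrow> cmat set \<Rightarrow> superop \<Rightarrow> superop" where
  "pseudoinverse n \<sigma> M \<Phi> X = (THE Z. Z \<in> M \<and>
     (\<forall>Y\<in>fixed_algebra n M \<Phi>. kms_inner n \<sigma> Y Z = 0) \<and>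
     (\<forall>W\<in>M. kms_inner n \<sigma> (\<Phi> W) (X - \<Phi> Z) = 0))"

text \<open>For the KMS-symmetric \<open>L\<close> below, the inner product here is real.\<close>

definition dirichlet_form :: "nat \<Rightarrow> cmat \<Rightarrow> superop \<Rightarrow> cmat \<Rightarrow> real" where
  "dirichlet_form n \<sigma> L X = - Re (kms_inner n \<sigma> X (L X))"

definition spectral_gap :: "nat \<Rightarrow> cmat \<Rightarrow> cmat set \<Rightarrow> superop \<Rightarrow> real" where
  "spectral_gap n \<sigma> N L = (let E = cond_exp n \<sigma> (fixed_algebra n N L) in
     Inf {dirichlet_form n \<sigma> L X / (kms_norm n \<sigma> (X - E X))\<^sup>2 | X. X \<in> N \<and> X \<noteq> E X})"

text \<open>The \<open>L\<^sup>2\<close> convergence rate with prefactor at most \<open>C\<close>; the supremum is taken in the extended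
  reals so that it is meaningful without a boundedness assumption.\<close>

definition l2_rate :: "real \<Rightarrow> nat \<Rightarrow> cmat \<Rightarrow> cmat set \<Rightarrow> superop \<Rightarrow> ereal" where
  "l2_rate C n \<sigma> M L = Sup {ereal \<nu> | \<nu>. \<exists>C'\<le>C. \<forall>t\<ge>0. \<forall>X\<in>M.
     cond_exp n \<sigma> (fixed_algebra n M L) X = 0\<^sub>m n n \<longrightarrow>
     kms_norm n \<sigma> (super_exp n t L X) \<le> C' * exp (- \<nu> * t) * kms_norm n \<sigma> X}"


section \<open>Second-order lifts\<close>

definition lifted :: "superop \<Rightarrow> superop \<Rightarrow> real \<Rightarrow> superop" where
  "lifted LA LS \<gamma> = (\<lambda>X. LA X + complex_of_real \<gamma> \<cdot>\<^sub>m LS X)"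

abbreviation neg_inverse :: "nat \<Rightarrow> cmat \<Rightarrow> cmat set \<Rightarrow> superop \<Rightarrow> superop" where
  "neg_inverse n \<sigma> M LS \<equiv> pseudoinverse n \<sigma> M (\<lambda>X. - LS X)"

definition overdamped :: "nat \<Rightarrow> cmat \<Rightarrow> cmat set \<Rightarrow> superop \<Rightarrow> superop \<Rightarrow> superop" where
  "overdamped n \<sigma> M LA LS = (let ES = cond_exp n \<sigma> (fixed_algebra n M LS) in
     (\<lambda>X. - kms_adjoint n \<sigma> M (LA \<circ> ES) (neg_inverse n \<sigma> M LS (LA (ES X)))))"

definition second_order_lift :: "nat \<Rightarrow> cmat \<Rightarrow> cmat set \<Rightarrow> superop \<Rightarrow> superop \<Rightarrow> bool" where
  "second_order_lift n \<sigma> M LA LS \<longleftrightarrow>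
    (let FS = fixed_algebra n M LS; ES = cond_exp n \<sigma> FS; LO = overdamped n \<sigma> M LA LS in
      linear_on M LA \<and> linear_on M LS \<and>
      (\<forall>\<gamma>>0. qms_generator n M (lifted LA LS \<gamma>)) \<and>
      \<sigma> \<in> full_rank_densities n M \<and>
      kms_detailed_balanced n \<sigma> M LS \<and>
      (\<forall>X\<in>M. LA X = - kms_adjoint n \<sigma> M LA X) \<and>
      (\<forall>\<gamma>>0. cdim n FS > cdim n (fixed_algebra n M (lifted LA LS \<gamma>))) \<and>
      (\<forall>X\<in>M. ES (LA (ES X)) = 0\<^sub>m n n) \<and>
      qms_generator n FS LO \<and>
      (\<exists>\<sigma>o\<in>full_rank_densities n FS.
         hs_adjoint FS LO \<sigma>o = 0\<^sub>m n n \<and>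
         kms_detailed_balanced n \<sigma>o FS LO \<and>
         (\<forall>X\<in>FS. \<forall>Y\<in>FS. kms_inner n \<sigma> X (LO Y) = kms_inner n \<sigma>o X (LO Y))))"

end

theory Submission
  imports Defs "HOL-Analysis.Linear_Algebra" "HOL-Library.Poly_Mapping"
begin

text \<open>
  With the KMS inner product the algebra is a finite-dimensional Hilbert space on which the
  generator acts as \<open>A - \<gamma> N\<close>, where \<open>A = LA\<close> is skew and \<open>N = - LS\<close> is symmetric and nonnegative.  Let \<open>P\<close>
  project onto \<open>F = ker N\<close>, let \<open>J\<close> be the pseudoinverse of \<open>N\<close>, and let \<open>D = - P A J A\<close> on \<open>F\<close>, which is
  minus the overdamped generator.  The norm alone gives only
  \<open>d/dt \<parallel>x\<parallel>\<^sup>2 / 2 = - \<gamma> \<langle>x, N x\<rangle>\<close>, which does not see \<open>P x\<close>.  The remedy is a Lyapunov function with a corrector,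
  \<open>\<parallel>x\<parallel>\<^sup>2 / 2 - \<epsilon> \<langle>x, C x\<rangle>\<close> with \<open>C = J A D\<^sup>-\<^sup>1 P\<close>.  Since \<open>\<langle>A P x, C x\<rangle> = \<parallel>P x\<parallel>\<^sup>2\<close>, the corrector contributes
  \<open>- \<epsilon> \<parallel>P x\<parallel>\<^sup>2\<close>, and all other contributions are products of \<open>\<langle>x, N x\<rangle>\<^bsup>1/2\<^esup>\<close> with itself or with \<open>\<parallel>P x\<parallel>\<close>:
  writing \<open>lS\<close> and \<open>lO\<close> for the two gaps, the coefficients are \<open>1 / lS\<close> and
  \<open>\<gamma> / \<surd>lO + (K1 + K2 / \<surd>lO) / \<surd>lS\<close>, the second summand being exactly what the hypothesis on \<open>K1\<close> and \<open>K2\<close>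
  measures (\<open>corrector_derivative\<close>).  Absorbing them into the dissipation allows
  \<open>\<epsilon> = \<gamma> / (2 \<gamma>\<^sup>2 / lO + 2 r\<^sup>2)\<close>, where \<open>r\<close> is the quantity whose square governs \<open>C1\<close>, and the norm decays with rate
  \<open>\<epsilon> / 3\<close> and prefactor \<open>2\<close> (\<open>decay\<close>).  So \<open>C0 = 6 / lO\<close> and \<open>C1 = 6 r\<^sup>2\<close>.

  That \<open>N\<close> is nonnegative uses that the semigroups consist of positive unital maps, for all \<open>\<gamma>\<close>.  Such
  maps keep order intervals, so the trajectories of \<open>A + \<gamma> LS\<close> are bounded uniformly in time and in \<open>\<gamma>\<close>
  (\<open>qms_uniformly_bounded\<close>), whereas a positive direction of \<open>LS\<close> would produce growth by a factor exponential
  in \<open>\<gamma>\<close> within a fixed time (\<open>nonpositive_if_trajectories_bounded\<close>).  The strict inequality of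
  dimensions makes both gaps infima over nonempty sets, and finite dimension makes them positive
  (\<open>A_nontrivial\<close>, \<open>spectral_gap_transfer\<close>).

  The estimate itself is carried out in a real inner product space, to which the algebra is transferred by
  \<open>X \<mapsto> \<sigma>\<^bsup>1/4\<^esup> X \<sigma>\<^bsup>1/4\<^esup>\<close>; this takes existence and uniqueness of positive square roots of matrices
  (\<open>psd_sqrt_exists\<close>, \<open>psd_sqrt_unique\<close>).
\<close>

section \<open>Finite-dimensional subspaces of a real inner product space\<close>

definition lin_on :: "'a::real_vector set \<Rightarrow> ('a \<Rightarrow> 'b::real_vector) \<Rightarrow> bool" where
  "lin_on S f \<longleftrightarrow> (\<forall>x\<in>S. \<forall>y\<in>S. f (x + y) = f x + f y) \<and> (\<forall>c. \<forall>x\<in>S. f (c *\<^sub>R x) = c *\<^sub>R f x)"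

definition fin_dim :: "'a::real_vector set \<Rightarrow> bool" where
  "fin_dim S \<longleftrightarrow> subspace S \<and> (\<exists>B. finite B \<and> S \<subseteq> span B)"

lemma fin_dim_subspace: "fin_dim S \<Longrightarrow> subspace S"
  by (simp add: fin_dim_def)

lemma fin_dim_mono: "fin_dim S \<Longrightarrow> subspace T \<Longrightarrow> T \<subseteq> S \<Longrightarrow> fin_dim T"
  unfolding fin_dim_def by blast

lemma orthogonal_family_exists:
  fixes S :: "'a::real_inner set"
  assumes "fin_dim S"
  obtains C where "finite C" "C \<subseteq> S" "pairwise orthogonal C" "span C = S"
proof -
  obtain B0 where B0: "finite B0" "S \<subseteq> span B0" and S: "subspace S"
    using assms unfolding fin_dim_def by blast
  obtain B where B: "B \<subseteq> S" "independent B" "S \<subseteq> span B"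
    using maximal_independent_subset by blast
  have "finite B" using independent_span_bound[OF B0(1) B(2)] B B0 by auto
  from basis_orthogonal[OF this] obtain C where C: "finite C" "span C = span B" "pairwise orthogonal C"
    by blast
  have "span B = S" using B S by (simp add: span_subspace)
  then show ?thesis using that[of C] C span_superset[of C] by auto
qed

lemma orthogonal_expansion:
  fixes C :: "'a::real_inner set"
  assumes C: "finite C" "pairwise orthogonal C" and x: "x \<in> span C"
  shows "x = (\<Sum>c\<in>C. (inner c x / inner c c) *\<^sub>R c)"
proof -
  let ?z = "x - (\<Sum>c\<in>C. (inner c x / inner c c) *\<^sub>R c)"
  have z: "?z \<in> span C"
    by (intro span_diff x span_sum span_scale span_base)
  have orth: "inner c ?z = 0" if c: "c \<in> C" for c
  proof -
    have "inner c (\<Sum>d\<in>C. (inner d x / inner d d) *\<^sub>R d) = (\<Sum>d\<in>C. (inner d x / inner d d) * inner c d)"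
      by (simp add: inner_sum_right)
    also have "\<dots> = (\<Sum>d\<in>C. if d = c then inner c x else 0)"
      using C(2) c by (intro sum.cong) (auto simp: pairwise_def orthogonal_def)
    also have "\<dots> = inner c x" using C(1) c by simp
    finally show ?thesis by (simp add: inner_diff_right)
  qed
  have "inner y ?z = 0" if "y \<in> span C" for y
    using that
  proof (induction rule: span_induct_alt)
    case base show ?case by simp
  next
    case (step c a b) then show ?case using orth by (simp add: inner_add_left)
  qed
  from this[OF z] show ?thesis by simp
qed

lemma lin_on_zero: "subspace S \<Longrightarrow> lin_on S f \<Longrightarrow> f 0 = 0"
  unfolding lin_on_def using subspace_0 by (metis scaleR_zero_left)

text \<open>In finite dimension every map that is linear on a subspace is the restriction of a bounded
  linear map of the whole space.  This gives continuity, and differentiability along curves, of maps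
  that are only specified on the subspace.\<close>

lemma lin_on_extends:
  fixes S :: "'a::real_inner set" and f :: "'a \<Rightarrow> 'b::real_normed_vector"
  assumes "fin_dim S" "lin_on S f"
  obtains g where "bounded_linear g" "\<And>x. x \<in> S \<Longrightarrow> g x = f x"
proof -
  obtain C where C: "finite C" "C \<subseteq> S" "pairwise orthogonal C" "span C = S"
    using orthogonal_family_exists[OF assms(1)] by blast
  have S: "subspace S" using assms by (simp add: fin_dim_def)
  let ?g = "\<lambda>x. \<Sum>c\<in>C. (inner c x / inner c c) *\<^sub>R f c"
  have "bounded_linear ?g"
    by (intro bounded_linear_sum bounded_linear_scaleR_const
        bounded_linear_compose[OF bounded_linear_divide bounded_linear_inner_right])
  moreover have "?g x = f x" if x: "x \<in> S" for x
  proof -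
    have sum: "f (\<Sum>c\<in>D. a c *\<^sub>R c) = (\<Sum>c\<in>D. a c *\<^sub>R f c)" if "finite D" "D \<subseteq> S" for D a
      using that
    proof (induction D rule: finite_induct)
      case empty
      show ?case using lin_on_zero[OF S assms(2)] by simp
    next
      case (insert d D)
      have "(\<Sum>c\<in>D. a c *\<^sub>R c) \<in> S" using insert by (intro subspace_sum[OF S] subspace_scale[OF S]) auto
      moreover have "a d *\<^sub>R d \<in> S" using insert by (intro subspace_scale[OF S]) auto
      ultimately show ?case using insert assms(2) by (simp add: lin_on_def)
    qed
    show ?thesis
      using sum[OF C(1,2), of "\<lambda>c. inner c x / inner c c"] orthogonal_expansion[OF C(1,3), of x] x C(4)
      by simp
  qed
  ultimately show ?thesis using that by blast
qed

lemma lin_on_bound: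
  fixes S :: "'a::real_inner set" and f :: "'a \<Rightarrow> 'b::real_normed_vector"
  assumes "fin_dim S" "lin_on S f"
  obtains K where "K > 0" "\<And>x. x \<in> S \<Longrightarrow> norm (f x) \<le> K * norm x"
proof -
  obtain g where g: "bounded_linear g" "\<And>x. x \<in> S \<Longrightarrow> g x = f x" using lin_on_extends[OF assms] by blast
  obtain K where "K > 0" "\<And>x. norm (g x) \<le> norm x * K"
    using bounded_linear.pos_bounded[OF g(1)] by blast
  then show ?thesis using that[of K] g(2) by (metis mult.commute)
qed

lemma riesz_on:
  fixes S :: "'a::real_inner set" and f :: "'a \<Rightarrow> real"
  assumes "fin_dim S" "lin_on S f"
  obtains z where "z \<in> S" "\<And>y. y \<in> S \<Longrightarrow> inner z y = f y"
proof -
  obtain C where C: "finite C" "C \<subseteq> S" "pairwise orthogonal C" "span C = S"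
    using orthogonal_family_exists[OF assms(1)] by blast
  have S: "subspace S" using assms by (simp add: fin_dim_def)
  obtain g where g: "bounded_linear g" "\<And>x. x \<in> S \<Longrightarrow> g x = f x" using lin_on_extends[OF assms] by blast
  let ?z = "\<Sum>c\<in>C. (f c / inner c c) *\<^sub>R c"
  have "?z \<in> S" using C by (intro subspace_sum[OF S] subspace_scale[OF S]) auto
  moreover have "inner ?z y = f y" if y: "y \<in> S" for y
  proof -
    have "f y = g (\<Sum>c\<in>C. (inner c y / inner c c) *\<^sub>R c)"
      using orthogonal_expansion[OF C(1,3), of y] y C(4) g(2)[OF y] by simp
    also have "\<dots> = (\<Sum>c\<in>C. (inner c y / inner c c) * g c)"
      using g(1) by (simp add: bounded_linear.linear linear_sum linear_scale)
    also have "\<dots> = (\<Sum>c\<in>C. (inner c y / inner c c) * f c)"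
      using C(2) g(2) by (intro sum.cong) auto
    also have "\<dots> = inner ?z y" by (simp add: inner_sum_left mult_ac)
    finally show ?thesis ..
  qed
  ultimately show ?thesis using that by blast
qed

section \<open>Orthogonal projections and pseudoinverses\<close>

definition oproj :: "'a::real_inner set \<Rightarrow> 'a \<Rightarrow> 'a" where
  "oproj S x = (THE z. z \<in> S \<and> (\<forall>y\<in>S. inner y (x - z) = 0))"

lemma oproj_unique:
  fixes S :: "'a::real_inner set"
  assumes "subspace S" "z \<in> S" "\<And>y. y \<in> S \<Longrightarrow> inner y (x - z) = 0"
    and "z' \<in> S" "\<And>y. y \<in> S \<Longrightarrow> inner y (x - z') = 0"
  shows "z = z'"
proof -
  have "z - z' \<in> S" using assms by (simp add: subspace_diff)
  then have "inner (z - z') (x - z') - inner (z - z') (x - z) = 0" using assms by simp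
  then show ?thesis by (simp add: inner_diff_right[symmetric])
qed

lemma oproj_eqI:
  fixes S :: "'a::real_inner set"
  assumes "subspace S" "z \<in> S" "\<And>y. y \<in> S \<Longrightarrow> inner y (x - z) = 0"
  shows "oproj S x = z"
  unfolding oproj_def using oproj_unique[OF assms(1)] assms(2,3) by (intro the_equality) blast+

lemma oproj_props:
  fixes S :: "'a::real_inner set"
  assumes "fin_dim S"
  shows oproj_in: "oproj S x \<in> S" and oproj_orth: "y \<in> S \<Longrightarrow> inner y (x - oproj S x) = 0"
proof -
  have S: "subspace S" using assms by (simp add: fin_dim_def)
  have "lin_on S (\<lambda>y. inner x y)" by (simp add: lin_on_def inner_add_right)
  from riesz_on[OF assms this] obtain z where z: "z \<in> S" "\<And>y. y \<in> S \<Longrightarrow> inner z y = inner x y" by blast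
  have "inner y (x - z) = 0" if "y \<in> S" for y using z(2)[OF that] by (simp add: inner_diff_right inner_commute)
  then have "oproj S x = z" using oproj_eqI[OF S z(1)] by blast
  then show "oproj S x \<in> S" "y \<in> S \<Longrightarrow> inner y (x - oproj S x) = 0"
    using z by (auto simp: inner_diff_right inner_commute)
qed

lemma oproj_inner: "fin_dim S \<Longrightarrow> y \<in> S \<Longrightarrow> inner y (oproj S x) = inner y (x::'a::real_inner)"
  using oproj_orth[of S y x] by (simp add: inner_diff_right)

lemma oproj_id: "fin_dim S \<Longrightarrow> x \<in> S \<Longrightarrow> oproj S x = (x::'a::real_inner)"
  by (rule oproj_eqI) (auto simp: fin_dim_def)

lemma oproj_zero: "fin_dim S \<Longrightarrow> (\<And>y. y \<in> S \<Longrightarrow> inner y x = 0) \<Longrightarrow> oproj S x = (0::'a::real_inner)"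
  by (rule oproj_eqI) (auto simp: fin_dim_def subspace_0)

lemma oproj_add: "fin_dim S \<Longrightarrow> oproj S (x + y) = oproj S x + oproj S (y::'a::real_inner)"
  using oproj_in[of S] oproj_inner[of S]
  by (intro oproj_eqI) (auto simp: fin_dim_def subspace_add inner_diff_right inner_add_right)

lemma oproj_scaleR: "fin_dim S \<Longrightarrow> oproj S (c *\<^sub>R x) = c *\<^sub>R oproj S (x::'a::real_inner)"
  using oproj_in[of S] oproj_inner[of S]
  by (intro oproj_eqI) (auto simp: fin_dim_def subspace_scale inner_diff_right)

lemma oproj_minus: "fin_dim S \<Longrightarrow> oproj S (- x) = - oproj S (x::'a::real_inner)"
  using oproj_scaleR[of S "-1" x] by simp

definition ker_on :: "'a::real_vector set \<Rightarrow> ('a \<Rightarrow> 'b::real_vector) \<Rightarrow> 'a set" where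
  "ker_on S f = {x \<in> S. f x = 0}"

definition sym_nonneg :: "'a::real_inner set \<Rightarrow> ('a \<Rightarrow> 'a) \<Rightarrow> bool" where
  "sym_nonneg S N \<longleftrightarrow> fin_dim S \<and> lin_on S N \<and> (\<forall>x\<in>S. N x \<in> S) \<and>
     (\<forall>x\<in>S. \<forall>y\<in>S. inner (N x) y = inner x (N y)) \<and> (\<forall>x\<in>S. 0 \<le> inner x (N x))"

lemma lin_on_diff: "subspace S \<Longrightarrow> lin_on S f \<Longrightarrow> x \<in> S \<Longrightarrow> y \<in> S \<Longrightarrow> f (x - y) = f x - f y"
proof -
  assume a: "subspace S" "lin_on S f" "x \<in> S" "y \<in> S"
  have "f (x + (-1) *\<^sub>R y) = f x + f ((-1) *\<^sub>R y)"
    using a subspace_scale[OF a(1,4)] unfolding lin_on_def by blast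
  moreover have "f ((-1) *\<^sub>R y) = (-1) *\<^sub>R f y" using a unfolding lin_on_def by blast
  ultimately show ?thesis by simp
qed

lemma kernel_subspace: "subspace S \<Longrightarrow> lin_on S f \<Longrightarrow> subspace (ker_on S f)"
  using lin_on_zero[of S f]
  by (auto simp: ker_on_def subspace_def lin_on_def)

lemma kernel_fin_dim: "fin_dim S \<Longrightarrow> lin_on S f \<Longrightarrow> fin_dim (ker_on S f)"
  by (rule fin_dim_mono[of S]) (auto simp: fin_dim_def intro: kernel_subspace, simp add: ker_on_def)

context
  fixes S :: "'a::real_inner set" and N
  assumes N: "sym_nonneg S N"
begin

lemma sym_nonneg_fin_dim: "fin_dim S" and sym_nonneg_lin: "lin_on S N"
  and sym_nonneg_in: "x \<in> S \<Longrightarrow> N x \<in> S"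
  and sym_nonneg_sym: "x \<in> S \<Longrightarrow> y \<in> S \<Longrightarrow> inner (N x) y = inner x (N y)"
  and sym_nonneg_nonneg: "x \<in> S \<Longrightarrow> 0 \<le> inner x (N x)"
  using N unfolding sym_nonneg_def by auto

lemma ker_fin_dim: "fin_dim (ker_on S N)"
  using kernel_fin_dim sym_nonneg_fin_dim sym_nonneg_lin by blast

lemma ker_orth_range: "x \<in> S \<Longrightarrow> y \<in> ker_on S N \<Longrightarrow> inner y (N x) = 0"
  using sym_nonneg_sym[of y x] by (auto simp: ker_on_def)

lemma form_cauchy_schwarz:
  assumes x: "x \<in> S" and y: "y \<in> S"
  shows "(inner x (N y))\<^sup>2 \<le> inner x (N x) * inner y (N y)"
proof -
  have S: "subspace S" using sym_nonneg_fin_dim by (simp add: fin_dim_def)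
  let ?a = "inner x (N x)" and ?b = "inner x (N y)" and ?c = "inner y (N y)"
  have q: "0 \<le> ?a + 2 * t * ?b + t\<^sup>2 * ?c" for t
  proof -
    have ty: "t *\<^sub>R y \<in> S" using S y by (simp add: subspace_scale)
    have "N (x + t *\<^sub>R y) = N x + t *\<^sub>R N y"
      using sym_nonneg_lin x y ty unfolding lin_on_def by simp
    moreover have "inner y (N x) = ?b" using sym_nonneg_sym[OF x y] by (simp add: inner_commute)
    moreover have "0 \<le> inner (x + t *\<^sub>R y) (N (x + t *\<^sub>R y))"
      using S x ty by (intro sym_nonneg_nonneg) (simp add: subspace_add)
    ultimately show ?thesis by (simp add: inner_add_left inner_add_right power2_eq_square algebra_simps)
  qed
  show ?thesis
  proof (cases "?c = 0")
    case True
    have "?b = 0"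
    proof (rule ccontr)
      assume "?b \<noteq> 0"
      then have "?a + 2 * (- (?a + 1) / (2 * ?b)) * ?b = -1" by (simp add: field_simps)
      then show False using q[of "- (?a + 1) / (2 * ?b)"] True by simp
    qed
    then show ?thesis by (simp add: True)
  next
    case False
    then have c: "?c > 0" using sym_nonneg_nonneg[OF y] by simp
    have "0 \<le> ?a - ?b\<^sup>2 / ?c" using q[of "- ?b / ?c"] c by (simp add: power2_eq_square field_simps)
    then show ?thesis using c by (simp add: field_simps)
  qed
qed

lemma sym_nonneg_null: "x \<in> S \<Longrightarrow> inner x (N x) = 0 \<Longrightarrow> N x = 0"
  using form_cauchy_schwarz[of "N x" x] sym_nonneg_in[of x] by auto

text \<open>A symmetric map is onto the orthogonal complement of its kernel: whatever is orthogonal to the range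
  is annihilated by the map.\<close>

lemma sym_nonneg_range:
  assumes z: "z \<in> S" "\<And>y. y \<in> ker_on S N \<Longrightarrow> inner y z = 0"
  obtains w where "w \<in> S" "\<And>y. y \<in> ker_on S N \<Longrightarrow> inner y w = 0" "N w = z"
proof -
  have S: "subspace S" using sym_nonneg_fin_dim by (simp add: fin_dim_def)
  note lin = sym_nonneg_lin
  have R: "subspace (N ` S)"
    unfolding subspace_def
  proof (intro conjI ballI allI)
    show "0 \<in> N ` S" using lin_on_zero[OF S lin] subspace_0[OF S] by force
  next
    fix x y assume "x \<in> N ` S" "y \<in> N ` S"
    then obtain u v where "u \<in> S" "x = N u" "v \<in> S" "y = N v" by blast
    then show "x + y \<in> N ` S" using lin subspace_add[OF S, of u v]
      by (intro image_eqI[of _ _ "u + v"]) (auto simp: lin_on_def)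
  next
    fix c x assume "x \<in> N ` S"
    then obtain u where "u \<in> S" "x = N u" by blast
    then show "c *\<^sub>R x \<in> N ` S" using lin subspace_scale[OF S, of u c]
      by (intro image_eqI[of _ _ "c *\<^sub>R u"]) (auto simp: lin_on_def)
  qed
  have fR: "fin_dim (N ` S)" using fin_dim_mono[OF sym_nonneg_fin_dim R] sym_nonneg_in by blast
  \<comment> \<open>The residual of \<open>z\<close> against the range lies in the kernel, by symmetry, and is orthogonal to it.\<close>
  define e where "e = z - oproj (N ` S) z"
  obtain w0 where w0: "oproj (N ` S) z = N w0" "w0 \<in> S" using oproj_in[OF fR, of z] by (rule imageE)
  then have "oproj (N ` S) z \<in> S" by (simp only: sym_nonneg_in)
  then have eS: "e \<in> S" unfolding e_def by (intro subspace_diff[OF S] z(1))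
  have "inner (N x) e = 0" if "x \<in> S" for x using oproj_orth[OF fR, of "N x" z] that by (simp add: e_def)
  then have "N e = 0" using sym_nonneg_sym[OF sym_nonneg_in[OF eS] eS] sym_nonneg_in[OF eS] by simp
  then have eK: "e \<in> ker_on S N" using eS by (simp add: ker_on_def)
  have "inner e e = 0" using z(2)[OF eK] ker_orth_range[OF w0(2) eK] w0(1)
    by (simp add: e_def inner_diff_right)
  then have zw: "z = N w0" using w0 by (simp add: e_def)
  define w where "w = w0 - oproj (ker_on S N) w0"
  have p: "oproj (ker_on S N) w0 \<in> ker_on S N" using oproj_in[OF ker_fin_dim] .
  then have "w \<in> S" unfolding w_def using w0(2) S by (auto simp: ker_on_def intro: subspace_diff)
  moreover have "inner y w = 0" if "y \<in> ker_on S N" for y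
    unfolding w_def using oproj_orth[OF ker_fin_dim that] .
  moreover have "N w = z" using lin_on_diff[OF S lin w0(2), of "oproj (ker_on S N) w0"] p zw
    by (simp add: w_def ker_on_def)
  ultimately show ?thesis using that by blast
qed

lemma sym_nonneg_range_unique:
  assumes "w \<in> S" "\<And>y. y \<in> ker_on S N \<Longrightarrow> inner y w = 0"
    and "w' \<in> S" "\<And>y. y \<in> ker_on S N \<Longrightarrow> inner y w' = 0" and "N w = N w'"
  shows "w = w'"
proof -
  have S: "subspace S" using sym_nonneg_fin_dim by (simp add: fin_dim_def)
  have "w - w' \<in> ker_on S N" using assms lin_on_diff[OF S sym_nonneg_lin, of w w'] subspace_diff[OF S]
    by (simp add: ker_on_def)
  then have "inner (w - w') (w - w') = 0" using assms(2,4) by (simp add: inner_diff_right)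
  then show ?thesis by simp
qed

end

text \<open>The component of \<open>z\<close> in the kernel is discarded first, so this is the Moore--Penrose inverse of \<open>N\<close>.\<close>

definition pinv :: "'a::real_inner set \<Rightarrow> ('a \<Rightarrow> 'a) \<Rightarrow> 'a \<Rightarrow> 'a" where
  "pinv S N z = (THE w. w \<in> S \<and> (\<forall>y\<in>ker_on S N. inner y w = 0) \<and> N w = z - oproj (ker_on S N) z)"

context
  fixes S :: "'a::real_inner set" and N
  assumes N: "sym_nonneg S N"
begin

lemma pinv_eqI:
  assumes "w \<in> S" "\<And>y. y \<in> ker_on S N \<Longrightarrow> inner y w = 0" "N w = z - oproj (ker_on S N) z"
  shows "pinv S N z = w"
  unfolding pinv_def
proof (rule the_equality)
  fix v assume v: "v \<in> S \<and> (\<forall>y\<in>ker_on S N. inner y v = 0) \<and> N v = z - oproj (ker_on S N) z"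
  show "v = w"
  proof (rule sym_nonneg_range_unique[OF N])
    show "N v = N w" using v assms(3) by metis
  qed (use v assms in blast)+
qed (use assms in blast)

lemma pinv_general:
  assumes z: "z \<in> S"
  shows pinv_in: "pinv S N z \<in> S" and pinv_orth: "y \<in> ker_on S N \<Longrightarrow> inner y (pinv S N z) = 0"
    and pinv_apply_general: "N (pinv S N z) = z - oproj (ker_on S N) z"
proof -
  note K = ker_fin_dim[OF N]
  have S: "subspace S" using sym_nonneg_fin_dim[OF N] by (simp add: fin_dim_def)
  have "z - oproj (ker_on S N) z \<in> S"
    using oproj_in[OF K, of z] z S by (auto simp: ker_on_def intro: subspace_diff)
  then obtain w where w: "w \<in> S" "\<And>y. y \<in> ker_on S N \<Longrightarrow> inner y w = 0" "N w = z - oproj (ker_on S N) z"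
    using sym_nonneg_range[OF N, of "z - oproj (ker_on S N) z"] oproj_orth[OF K] by blast
  moreover have "pinv S N z = w" using pinv_eqI w by blast
  ultimately show "pinv S N z \<in> S" "y \<in> ker_on S N \<Longrightarrow> inner y (pinv S N z) = 0"
    "N (pinv S N z) = z - oproj (ker_on S N) z" by simp_all
qed

lemma pinv_apply:
  assumes "z \<in> S" "\<And>y. y \<in> ker_on S N \<Longrightarrow> inner y z = 0"
  shows "N (pinv S N z) = z"
  using pinv_apply_general[OF assms(1)] oproj_zero[OF ker_fin_dim[OF N] assms(2)] by simp

lemma pinv_lin: "lin_on S (pinv S N)"
proof -
  note K = ker_fin_dim[OF N]
  have S: "subspace S" using sym_nonneg_fin_dim[OF N] by (simp add: fin_dim_def)
  have lin: "N (x + y) = N x + N y" "N (c *\<^sub>R x) = c *\<^sub>R N x" if "x \<in> S" "y \<in> S" for x y c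
    using sym_nonneg_lin[OF N] that by (auto simp: lin_on_def)
  show ?thesis
    unfolding lin_on_def
  proof (intro conjI ballI allI)
    fix x y assume x: "x \<in> S" and y: "y \<in> S"
    show "pinv S N (x + y) = pinv S N x + pinv S N y"
      using pinv_in[OF x] pinv_in[OF y] pinv_orth[OF x] pinv_orth[OF y]
        pinv_apply_general[OF x] pinv_apply_general[OF y]
      by (intro pinv_eqI) (auto simp: lin oproj_add[OF K] subspace_add[OF S] inner_add_right)
  next
    fix c x assume x: "x \<in> S"
    show "pinv S N (c *\<^sub>R x) = c *\<^sub>R pinv S N x"
      using pinv_in[OF x] pinv_orth[OF x] pinv_apply_general[OF x]
      by (intro pinv_eqI) (auto simp: lin oproj_scaleR[OF K] subspace_scale[OF S] scaleR_diff_right)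
  qed
qed

text \<open>A spectral gap exists in finite dimension: the pseudoinverse is bounded, and the
  Cauchy--Schwarz inequality for the form of \<open>N\<close> turns an upper bound for it into a lower bound
  for \<open>N\<close>.\<close>

lemma sym_nonneg_gap:
  obtains d where "d > 0"
    "\<And>x. x \<in> S \<Longrightarrow> (\<And>y. y \<in> ker_on S N \<Longrightarrow> inner y x = 0) \<Longrightarrow> d * (norm x)\<^sup>2 \<le> inner x (N x)"
proof -
  obtain K where K: "K > 0" "\<And>x. x \<in> S \<Longrightarrow> norm (pinv S N x) \<le> K * norm x"
    using lin_on_bound[OF sym_nonneg_fin_dim[OF N] pinv_lin] by blast
  have "1 / K * (norm x)\<^sup>2 \<le> inner x (N x)"
    if x: "x \<in> S" and o: "\<And>y. y \<in> ker_on S N \<Longrightarrow> inner y x = 0" for x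
  proof (cases "x = 0")
    case True then show ?thesis by simp
  next
    case False
    let ?w = "pinv S N x"
    have Nw: "N ?w = x" using pinv_apply[OF x o] .
    have "((norm x)\<^sup>2)\<^sup>2 = (inner x (N ?w))\<^sup>2" by (simp add: Nw power2_norm_eq_inner)
    also have "\<dots> \<le> inner x (N x) * inner ?w (N ?w)"
      using form_cauchy_schwarz[OF N x pinv_in[OF x]] .
    also have "\<dots> \<le> inner x (N x) * (K * (norm x)\<^sup>2)"
    proof (rule mult_left_mono)
      have "inner ?w (N ?w) \<le> norm ?w * norm x" unfolding Nw by (rule norm_cauchy_schwarz)
      also have "\<dots> \<le> (K * norm x) * norm x" using K(2)[OF x] by (intro mult_right_mono) auto
      finally show "inner ?w (N ?w) \<le> K * (norm x)\<^sup>2" by (simp add: power2_eq_square)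
    qed (rule sym_nonneg_nonneg[OF N x])
    finally have "(norm x)\<^sup>2 * (norm x)\<^sup>2 \<le> (norm x)\<^sup>2 * (K * inner x (N x))"
      by (simp add: power2_eq_square mult_ac)
    moreover have "0 < (norm x)\<^sup>2" using False by simp
    ultimately have "(norm x)\<^sup>2 \<le> K * inner x (N x)" by (simp only: mult_le_cancel_left_pos)
    then show ?thesis using K(1) by (simp add: field_simps)
  qed
  then show ?thesis using that[of "1 / K"] K(1) by simp
qed

end

section \<open>The hypocoercive estimate\<close>

lemma differential_inequality:
  fixes f f' :: "real \<Rightarrow> real"
  assumes "0 \<le> T" and "\<And>t. 0 \<le> t \<Longrightarrow> t \<le> T \<Longrightarrow> (f has_real_derivative f' t) (at t)"
    and "\<And>t. 0 \<le> t \<Longrightarrow> t \<le> T \<Longrightarrow> f' t \<le> r * f t"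
  shows "f T \<le> f 0 * exp (r * T)"
proof -
  have "f T * exp (- r * T) \<le> f 0 * exp (- r * 0)"
  proof (rule DERIV_nonpos_imp_nonincreasing[OF assms(1)])
    fix t assume t: "0 \<le> t" "t \<le> T"
    have "((\<lambda>t. f t * exp (- r * t)) has_real_derivative
        f' t * exp (- r * t) + exp (- r * t) * (- r) * f t) (at t)"
      by (rule derivative_eq_intros assms(2)[OF t] refl | simp)+
    moreover have "f' t * exp (- r * t) + exp (- r * t) * (- r) * f t = (f' t - r * f t) * exp (- r * t)"
      by (simp add: algebra_simps)
    moreover have "(f' t - r * f t) * exp (- r * t) \<le> 0" using assms(3)[OF t] by (simp add: mult_le_0_iff)
    ultimately show "\<exists>y. ((\<lambda>t. f t * exp (- r * t)) has_real_derivative y) (at t) \<and> y \<le> 0" by metis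
  qed
  then have "f T * exp (- r * T) * exp (r * T) \<le> f 0 * exp (r * T)" by (intro mult_right_mono) auto
  then show ?thesis by (simp add: mult.assoc exp_add[symmetric])
qed

text \<open>The semigroup is generated by \<open>A - \<gamma> N\<close>.  Dissipation comes from \<open>N\<close> only and vanishes on \<open>ker N\<close>;
  the last condition says that the compression of \<open>A\<close> to \<open>ker N\<close> is zero, so \<open>A\<close> maps \<open>ker N\<close> into the
  range of \<open>N\<close>, where \<open>N\<close> can be inverted.\<close>

locale hypocoercive =
  fixes S :: "'a::real_inner set" and A N :: "'a \<Rightarrow> 'a"
  assumes N: "sym_nonneg S N" and A_lin: "lin_on S A" and A_in: "x \<in> S \<Longrightarrow> A x \<in> S"
    and A_anti: "x \<in> S \<Longrightarrow> y \<in> S \<Longrightarrow> inner (A x) y = - inner x (A y)"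
    and no_drift: "x \<in> ker_on S N \<Longrightarrow> y \<in> ker_on S N \<Longrightarrow> inner y (A x) = 0"
begin

abbreviation F :: "'a set" where "F \<equiv> ker_on S N"
abbreviation P :: "'a \<Rightarrow> 'a" where "P \<equiv> oproj F"
abbreviation J :: "'a \<Rightarrow> 'a" where "J \<equiv> pinv S N"

text \<open>The negative of the overdamped generator: the Schur complement that remains when the part of a
  vector orthogonal to \<open>F\<close> is slaved to the part in \<open>F\<close>.\<close>

definition D :: "'a \<Rightarrow> 'a" where "D y = - P (A (J (A y)))"

lemma F_fin_dim: "fin_dim F" and S_fin_dim: "fin_dim S" and S_sub: "subspace S" and F_sub: "subspace F"
  using ker_fin_dim[OF N] sym_nonneg_fin_dim[OF N] by (auto simp: fin_dim_def)

lemma F_in_S: "x \<in> F \<Longrightarrow> x \<in> S" and N_F: "x \<in> F \<Longrightarrow> N x = 0"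
  by (auto simp: ker_on_def)

lemma P_in: "P x \<in> F" and P_in_S: "P x \<in> S"
  using oproj_in[OF F_fin_dim] F_in_S by auto

lemma JA:
  assumes "y \<in> F"
  shows "J (A y) \<in> S" "v \<in> F \<Longrightarrow> inner v (J (A y)) = 0" "N (J (A y)) = A y"
  using pinv_in[OF N] pinv_orth[OF N] pinv_apply[OF N] A_in[OF F_in_S[OF assms]] no_drift[OF assms] by auto

text \<open>Moving one factor \<open>A\<close> to the other side exhibits \<open>D\<close> as \<open>A\<^sup>* J A\<close> on \<open>F\<close>, which is where its symmetry and
  positivity come from.\<close>

lemma D_form:
  assumes "y \<in> F" "v \<in> F"
  shows "inner v (D y) = inner (J (A y)) (A v)"
  using assms JA(1)[OF assms(1)] A_anti[OF F_in_S[OF assms(2)] JA(1)[OF assms(1)]]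
  by (simp add: D_def oproj_inner[OF F_fin_dim] inner_commute)

lemma D_dirichlet: "y \<in> F \<Longrightarrow> inner y (D y) = inner (J (A y)) (N (J (A y)))"
  using D_form[of y y] JA(3)[of y] by simp

lemma D_sym_nonneg: "sym_nonneg F D"
proof -
  have lin: "lin_on F D"
  proof -
    have "lin_on S J" by (rule pinv_lin[OF N])
    then show ?thesis
      using A_lin A_in F_in_S JA(1) F_sub
      by (simp add: lin_on_def D_def oproj_add[OF F_fin_dim] oproj_scaleR[OF F_fin_dim])
  qed
  have sym: "inner (D x) y = inner x (D y)" if "x \<in> F" "y \<in> F" for x y
  proof -
    have "inner (D x) y = inner (J (A x)) (N (J (A y)))"
      using D_form[OF that] JA(3)[OF that(2)] by (simp add: inner_commute)
    also have "\<dots> = inner (J (A y)) (N (J (A x)))"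
      using sym_nonneg_sym[OF N] JA(1) that by (metis inner_commute)
    also have "\<dots> = inner x (D y)" using D_form[OF that(2,1)] JA(3)[OF that(1)] by simp
    finally show ?thesis .
  qed
  have "D x \<in> F" for x unfolding D_def using F_sub P_in by (simp add: subspace_neg)
  moreover have "0 \<le> inner x (D x)" if "x \<in> F" for x
    using D_dirichlet[OF that] sym_nonneg_nonneg[OF N JA(1)[OF that]] by simp
  ultimately show ?thesis unfolding sym_nonneg_def using F_fin_dim lin sym by blast
qed

text \<open>The energy of \<open>y\<close> for \<open>D\<close> is the energy of \<open>J A y\<close> for \<open>N\<close>, so it vanishes exactly when \<open>A y = N (J A y)\<close>
  does.  Hence \<open>D\<close> annihilates nothing beyond the vectors fixed by the whole semigroup.\<close>

lemma ker_D: "ker_on F D = {y \<in> F. A y = 0}"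
proof -
  have "A y = 0" if y: "y \<in> F" and "D y = 0" for y
    using sym_nonneg_null[OF N JA(1)[OF y]] D_dirichlet[OF y] JA(3)[OF y] that(2) by simp
  moreover have "D y = 0" if y: "y \<in> F" and a: "A y = 0" for y
    using sym_nonneg_null[OF D_sym_nonneg y] D_form[OF y y] a by simp
  ultimately show ?thesis unfolding ker_on_def[of F] by blast
qed

text \<open>The corrector.  Pairing it with the transport term \<open>A (P x)\<close> undoes \<open>D\<close> and returns \<open>\<parallel>P x\<parallel>\<^sup>2\<close>, the
  dissipation that \<open>N\<close> does not provide.\<close>

definition C :: "'a \<Rightarrow> 'a" where "C x = J (A (pinv F D (P x)))"

lemma C_lin: "lin_on S C"
proof -
  have "lin_on F (pinv F D)" by (rule pinv_lin[OF D_sym_nonneg])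
  moreover have "lin_on S J" by (rule pinv_lin[OF N])
  moreover have "pinv F D (P x) \<in> F" for x using pinv_in[OF D_sym_nonneg P_in] .
  ultimately show ?thesis
    using A_lin A_in F_in_S P_in
    by (simp add: lin_on_def C_def oproj_add[OF F_fin_dim] oproj_scaleR[OF F_fin_dim])
qed

lemma C_props:
  assumes x: "x \<in> S" and o: "\<And>v. v \<in> ker_on F D \<Longrightarrow> inner v x = 0"
  obtains u where "u \<in> F" "\<And>v. v \<in> ker_on F D \<Longrightarrow> inner v u = 0" "D u = P x" "C x = J (A u)"
    "C x \<in> S" "\<And>v. v \<in> F \<Longrightarrow> inner v (C x) = 0" "N (C x) = A u"
    "inner (C x) (N (C x)) = inner u (P x)"
proof -
  let ?u = "pinv F D (P x)"
  have u: "?u \<in> F" using pinv_in[OF D_sym_nonneg P_in] .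
  have "inner v (P x) = 0" if "v \<in> ker_on F D" for v
    using o[OF that] that oproj_inner[OF F_fin_dim, of v x] by (auto simp: ker_on_def)
  then have Du: "D ?u = P x" by (rule pinv_apply[OF D_sym_nonneg P_in])
  have C: "C x = J (A ?u)" by (simp add: C_def)
  show ?thesis
    using that[OF u pinv_orth[OF D_sym_nonneg P_in] Du C] JA[OF u] D_dirichlet[OF u] Du C by simp
qed

end

locale hypocoercive_gaps = hypocoercive +
  fixes lS lO K1 K2 :: real
  assumes lS: "lS > 0" and lO: "lO > 0" and K1: "K1 \<ge> 0" and K2: "K2 \<ge> 0"
    and gapS: "x \<in> S \<Longrightarrow> (\<And>v. v \<in> F \<Longrightarrow> inner v x = 0) \<Longrightarrow> lS * (norm x)\<^sup>2 \<le> inner x (N x)"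
    and gapO: "y \<in> F \<Longrightarrow> (\<And>v. v \<in> ker_on F D \<Longrightarrow> inner v y = 0) \<Longrightarrow> lO * (norm y)\<^sup>2 \<le> inner y (D y)"
    and second_order_bound: "y \<in> F \<Longrightarrow> norm (A (J (A y)) - P (A (J (A y)))) \<le> K1 * norm (D y) + K2 * sqrt (inner y (D y))"
begin

text \<open>The part of \<open>x\<close> orthogonal to \<open>F\<close> is controlled by the dissipation \<open>\<langle>x, N x\<rangle>\<close>.\<close>

lemma fast_part:
  assumes x: "x \<in> S"
  shows "x - P x \<in> S" "v \<in> F \<Longrightarrow> inner v (x - P x) = 0" "N (x - P x) = N x"
    "inner (x - P x) (N x) = inner x (N x)" "sqrt lS * norm (x - P x) \<le> sqrt (inner x (N x))"
proof -
  show z: "x - P x \<in> S" using x P_in_S S_sub by (simp add: subspace_diff)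
  show o: "inner v (x - P x) = 0" if "v \<in> F" for v using oproj_orth[OF F_fin_dim that] .
  show Nz: "N (x - P x) = N x"
    using lin_on_diff[OF S_sub sym_nonneg_lin[OF N] x P_in_S] N_F[OF P_in] by simp
  show zz: "inner (x - P x) (N x) = inner x (N x)"
    using ker_orth_range[OF N x P_in] by (simp add: inner_diff_left)
  have "lS * (norm (x - P x))\<^sup>2 \<le> inner x (N x)" using gapS[OF z o] Nz zz by simp
  then have "sqrt (lS * (norm (x - P x))\<^sup>2) \<le> sqrt (inner x (N x))" by (rule real_sqrt_le_mono)
  then show "sqrt lS * norm (x - P x) \<le> sqrt (inner x (N x))" by (simp add: real_sqrt_mult)
qed

text \<open>By the gap of \<open>D\<close> and the Cauchy--Schwarz inequality, \<open>q\<^sup>2 \<le> \<parallel>u\<parallel>\<^sup>2 \<parallel>D u\<parallel>\<^sup>2 \<le> (q / lO) \<parallel>D u\<parallel>\<^sup>2\<close> for \<open>q = \<langle>u, D u\<rangle>\<close>,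
  and one factor \<open>q\<close> cancels.\<close>

lemma corrector_energy:
  assumes "u \<in> F" "\<And>v. v \<in> ker_on F D \<Longrightarrow> inner v u = 0"
  shows "0 \<le> inner u (D u)" "sqrt (inner u (D u)) \<le> norm (D u) / sqrt lO"
proof -
  show nn: "0 \<le> inner u (D u)" using sym_nonneg_nonneg[OF D_sym_nonneg assms(1)] .
  let ?q = "inner u (D u)"
  have "?q * ?q \<le> (norm u)\<^sup>2 * (norm (D u))\<^sup>2"
    using Cauchy_Schwarz_ineq[of u "D u"] by (simp add: power2_eq_square power2_norm_eq_inner[symmetric])
  also have "\<dots> \<le> (?q / lO) * (norm (D u))\<^sup>2"
    using gapO[OF assms] lO by (intro mult_right_mono) (auto simp: field_simps)
  finally have *: "?q * ?q \<le> ?q * ((norm (D u))\<^sup>2 / lO)" by simp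
  have "?q \<le> (norm (D u))\<^sup>2 / lO"
  proof (cases "?q = 0")
    case True show ?thesis unfolding True using lO by simp
  next
    case False then have "?q > 0" using nn by simp
    then show ?thesis using * by (simp only: mult_le_cancel_left_pos)
  qed
  then have "sqrt ?q \<le> sqrt ((norm (D u))\<^sup>2 / lO)" by (rule real_sqrt_le_mono)
  then show "sqrt ?q \<le> norm (D u) / sqrt lO" by (simp add: real_sqrt_divide)
qed

definition drift :: real where "drift = (K1 + K2 / sqrt lO) / sqrt lS"

lemma drift_nonneg: "0 \<le> drift" using K1 K2 lO lS by (simp add: drift_def)

lemma corrector_size:
  assumes x: "x \<in> S" and o: "\<And>v. v \<in> ker_on F D \<Longrightarrow> inner v x = 0"
  shows "\<bar>inner x (C x)\<bar> \<le> norm (x - P x) * norm (P x) / (sqrt lS * sqrt lO)"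
proof -
  obtain u where u: "u \<in> F" "\<And>v. v \<in> ker_on F D \<Longrightarrow> inner v u = 0" "D u = P x"
    "C x \<in> S" "\<And>v. v \<in> F \<Longrightarrow> inner v (C x) = 0" "inner (C x) (N (C x)) = inner u (P x)"
    using C_props[OF x o] by metis
  have "sqrt (lS * (norm (C x))\<^sup>2) \<le> sqrt (inner u (D u))"
    using gapS[OF u(4,5)] u(6,3) by (intro real_sqrt_le_mono) simp
  then have "sqrt lS * norm (C x) \<le> norm (P x) / sqrt lO"
    using corrector_energy(2)[OF u(1,2)] u(3) by (simp add: real_sqrt_mult)
  then have "norm (C x) \<le> norm (P x) / (sqrt lS * sqrt lO)" using lS lO by (simp add: field_simps)
  moreover have "inner x (C x) = inner (x - P x) (C x)" using u(5)[OF P_in] by (simp add: inner_diff_left)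
  moreover have "\<bar>inner (x - P x) (C x)\<bar> \<le> norm (x - P x) * norm (C x)" by (rule Cauchy_Schwarz_ineq2)
  ultimately show ?thesis
    using mult_left_mono[of "norm (C x)" "norm (P x) / (sqrt lS * sqrt lO)" "norm (x - P x)"] by simp
qed

text \<open>The heart of the estimate.  Write \<open>y = P x\<close>, \<open>z = x - y\<close>, \<open>s\<^sup>2 = \<langle>x, N x\<rangle>\<close> and \<open>w = C x = J A u\<close> with
  \<open>D u = y\<close>.  The derivative of \<open>\<langle>x, C x\<rangle>\<close> along the flow consists of four terms:
  \<open>\<langle>A y, w\<rangle> = \<parallel>y\<parallel>\<^sup>2\<close>, the gain;
  \<open>\<langle>A z, w\<rangle> = - \<langle>z, (1 - P) A J A u\<rangle>\<close>, which the second-order bound controls by \<open>drift s \<parallel>y\<parallel>\<close>;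
  \<open>- \<gamma> \<langle>N x, w\<rangle>\<close>, at most \<open>\<gamma> s \<parallel>y\<parallel> / \<surd>lO\<close> by the Cauchy--Schwarz inequality for the form of \<open>N\<close>;
  and \<open>\<langle>x, C g\<rangle>\<close>, where the energy of \<open>C g\<close> equals \<open>- \<langle>N x, C g\<rangle>\<close>, so it is at most \<open>s\<^sup>2\<close> and the term at most \<open>s\<^sup>2 / lS\<close>.\<close>

lemma corrector_derivative:
  assumes x: "x \<in> S" and o: "\<And>v. v \<in> ker_on F D \<Longrightarrow> inner v x = 0" and \<gamma>: "0 < \<gamma>"
  defines "g \<equiv> A x - \<gamma> *\<^sub>R N x"
  shows "- (inner g (C x) + inner x (C g))
    \<le> - (norm (P x))\<^sup>2 / 2 + ((\<gamma> / sqrt lO + drift)\<^sup>2 / 2 + 1 / lS) * inner x (N x)"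
proof -
  define y where "y = P x"
  define z where "z = x - P x"
  define s where "s = sqrt (inner x (N x))"
  have xNx: "0 \<le> inner x (N x)" using sym_nonneg_nonneg[OF N x] .
  then have s: "0 \<le> s" "s * s = inner x (N x)" by (simp_all add: s_def)
  have yF: "y \<in> F" and yS: "y \<in> S" unfolding y_def using P_in P_in_S by auto
  note fp = fast_part[OF x]
  have zS: "z \<in> S" and zo: "\<And>v. v \<in> F \<Longrightarrow> inner v z = 0" and z_s: "norm z \<le> s / sqrt lS"
    using fp(1,2,5) lS by (auto simp: z_def s_def field_simps)
  have Ax: "A x = A y + A z" using A_lin yS zS unfolding lin_on_def y_def z_def
    by (metis add.commute diff_add_cancel)
  obtain u where u: "u \<in> F" "\<And>v. v \<in> ker_on F D \<Longrightarrow> inner v u = 0" "D u = y" "C x = J (A u)"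
    "C x \<in> S" "\<And>v. v \<in> F \<Longrightarrow> inner v (C x) = 0" "N (C x) = A u"
    "inner (C x) (N (C x)) = inner u y"
    using C_props[OF x o] unfolding y_def by metis
  define w where "w = C x"
  have q: "sqrt (inner u y) \<le> norm y / sqrt lO" "0 \<le> inner u y"
    using corrector_energy[OF u(1,2)] u(3) by simp_all
  have T1: "inner (A y) w = (norm y)\<^sup>2"
    using D_form[OF u(1) yF] u(3,4) by (simp add: w_def inner_commute power2_norm_eq_inner)
  have T2: "\<bar>inner (A z) w\<bar> \<le> drift * (s * norm y)"
  proof -
    have "inner (A z) w = - inner z (A w)" using A_anti[OF zS] u(5) by (simp add: w_def)
    also have "inner z (A w) = inner z (A w - P (A w))"
      using zo[OF P_in, of "A w"] by (simp add: inner_diff_right inner_commute)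
    finally have "\<bar>inner (A z) w\<bar> \<le> norm z * norm (A w - P (A w))"
      using Cauchy_Schwarz_ineq2[of z "A w - P (A w)"] by simp
    also have "\<dots> \<le> (s / sqrt lS) * (K1 * norm y + K2 * sqrt (inner u y))"
      using second_order_bound[OF u(1)] u(3,4) s lS by (intro mult_mono z_s) (auto simp: w_def)
    also have "\<dots> \<le> (s / sqrt lS) * (K1 * norm y + K2 * (norm y / sqrt lO))"
      using q K2 s lS by (intro mult_left_mono add_left_mono) auto
    also have "\<dots> = drift * (s * norm y)" by (simp add: drift_def algebra_simps add_divide_distrib)
    finally show ?thesis .
  qed
  have T3: "\<bar>inner (N x) w\<bar> \<le> s * (norm y / sqrt lO)"
  proof -
    have "(inner w (N x))\<^sup>2 \<le> inner w (N w) * inner x (N x)"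
      using form_cauchy_schwarz[OF N _ x] u(5) by (simp add: w_def)
    then have "sqrt ((inner w (N x))\<^sup>2) \<le> sqrt (inner u y * inner x (N x))"
      using u(8) by (intro real_sqrt_le_mono) (simp add: w_def)
    then have "\<bar>inner (N x) w\<bar> \<le> sqrt (inner u y) * s" by (simp add: real_sqrt_mult s_def inner_commute)
    also have "\<dots> \<le> (norm y / sqrt lO) * s" using q s by (intro mult_right_mono) auto
    finally show ?thesis by (simp add: mult.commute)
  qed
  have T4: "\<bar>inner x (C g)\<bar> \<le> s * s / lS"
  proof -
    have gS: "g \<in> S" unfolding g_def using A_in[OF x] sym_nonneg_in[OF N x] S_sub
      by (intro subspace_diff subspace_scale)
    have go: "inner v g = 0" if "v \<in> ker_on F D" for v
    proof -
      have v: "v \<in> F" "A v = 0" using that unfolding ker_D by auto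
      then show ?thesis using A_anti[OF F_in_S[OF v(1)] x] ker_orth_range[OF N x v(1)]
        by (simp add: g_def inner_diff_right)
    qed
    obtain p where p: "p \<in> F" "C g \<in> S" "\<And>v. v \<in> F \<Longrightarrow> inner v (C g) = 0" "N (C g) = A p"
      "inner (C g) (N (C g)) = inner p (P g)"
      using C_props[OF gS go] by metis
    define w' where "w' = C g"
    define s' where "s' = sqrt (inner w' (N w'))"
    have nn: "0 \<le> inner w' (N w')" using sym_nonneg_nonneg[OF N p(2)] by (simp add: w'_def)
    then have s': "0 \<le> s'" "s' * s' = inner w' (N w')" by (simp_all add: s'_def)
    have "inner p (P g) = inner p (A x)"
      using oproj_inner[OF F_fin_dim p(1)] ker_orth_range[OF N x p(1)]
      by (simp add: g_def inner_diff_right)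
    also have "\<dots> = - inner x (N w')"
      using A_anti[OF F_in_S[OF p(1)] x] p(4) by (simp add: w'_def inner_commute)
    finally have eq: "s' * s' = - inner x (N w')" using s' p(5) by (simp add: w'_def)
    have "(inner x (N w'))\<^sup>2 \<le> (s * s) * (s' * s')"
      using form_cauchy_schwarz[OF N x p(2)] s s' by (simp add: w'_def)
    moreover have "(inner x (N w'))\<^sup>2 = (s' * s')\<^sup>2" unfolding eq by simp
    ultimately have "(s' * s')\<^sup>2 \<le> (s * s')\<^sup>2" by (simp add: power2_eq_square mult_ac)
    then have "s' * s' \<le> s * s'" using s s' by (simp add: power2_le_iff_abs_le)
    then have ss: "s' \<le> s" using s(1) s'(1) mult_right_le_imp_le[of s' s' s] by linarith
    have "lS * (norm w')\<^sup>2 \<le> s' * s'" using gapS[OF p(2,3)] s' by (simp add: w'_def)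
    then have "sqrt (lS * (norm w')\<^sup>2) \<le> sqrt (s' * s')" by (rule real_sqrt_le_mono)
    then have "norm w' \<le> s' / sqrt lS" using s'(1) lS by (simp only: real_sqrt_mult) (simp add: field_simps)
    then have w's: "norm w' \<le> s / sqrt lS"
      using ss lS by (meson divide_right_mono order_trans real_sqrt_ge_zero less_imp_le)
    have "inner x (C g) = inner z w'" using p(3)[OF P_in] by (simp add: z_def w'_def inner_diff_left)
    also have "\<bar>\<dots>\<bar> \<le> norm z * norm w'" by (rule Cauchy_Schwarz_ineq2)
    also have "\<dots> \<le> (s / sqrt lS) * (s / sqrt lS)" using z_s w's s lS by (intro mult_mono) auto
    also have "\<dots> = s * s / lS" using lS by simp
    finally show ?thesis .
  qed
  define k where "k = \<gamma> / sqrt lO + drift"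
  have "inner g w = (norm y)\<^sup>2 + inner (A z) w - \<gamma> * inner (N x) w"
    by (simp add: g_def Ax inner_diff_left inner_add_left T1)
  moreover have "\<gamma> * inner (N x) w \<le> \<gamma> * (s * (norm y / sqrt lO))"
    using T3 \<gamma> by (intro mult_left_mono) auto
  ultimately have "- (inner g w + inner x (C g)) \<le> - (norm y)\<^sup>2 + k * s * norm y + s * s / lS"
    using T2 T4 by (simp add: k_def algebra_simps)
  also have "k * s * norm y \<le> (norm y)\<^sup>2 / 2 + k\<^sup>2 / 2 * (s * s)"
    using zero_le_power2[of "norm y - k * s"] by (simp add: power2_eq_square algebra_simps)
  finally show ?thesis
    unfolding w_def[symmetric] y_def[symmetric] k_def[symmetric] s(2)[symmetric] by (simp add: algebra_simps)
qed

text \<open>The energy \<open>\<parallel>x\<parallel>\<^sup>2 / 2 - \<epsilon> \<langle>x, C x\<rangle>\<close> differs from \<open>\<parallel>x\<parallel>\<^sup>2 / 2\<close> by at most half of it and decays exponentially.  The value of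
  \<open>\<epsilon>\<close> is dictated by absorbing the error terms of the corrector into half of the dissipation
  \<open>\<gamma> \<langle>x, N x\<rangle>\<close>; the arithmetic-geometric mean inequality then makes the corrector small enough and
  \<open>\<epsilon> \<le> \<gamma> lS\<close>.\<close>

theorem decay:
  fixes x :: "real \<Rightarrow> 'a"
  assumes \<gamma>: "0 < \<gamma>" and T: "0 \<le> T"
    and x_in: "\<And>t. 0 \<le> t \<Longrightarrow> x t \<in> S"
    and x_deriv: "\<And>t. 0 \<le> t \<Longrightarrow> (x has_vector_derivative (A (x t) - \<gamma> *\<^sub>R N (x t))) (at t)"
    and x0: "\<And>v. v \<in> ker_on F D \<Longrightarrow> inner v (x 0) = 0"
  shows "norm (x T) \<le> 2 * exp (- (\<gamma> / (\<gamma>\<^sup>2 * (6 / lO) + 6 * (1 / lS + 1 + drift)\<^sup>2)) * T) * norm (x 0)"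
proof -
  define g where "g t = A (x t) - \<gamma> *\<^sub>R N (x t)" for t
  define R where "R = 1 / lS + 1 + drift"
  define den where "den = 2 * (\<gamma>\<^sup>2 / lO) + 2 * R\<^sup>2"
  define \<epsilon> where "\<epsilon> = \<gamma> / den"
  have lS1: "0 < 1 / lS" using lS by simp
  have R2: "drift\<^sup>2 + 2 * (1 / lS) \<le> R\<^sup>2"
  proof -
    have "R\<^sup>2 = drift\<^sup>2 + 2 * (1 / lS) + ((1 / lS)\<^sup>2 + 1 + 2 * drift * (1 / lS + 1))"
      by (simp add: R_def power2_eq_square algebra_simps)
    moreover have "0 \<le> (1 / lS)\<^sup>2 + 1 + 2 * drift * (1 / lS + 1)" using drift_nonneg lS1 by simp
    ultimately show ?thesis by linarith
  qed
  have den: "den > 0" "2 * (\<gamma>\<^sup>2 / lO) + 4 / lS \<le> den"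
  proof -
    have "0 \<le> \<gamma>\<^sup>2 / lO" using lO by simp
    moreover have "2 / lS \<le> R\<^sup>2" using R2 by (simp add: algebra_simps) (smt (verit) zero_le_power2)
    moreover have "0 < 2 / lS" using lS by simp
    ultimately have "0 < \<gamma>\<^sup>2 / lO + R\<^sup>2" "\<gamma>\<^sup>2 / lO + 2 / lS \<le> \<gamma>\<^sup>2 / lO + R\<^sup>2" by linarith+
    then show "den > 0" "2 * (\<gamma>\<^sup>2 / lO) + 4 / lS \<le> den" by (simp_all add: den_def)
  qed
  have \<epsilon>: "\<epsilon> > 0" using \<gamma> den by (simp add: \<epsilon>_def)
  have \<epsilon>den: "\<epsilon> * den = \<gamma>" using den by (simp add: \<epsilon>_def)
  \<comment> \<open>\<open>e1\<close> absorbs the error terms into half of the dissipation, \<open>e2\<close> lets the other half damp the fast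
    part at rate \<open>\<epsilon> / 2\<close>, and \<open>e3\<close> keeps the corrector below \<open>\<parallel>x\<parallel>\<^sup>2 / 4\<close>.\<close>
  have e1: "\<epsilon> * ((\<gamma> / sqrt lO + drift)\<^sup>2 / 2 + 1 / lS) \<le> \<gamma> / 2"
  proof -
    let ?k = "(\<gamma> / sqrt lO + drift)\<^sup>2"
    have "?k \<le> 2 * (\<gamma> / sqrt lO)\<^sup>2 + 2 * drift\<^sup>2"
      using zero_le_power2[of "\<gamma> / sqrt lO - drift"] unfolding power2_sum power2_diff by linarith
    also have "(\<gamma> / sqrt lO)\<^sup>2 = \<gamma>\<^sup>2 / lO" using lO by (simp add: power_divide)
    finally have "?k + 2 * (1 / lS) \<le> den" using R2 lS1 unfolding den_def by linarith
    then have "\<epsilon> * (?k + 2 * (1 / lS)) \<le> \<epsilon> * den" using \<epsilon> by (intro mult_left_mono) auto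
    then show ?thesis unfolding \<epsilon>den by (simp add: algebra_simps)
  qed
  have e2: "\<epsilon> \<le> \<gamma> * lS"
  proof -
    have "4 / lS \<le> den" using den(2) lO by (smt (verit) divide_nonneg_pos zero_le_power2)
    then have "\<epsilon> * (4 / lS) \<le> \<gamma>" using \<epsilon> \<epsilon>den by (metis mult_left_mono less_imp_le)
    then have "\<epsilon> * 4 \<le> \<gamma> * lS" using lS by (simp add: field_simps)
    then show ?thesis using \<epsilon> by linarith
  qed
  have e3: "\<epsilon> / (sqrt lS * sqrt lO) \<le> 1 / 2"
  proof -
    have "0 \<le> (\<gamma> / sqrt lO - 1 / sqrt lS)\<^sup>2" by simp
    also have "\<dots> = \<gamma>\<^sup>2 / lO + 1 / lS - 2 * (\<gamma> / (sqrt lS * sqrt lO))"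
      using lS lO by (simp add: power2_diff power_divide mult_ac)
    finally have "2 * (\<gamma> / (sqrt lS * sqrt lO)) \<le> den / 2"
      using den(2) lS1 times_divide_eq_right[of 4 1 lS] by linarith
    then have "\<epsilon> * (2 * (\<gamma> / (sqrt lS * sqrt lO))) \<le> \<epsilon> * (den / 2)" using \<epsilon> by (intro mult_left_mono) auto
    then have "\<gamma> * (\<epsilon> / (sqrt lS * sqrt lO)) \<le> \<gamma> * (1 / 4)" using \<epsilon>den by (simp add: mult_ac)
    then have "\<epsilon> / (sqrt lS * sqrt lO) \<le> 1 / 4" using \<gamma> by (rule mult_left_le_imp_le)
    then show ?thesis by linarith
  qed
  have xo: "inner v (x t) = 0" if v: "v \<in> ker_on F D" and t: "0 \<le> t" for v t
  proof -
    have vF: "v \<in> F" "A v = 0" using v unfolding ker_D by auto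
    have d: "((\<lambda>t. inner v (x t)) has_real_derivative 0) (at t)" if "0 \<le> t" for t
    proof -
      have "((\<lambda>t. inner v (x t)) has_vector_derivative inner v (g t)) (at t)"
        using bounded_linear.has_vector_derivative[OF bounded_linear_inner_right x_deriv[OF that]]
        by (simp add: g_def)
      moreover have "inner v (g t) = 0"
        using A_anti[OF F_in_S[OF vF(1)] x_in[OF that]] ker_orth_range[OF N x_in[OF that] vF(1)] vF(2)
        by (simp add: g_def inner_diff_right)
      ultimately show ?thesis by (simp add: has_real_derivative_iff_has_vector_derivative)
    qed
    have "inner v (x t) \<le> inner v (x 0) * exp (0 * t)"
      by (rule differential_inequality[OF t d]) auto
    moreover have "- inner v (x t) \<le> - inner v (x 0) * exp (0 * t)"
      by (rule differential_inequality[OF t DERIV_minus[OF d]]) auto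
    ultimately show ?thesis using x0[OF v] by simp
  qed
  obtain C' where C': "bounded_linear C'" "\<And>x. x \<in> S \<Longrightarrow> C' x = C x"
    using lin_on_extends[OF S_fin_dim C_lin] by blast
  have gS: "g t \<in> S" if "0 \<le> t" for t
    unfolding g_def using A_in[OF x_in[OF that]] sym_nonneg_in[OF N x_in[OF that]] S_sub
    by (intro subspace_diff subspace_scale)
  define E where "E t = inner (x t) (x t) / 2 - \<epsilon> * inner (x t) (C' (x t))" for t
  define E' where "E' t = inner (x t) (g t) - \<epsilon> * (inner (g t) (C' (x t)) + inner (x t) (C' (g t)))" for t
  have E_deriv: "(E has_real_derivative E' t) (at t)" if "0 \<le> t" for t
  proof -
    have dx: "(x has_vector_derivative g t) (at t)" using x_deriv[OF that] by (simp add: g_def)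
    have dC: "((\<lambda>t. C' (x t)) has_vector_derivative C' (g t)) (at t)"
      by (rule bounded_linear.has_vector_derivative[OF C'(1) dx])
    have 1: "((\<lambda>t. inner (x t) (x t)) has_real_derivative 2 * inner (x t) (g t)) (at t)"
      using bounded_bilinear.has_vector_derivative[OF bounded_bilinear_inner dx dx]
      by (simp add: has_real_derivative_iff_has_vector_derivative inner_commute)
    have 2: "((\<lambda>t. inner (x t) (C' (x t))) has_real_derivative inner (g t) (C' (x t)) + inner (x t) (C' (g t))) (at t)"
      using bounded_bilinear.has_vector_derivative[OF bounded_bilinear_inner dx dC]
      by (simp add: has_real_derivative_iff_has_vector_derivative add.commute)
    show ?thesis unfolding E_def E'_def
      using DERIV_diff[OF DERIV_cdivide[OF 1, of 2] DERIV_cmult[OF 2, of \<epsilon>]] by simp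
  qed
  have split: "inner (x t) (x t) = (norm (P (x t)))\<^sup>2 + (norm (x t - P (x t)))\<^sup>2" if "0 \<le> t" for t
    using fast_part(2)[OF x_in[OF that] P_in, of "x t"]
    by (simp add: power2_norm_eq_inner inner_diff_left inner_diff_right inner_commute)
  have E_near: "\<bar>E t - inner (x t) (x t) / 2\<bar> \<le> inner (x t) (x t) / 4" if t: "0 \<le> t" for t
  proof -
    let ?Y = "norm (P (x t))" and ?Z = "norm (x t - P (x t))"
    have "\<bar>\<epsilon> * inner (x t) (C' (x t))\<bar> \<le> \<epsilon> * (?Z * ?Y / (sqrt lS * sqrt lO))"
      unfolding abs_mult C'(2)[OF x_in[OF t]]
      using corrector_size[OF x_in[OF t] xo[OF _ t]] \<epsilon> by (intro mult_mono) auto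
    also have "\<dots> = \<epsilon> / (sqrt lS * sqrt lO) * (?Z * ?Y)" by simp
    also have "\<dots> \<le> 1 / 2 * (?Z * ?Y)" using e3 by (intro mult_right_mono) auto
    also have "\<dots> \<le> inner (x t) (x t) / 4"
      using zero_le_power2[of "?Z - ?Y"] split[OF t] by (simp add: power2_diff mult_ac)
    finally show ?thesis by (simp add: E_def)
  qed
  have E_bounds: "E t \<le> 3 / 4 * inner (x t) (x t)" "inner (x t) (x t) / 4 \<le> E t" if t: "0 \<le> t" for t
    using E_near[OF t] unfolding abs_le_iff by (simp_all add: field_simps)
  have E'_le: "E' t \<le> (- (2 * \<epsilon> / 3)) * E t" if t: "0 \<le> t" for t
  proof -
    let ?Y = "(norm (P (x t)))\<^sup>2" and ?Z = "(norm (x t - P (x t)))\<^sup>2" and ?s = "inner (x t) (N (x t))"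
    let ?k = "(\<gamma> / sqrt lO + drift)\<^sup>2 / 2 + 1 / lS"
    note xt = x_in[OF t]
    have s: "0 \<le> ?s" using sym_nonneg_nonneg[OF N xt] .
    have "- (inner (g t) (C' (x t)) + inner (x t) (C' (g t))) \<le> - ?Y / 2 + ?k * ?s"
      using corrector_derivative[OF xt xo[OF _ t] \<gamma>] C'(2)[OF xt] C'(2)[OF gS[OF t]] by (simp add: g_def)
    then have "\<epsilon> * - (inner (g t) (C' (x t)) + inner (x t) (C' (g t))) \<le> \<epsilon> * (- ?Y / 2 + ?k * ?s)"
      using \<epsilon> by (intro mult_left_mono) auto
    also have "\<dots> = - \<epsilon> * ?Y / 2 + \<epsilon> * ?k * ?s" by (simp add: algebra_simps)
    also have "\<dots> \<le> - \<epsilon> * ?Y / 2 + \<gamma> / 2 * ?s" using e1 s by (intro add_left_mono mult_right_mono)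
    finally have b: "- \<epsilon> * (inner (g t) (C' (x t)) + inner (x t) (C' (g t))) \<le> - \<epsilon> * ?Y / 2 + \<gamma> / 2 * ?s"
      by (simp only: mult_minus_left mult_minus_right)
    have "inner (x t) (A (x t)) = 0" using A_anti[OF xt xt] by (simp add: inner_commute)
    then have "inner (x t) (g t) = - \<gamma> * ?s" by (simp add: g_def inner_diff_right)
    with b have "E' t \<le> - \<epsilon> * ?Y / 2 - \<gamma> * ?s / 2" by (simp add: E'_def)
    moreover have "\<epsilon> * ?Z \<le> \<gamma> * ?s"
    proof -
      have "\<epsilon> * ?Z \<le> \<gamma> * lS * ?Z" using e2 by (intro mult_right_mono) auto
      also have "\<dots> \<le> \<gamma> * ?s"
        using gapS[OF fast_part(1,2)[OF xt]] fast_part(3,4)[OF xt] \<gamma> by (simp add: mult.assoc)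
      finally show ?thesis .
    qed
    ultimately have "E' t \<le> - \<epsilon> * inner (x t) (x t) / 2" using split[OF t] by (simp add: algebra_simps)
    moreover have "\<epsilon> * E t \<le> \<epsilon> * (3 / 4 * inner (x t) (x t))"
      using E_bounds(1)[OF t] \<epsilon> by (intro mult_left_mono) auto
    ultimately show ?thesis by (simp add: field_simps)
  qed
  define e where "e = exp ((- (2 * \<epsilon> / 3)) * T)"
  have e: "0 < e" by (simp add: e_def)
  have "E T \<le> E 0 * e" unfolding e_def by (rule differential_inequality[OF T E_deriv E'_le])
  also have "\<dots> \<le> (3 / 4 * inner (x 0) (x 0)) * e"
    using E_bounds(1)[of 0] e by (intro mult_right_mono) auto
  finally have "inner (x T) (x T) \<le> 3 * (inner (x 0) (x 0) * e)" using E_bounds(2)[OF T] by simp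
  also have "\<dots> \<le> 4 * (inner (x 0) (x 0) * e)" using e by (intro mult_right_mono) auto
  finally have "(norm (x T))\<^sup>2 \<le> 4 * (norm (x 0))\<^sup>2 * e" by (simp add: power2_norm_eq_inner mult.assoc)
  also have "e = (exp (- (\<epsilon> / 3) * T))\<^sup>2"
    by (simp add: e_def power2_eq_square exp_add[symmetric])
  finally have "(norm (x T))\<^sup>2 \<le> (2 * exp (- (\<epsilon> / 3) * T) * norm (x 0))\<^sup>2"
    by (simp add: power_mult_distrib mult_ac)
  then have "norm (x T) \<le> 2 * exp (- (\<epsilon> / 3) * T) * norm (x 0)" by (rule power2_le_imp_le) simp
  moreover have "\<epsilon> / 3 = \<gamma> / (\<gamma>\<^sup>2 * (6 / lO) + 6 * R\<^sup>2)"
    by (simp add: \<epsilon>_def den_def algebra_simps)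
  ultimately show ?thesis by (simp add: R_def)
qed

end

text \<open>Along a trajectory of \<open>A + \<gamma> B\<close> the flow of \<open>B\<close> can only increase the Rayleigh quotient of \<open>B\<close>, so this
  quotient decreases at a rate that comes from \<open>A\<close> and does not depend on \<open>\<gamma>\<close>.  If it were positive
  initially, it would stay bounded below by a positive number up to a time independent of \<open>\<gamma>\<close>, and by
  then the squared norm would have grown by a factor exponential in \<open>\<gamma>\<close>.\<close>

lemma nonpositive_if_trajectories_bounded:
  fixes S :: "'a::real_inner set"
  assumes S: "fin_dim S" and A: "lin_on S A" "\<And>x. x \<in> S \<Longrightarrow> A x \<in> S"
    and A_anti: "\<And>x. x \<in> S \<Longrightarrow> inner x (A x) = 0"
    and B: "lin_on S B" "\<And>x. x \<in> S \<Longrightarrow> B x \<in> S"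
    and B_sym: "\<And>x y. x \<in> S \<Longrightarrow> y \<in> S \<Longrightarrow> inner (B x) y = inner x (B y)"
    and X: "X \<in> S"
    and traj: "\<And>\<gamma>. 0 < \<gamma> \<Longrightarrow> \<exists>x. x 0 = X \<and> (\<forall>t\<ge>0. x t \<in> S \<and> norm (x t) \<le> K \<and>
        (x has_vector_derivative (A (x t) + \<gamma> *\<^sub>R B (x t))) (at t))"
  shows "inner X (B X) \<le> 0"
proof (rule ccontr)
  assume "\<not> inner X (B X) \<le> 0"
  then have pos: "0 < inner X (B X)" by simp
  then have X0: "X \<noteq> 0" by auto
  obtain a where a: "a > 0" "\<And>x. x \<in> S \<Longrightarrow> norm (A x) \<le> a * norm x" using lin_on_bound[OF S A(1)] by blast
  obtain b where b: "b > 0" "\<And>x. x \<in> S \<Longrightarrow> norm (B x) \<le> b * norm x" using lin_on_bound[OF S B(1)] by blast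
  obtain B' where B': "bounded_linear B'" "\<And>x. x \<in> S \<Longrightarrow> B' x = B x" using lin_on_extends[OF S B(1)] by blast
  define q0 where "q0 = inner X (B X) / inner X X"
  have q0: "q0 > 0" using pos X0 by (simp add: q0_def)
  define \<tau> where "\<tau> = q0 / (4 * a * b)"
  have \<tau>: "\<tau> > 0" using q0 a b by (simp add: \<tau>_def)
  have growth: "inner X X * (1 + \<gamma> * (q0 * \<tau>)) \<le> K\<^sup>2" if \<gamma>: "0 < \<gamma>" for \<gamma>
  proof -
    obtain x where x: "x 0 = X" "\<And>t. 0 \<le> t \<Longrightarrow> x t \<in> S" "\<And>t. 0 \<le> t \<Longrightarrow> norm (x t) \<le> K"
      "\<And>t. 0 \<le> t \<Longrightarrow> (x has_vector_derivative (A (x t) + \<gamma> *\<^sub>R B (x t))) (at t)"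
      using traj[OF \<gamma>] by blast
    define f where "f t = inner (x t) (x t)" for t
    define h where "h t = inner (x t) (B' (x t))" for t
    define h' where "h' t = 2 * \<gamma> * inner (B (x t)) (B (x t)) + 2 * inner (B (x t)) (A (x t))" for t
    have f_deriv: "(f has_real_derivative 2 * \<gamma> * h t) (at t)" if t: "0 \<le> t" for t
    proof -
      have "(f has_vector_derivative 2 * inner (x t) (A (x t) + \<gamma> *\<^sub>R B (x t))) (at t)"
        unfolding f_def
        using bounded_bilinear.has_vector_derivative[OF bounded_bilinear_inner x(4)[OF t] x(4)[OF t]]
        by (simp add: inner_commute)
      then show ?thesis using A_anti[OF x(2)[OF t]] B'(2)[OF x(2)[OF t]]
        by (simp add: has_real_derivative_iff_has_vector_derivative h_def inner_add_right mult.assoc)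
    qed
    have h_deriv: "(h has_real_derivative h' t) (at t)" if t: "0 \<le> t" for t
    proof -
      let ?g = "A (x t) + \<gamma> *\<^sub>R B (x t)"
      have g: "?g \<in> S" using x(2)[OF t] A(2) B(2) S
        by (intro subspace_add subspace_scale) (auto simp: fin_dim_def)
      have "(h has_vector_derivative inner (x t) (B' ?g) + inner ?g (B' (x t))) (at t)"
        unfolding h_def
        by (rule bounded_bilinear.has_vector_derivative[OF bounded_bilinear_inner x(4)[OF t]
            bounded_linear.has_vector_derivative[OF B'(1) x(4)[OF t]]])
      moreover have "inner (x t) (B' ?g) + inner ?g (B' (x t)) = h' t"
      proof -
        have "inner ?g (B' (x t)) = inner (B (x t)) ?g"
          unfolding B'(2)[OF x(2)[OF t]] by (rule inner_commute)
        moreover have "inner (x t) (B' ?g) = inner (B (x t)) ?g"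
          unfolding B'(2)[OF g] by (rule B_sym[OF x(2)[OF t] g, symmetric])
        ultimately show ?thesis by (simp add: h'_def inner_add_right)
      qed
      ultimately show ?thesis by (simp add: has_real_derivative_iff_has_vector_derivative)
    qed
    \<comment> \<open>The Rayleigh quotient stays above \<open>q0 - 2 a b t\<close>, hence above \<open>q0 / 2\<close> up to time \<open>\<tau>\<close>.\<close>
    have quot: "q0 / 2 * f t \<le> h t" if t: "0 \<le> t" "t \<le> \<tau>" for t
    proof -
      let ?k = "\<lambda>r. q0 - 2 * a * b * r" and ?e = "\<lambda>r. exp (- (2 * \<gamma> * (q0 * r - a * b * r\<^sup>2)))"
      have "- (h t - ?k t * f t) * ?e t \<le> - (h 0 - ?k 0 * f 0) * ?e 0"
      proof (rule DERIV_nonpos_imp_nonincreasing[OF t(1)])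
        fix r :: real assume r: "0 \<le> r"
        note xr = x(2)[OF r]
        let ?d = "h' r + 2 * a * b * f r - 2 * \<gamma> * ?k r * h r - 2 * \<gamma> * ?k r * (h r - ?k r * f r)"
        have "((\<lambda>r. - (h r - ?k r * f r) * ?e r) has_real_derivative - (?d * ?e r)) (at r)"
          by (rule derivative_eq_intros f_deriv[OF r] h_deriv[OF r] refl)+ (simp add: algebra_simps power2_eq_square)
        moreover have "0 \<le> ?d"
        proof -
          have "- inner (B (x r)) (A (x r)) \<le> norm (B (x r)) * norm (A (x r))"
            using Cauchy_Schwarz_ineq2[of "B (x r)" "A (x r)"] by linarith
          also have "\<dots> \<le> (b * norm (x r)) * (a * norm (x r))"
            using a(2)[OF xr] b(2)[OF xr] b(1) by (intro mult_mono) auto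
          also have "\<dots> = a * b * f r" by (simp add: f_def power2_norm_eq_inner[symmetric] power2_eq_square)
          finally have 1: "0 \<le> 2 * (inner (B (x r)) (A (x r)) + a * b * f r)" by simp
          have "0 \<le> 2 * \<gamma> * inner (B (x r) - ?k r *\<^sub>R x r) (B (x r) - ?k r *\<^sub>R x r)" using \<gamma> by simp
          also have "inner (B (x r) - ?k r *\<^sub>R x r) (B (x r) - ?k r *\<^sub>R x r)
              = inner (B (x r)) (B (x r)) - 2 * ?k r * h r + (?k r)\<^sup>2 * f r"
            by (simp add: h_def f_def B'(2)[OF xr] inner_diff_left inner_diff_right inner_commute[of "B (x r)" "x r"]
                power2_eq_square) (simp add: algebra_simps)
          finally have 2: "0 \<le> 2 * \<gamma> * (inner (B (x r)) (B (x r)) - 2 * ?k r * h r + (?k r)\<^sup>2 * f r)" .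
          show ?thesis using add_nonneg_nonneg[OF 1 2] by (simp add: h'_def power2_eq_square algebra_simps)
        qed
        then have "- (?d * ?e r) \<le> 0" by simp
        ultimately show "\<exists>y. ((\<lambda>r. - (h r - ?k r * f r) * ?e r) has_real_derivative y) (at r) \<and> y \<le> 0"
          by blast
      qed
      moreover have "- (h 0 - ?k 0 * f 0) * ?e 0 = 0" using B'(2)[OF X] x(1) X0 by (simp add: h_def f_def q0_def)
      ultimately have "- (h t - ?k t * f t) * ?e t \<le> 0" by (simp only:)
      then have "0 \<le> (h t - ?k t * f t) * ?e t" by (simp only: mult_minus_left neg_le_0_iff_le)
      then have "?k t * f t \<le> h t" by (simp add: zero_le_mult_iff)
      moreover have "q0 / 2 \<le> ?k t"
        using mult_left_mono[OF t(2), of "2 * a * b"] a b by (simp add: \<tau>_def)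
      then have "q0 / 2 * f t \<le> ?k t * f t" by (intro mult_right_mono) (simp_all add: f_def)
      ultimately show ?thesis by linarith
    qed
    have "- f \<tau> \<le> - f 0 * exp (\<gamma> * q0 * \<tau>)"
    proof (rule differential_inequality[OF _ DERIV_minus[OF f_deriv]])
      fix t assume t: "0 \<le> t" "t \<le> \<tau>"
      have "2 * \<gamma> * (q0 / 2 * f t) \<le> 2 * \<gamma> * h t" using quot[OF t] \<gamma> by (intro mult_left_mono) auto
      then show "- (2 * \<gamma> * h t) \<le> \<gamma> * q0 * - f t" by simp
    qed (use \<tau> in auto)
    moreover have "1 + \<gamma> * (q0 * \<tau>) \<le> exp (\<gamma> * q0 * \<tau>)" using exp_ge_add_one_self[of "\<gamma> * q0 * \<tau>"] by (simp add: mult.assoc)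
    then have "f 0 * (1 + \<gamma> * (q0 * \<tau>)) \<le> f 0 * exp (\<gamma> * q0 * \<tau>)"
      by (intro mult_left_mono) (simp_all add: f_def)
    moreover have "f \<tau> \<le> K\<^sup>2"
      unfolding f_def power2_norm_eq_inner[symmetric] using x(3)[of \<tau>] \<tau> by (intro power_mono) auto
    ultimately show ?thesis using x(1) by (simp add: f_def)
  qed
  have X_pos: "inner X X > 0" using X0 by simp
  define c where "c = inner X X * (q0 * \<tau>)"
  define \<gamma> where "\<gamma> = K\<^sup>2 / c + 1"
  have c: "c > 0" using X_pos q0 \<tau> by (simp add: c_def)
  have "0 < \<gamma>" using c by (simp add: \<gamma>_def add_nonneg_pos)
  from growth[OF this] have "inner X X + \<gamma> * c \<le> K\<^sup>2" by (simp add: c_def algebra_simps)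
  moreover have "\<gamma> * c = K\<^sup>2 + c" using c by (simp add: \<gamma>_def field_simps)
  ultimately show False using X_pos c by linarith
qed

section \<open>Complex matrices and adjoints\<close>

declare minus_carrier_mat [simp]

lemma complex_nonneg_iff: "0 \<le> z \<longleftrightarrow> 0 \<le> Re z \<and> Im z = 0"
  by (auto simp: less_eq_complex_def)

lemma mat_adjoint_dim [simp]: "dim_row (mat_adjoint A) = dim_col A" "dim_col (mat_adjoint A) = dim_row A"
  by (auto simp: mat_adjoint_def)

lemma mat_adjoint_carrier [simp]: "A \<in> carrier_mat n m \<Longrightarrow> mat_adjoint A \<in> carrier_mat m n"
  by (auto intro!: carrier_matI)

lemma mat_adjoint_index [simp]:
  fixes A :: cmat
  shows "i < dim_col A \<Longrightarrow> j < dim_row A \<Longrightarrow> mat_adjoint A $$ (i, j) = cnj (A $$ (j, i))"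
  by (simp add: mat_adjoint_def mat_of_rows_def)

lemma mat_adjoint_adjoint [simp]: "mat_adjoint (mat_adjoint A) = (A::cmat)"
  by (rule eq_matI) auto

lemma mult_entry:
  fixes A B :: "'a::semiring_0 mat"
  assumes "A \<in> carrier_mat n m" "B \<in> carrier_mat m k" "i < n" "j < k"
  shows "(A * B) $$ (i, j) = (\<Sum>l<m. A $$ (i, l) * B $$ (l, j))"
  using assms by (simp add: scalar_prod_def lessThan_atLeast0)

lemma mult_vec_entry:
  fixes A :: "'a::semiring_0 mat"
  assumes "A \<in> carrier_mat n m" "v \<in> carrier_vec m" "i < n"
  shows "(A *\<^sub>v v) $ i = (\<Sum>l<m. A $$ (i, l) * v $ l)"
  using assms by (simp add: scalar_prod_def lessThan_atLeast0)

lemma mat_adjoint_mult: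
  fixes A B :: cmat
  assumes "A \<in> carrier_mat n m" "B \<in> carrier_mat m k"
  shows "mat_adjoint (A * B) = mat_adjoint B * mat_adjoint A"
proof (rule eq_matI)
  fix i j assume ij: "i < dim_row (mat_adjoint B * mat_adjoint A)" "j < dim_col (mat_adjoint B * mat_adjoint A)"
  then have i: "i < k" and j: "j < n" using assms by auto
  have "mat_adjoint (A * B) $$ (i, j) = cnj (\<Sum>l<m. A $$ (j, l) * B $$ (l, i))"
    using mult_entry[OF assms j i] i j assms by simp
  also have "\<dots> = (\<Sum>l<m. mat_adjoint B $$ (i, l) * mat_adjoint A $$ (l, j))"
    using assms i j by (auto intro!: sum.cong simp: mult.commute)
  also have "\<dots> = (mat_adjoint B * mat_adjoint A) $$ (i, j)"
    using mult_entry[OF mat_adjoint_carrier[OF assms(2)] mat_adjoint_carrier[OF assms(1)] i j] by simp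
  finally show "mat_adjoint (A * B) $$ (i, j) = (mat_adjoint B * mat_adjoint A) $$ (i, j)" .
qed (use assms in auto)

lemma cscalar_prod_sum:
  assumes "v \<in> carrier_vec n" "w \<in> carrier_vec n"
  shows "v \<bullet>c w = (\<Sum>i<n. v $ i * cnj (w $ i))"
  using assms by (simp add: scalar_prod_def lessThan_atLeast0)

lemma cscalar_prod_self:
  assumes "v \<in> carrier_vec n"
  shows "v \<bullet>c v = complex_of_real (\<Sum>i<n. (cmod (v $ i))\<^sup>2)"
  using assms by (simp add: cscalar_prod_sum complex_norm_square del: of_real_power)

lemma cscalar_prod_self_eq_0:
  assumes v: "v \<in> carrier_vec n" and z: "v \<bullet>c v = (0::complex)"
  shows "v = 0\<^sub>v n"
proof (rule eq_vecI)
  have "complex_of_real (\<Sum>i<n. (cmod (v $ i))\<^sup>2) = 0" using z cscalar_prod_self[OF v] by simp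
  then have "(\<Sum>i<n. (cmod (v $ i))\<^sup>2) = 0" by (simp only: of_real_eq_0_iff)
  then show "v $ i = 0\<^sub>v n $ i" if "i < dim_vec (0\<^sub>v n)" for i
    using that by (simp add: sum_nonneg_eq_0_iff)
qed (use v in auto)

lemma adjoint_move:
  fixes A :: cmat
  assumes A: "A \<in> carrier_mat n n" and v: "v \<in> carrier_vec n" and w: "w \<in> carrier_vec n"
  shows "(A *\<^sub>v v) \<bullet>c w = v \<bullet>c (mat_adjoint A *\<^sub>v w)"
proof -
  have aw: "mat_adjoint A *\<^sub>v w \<in> carrier_vec n" using mult_mat_vec_carrier[OF mat_adjoint_carrier[OF A] w] .
  have "(A *\<^sub>v v) \<bullet>c w = (\<Sum>i<n. \<Sum>j<n. A $$ (i, j) * v $ j * cnj (w $ i))"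
    using assms by (simp add: cscalar_prod_sum[of _ n] mult_vec_entry[of A n n] sum_distrib_right del: index_mult_mat_vec)
  also have "\<dots> = (\<Sum>j<n. \<Sum>i<n. A $$ (i, j) * v $ j * cnj (w $ i))" by (rule sum.swap)
  also have "\<dots> = (\<Sum>j<n. v $ j * cnj (\<Sum>i<n. mat_adjoint A $$ (j, i) * w $ i))"
    using A by (auto intro!: sum.cong simp: sum_distrib_left mult_ac)
  also have "\<dots> = v \<bullet>c (mat_adjoint A *\<^sub>v w)"
    using assms mult_vec_entry[OF mat_adjoint_carrier[OF A] w] aw
    by (simp add: cscalar_prod_sum[of _ n] del: index_mult_mat_vec)
  finally show ?thesis .
qed

section \<open>Positive semidefinite matrices\<close>

lemma quadratic_form:
  fixes A :: cmat
  assumes "A \<in> carrier_mat n n" "v \<in> carrier_vec n"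
  shows "(A *\<^sub>v v) \<bullet>c v = (\<Sum>i<n. \<Sum>j<n. A $$ (i, j) * v $ j * cnj (v $ i))"
  using assms by (simp add: cscalar_prod_sum[of _ n] mult_vec_entry[of A n n] sum_distrib_right del: index_mult_mat_vec)

lemma psd_carrier: "psd n A \<Longrightarrow> A \<in> carrier_mat n n"
  and psd_form: "psd n A \<Longrightarrow> v \<in> carrier_vec n \<Longrightarrow> 0 \<le> (A *\<^sub>v v) \<bullet>c v"
  by (auto simp: psd_def)

lemma mult_unit_vec:
  fixes A :: "'a::semiring_1 mat"
  assumes "A \<in> carrier_mat n m" "i < n" "j < m"
  shows "(A *\<^sub>v unit_vec m j) $ i = A $$ (i, j)"
  using assms by (subst index_mult_mat_vec) auto

lemma psd_diag:
  assumes A: "psd n A" and i: "i < n"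
  shows "0 \<le> A $$ (i, i)"
proof -
  have "conjugate (unit_vec n i) = (unit_vec n i :: complex vec)" by (intro eq_vecI) (auto simp: unit_vec_def)
  then have "(A *\<^sub>v unit_vec n i) \<bullet>c unit_vec n i = A $$ (i, i)"
    using mult_unit_vec[OF psd_carrier[OF A] i i] i by simp
  then show ?thesis using psd_form[OF A, of "unit_vec n i"] by simp
qed

text \<open>The quadratic form at the vector with entries \<open>a\<close> at \<open>i\<close> and \<open>b\<close> at \<open>j\<close>; suitable choices of \<open>a\<close> and \<open>b\<close>
  give the symmetry and the size of the entries.\<close>

lemma psd_two_points:
  assumes A: "psd n A" and i: "i < n" and j: "j < n" and ij: "i \<noteq> j"
  shows "0 \<le> A $$ (i, i) * a * cnj a + A $$ (i, j) * b * cnj a + A $$ (j, i) * a * cnj b + A $$ (j, j) * b * cnj b"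
proof -
  let ?v = "vec n (\<lambda>k. if k = i then a else if k = j then b else 0)"
  have two: "(\<Sum>k<n. f k) = f i + f j" if "\<And>k. k \<noteq> i \<Longrightarrow> k \<noteq> j \<Longrightarrow> f k = 0" for f :: "nat \<Rightarrow> complex"
  proof -
    have "(\<Sum>k<n. f k) = (\<Sum>k\<in>{i, j}. f k)" using i j that by (intro sum.mono_neutral_right) auto
    then show ?thesis using ij by simp
  qed
  have "(A *\<^sub>v ?v) \<bullet>c ?v = (\<Sum>k<n. \<Sum>l<n. A $$ (k, l) * (if l = i then a else if l = j then b else 0)
      * cnj (if k = i then a else if k = j then b else 0))"
    unfolding quadratic_form[OF psd_carrier[OF A], of ?v, simplified] by (intro sum.cong) auto
  also have "\<dots> = (\<Sum>k<n. (A $$ (k, i) * a + A $$ (k, j) * b) * cnj (if k = i then a else if k = j then b else 0))"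
    using ij by (intro sum.cong refl, subst two) (auto simp: algebra_simps)
  also have "\<dots> = (A $$ (i, i) * a + A $$ (i, j) * b) * cnj a + (A $$ (j, i) * a + A $$ (j, j) * b) * cnj b"
    using ij by (subst two) auto
  finally show ?thesis using psd_form[OF A, of ?v] by (simp add: algebra_simps)
qed

lemma psd_hermitian_entry:
  assumes A: "psd n A" and i: "i < n" and j: "j < n"
  shows "A $$ (j, i) = cnj (A $$ (i, j))"
proof (cases "i = j")
  case True then show ?thesis using psd_diag[OF A i] by (simp add: complex_nonneg_iff complex_eq_iff)
next
  case False
  have "0 \<le> A $$ (i, i) + A $$ (i, j) + A $$ (j, i) + A $$ (j, j)"
    using psd_two_points[OF A i j False, of 1 1] by simp
  then have 1: "Im (A $$ (i, i)) + Im (A $$ (i, j)) + Im (A $$ (j, i)) + Im (A $$ (j, j)) = 0"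
    unfolding complex_nonneg_iff by simp
  have "0 \<le> A $$ (i, i) + A $$ (i, j) * \<i> - A $$ (j, i) * \<i> + A $$ (j, j)"
    using psd_two_points[OF A i j False, of 1 \<i>] by (simp add: mult.assoc)
  then have 2: "Im (A $$ (i, i)) + Re (A $$ (i, j)) - Re (A $$ (j, i)) + Im (A $$ (j, j)) = 0"
    unfolding complex_nonneg_iff by simp
  show ?thesis using 1 2 psd_diag[OF A i] psd_diag[OF A j] unfolding complex_nonneg_iff complex_eq_iff by simp
qed

lemma psd_hermitian:
  assumes A: "psd n A"
  shows "mat_adjoint A = A"
proof (rule eq_matI)
  note c = psd_carrier[OF A]
  fix i j assume "i < dim_row A" "j < dim_col A"
  then have "i < n" "j < n" using c by auto
  then show "mat_adjoint A $$ (i, j) = A $$ (i, j)" using psd_hermitian_entry[OF A, of j i] c by simp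
qed (use psd_carrier[OF A] in auto)

lemma psd_entry_bound:
  assumes A: "psd n A" and i: "i < n" and j: "j < n"
  shows "2 * cmod (A $$ (i, j)) \<le> Re (A $$ (i, i)) + Re (A $$ (j, j))"
proof (cases "i = j")
  case True
  have "A $$ (i, i) = complex_of_real (Re (A $$ (i, i)))" using psd_diag[OF A i] by (simp add: complex_nonneg_iff complex_eq_iff)
  then have "cmod (A $$ (i, i)) = \<bar>Re (A $$ (i, i))\<bar>" by (metis norm_of_real)
  then show ?thesis using True psd_diag[OF A i] by (simp add: complex_nonneg_iff)
next
  case False
  show ?thesis
  proof (cases "A $$ (i, j) = 0")
    case True then show ?thesis using psd_diag[OF A i] psd_diag[OF A j] by (simp add: complex_nonneg_iff)
  next
    case nz: False
    let ?z = "A $$ (i, j)"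
    define \<omega> where "\<omega> = cnj ?z / cmod ?z"
    have 1: "?z * \<omega> = cmod ?z" using nz by (simp add: \<omega>_def complex_norm_square[symmetric] power2_eq_square)
    have 2: "\<omega> * cnj \<omega> = 1" using nz
      by (simp add: \<omega>_def complex_norm_square[symmetric] power2_eq_square mult.commute)
    have 3: "cnj ?z * cnj \<omega> = cmod ?z" using arg_cong[OF 1, of cnj] by simp
    have "0 \<le> A $$ (i, i) - ?z * \<omega> - cnj ?z * cnj \<omega> + A $$ (j, j) * (\<omega> * cnj \<omega>)"
      using psd_two_points[OF A i j False, of 1 "- \<omega>"] psd_hermitian_entry[OF A i j] by (simp add: mult.assoc)
    then show ?thesis unfolding 1 2 3 by (simp add: complex_nonneg_iff)
  qed
qed

lemma psd_trace_zero:
  assumes A: "psd n A" and t: "trace A = 0"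
  shows "A = 0\<^sub>m n n"
proof (rule eq_matI)
  have n: "dim_row A = n" "dim_col A = n" using psd_carrier[OF A] by auto
  then show "dim_row A = dim_row (0\<^sub>m n n)" "dim_col A = dim_col (0\<^sub>m n n)" by auto
  have "(\<Sum>i<n. Re (A $$ (i, i))) = 0" using arg_cong[OF t, of Re] n by (simp add: trace_def)
  then have z: "Re (A $$ (i, i)) = 0" if "i < n" for i
    using psd_diag[OF A] that by (subst (asm) sum_nonneg_eq_0_iff) (auto simp: complex_nonneg_iff)
  show "A $$ (i, j) = 0\<^sub>m n n $$ (i, j)" if "i < dim_row (0\<^sub>m n n)" "j < dim_col (0\<^sub>m n n)" for i j
    using psd_entry_bound[OF A, of i j] z that by simp
qed

lemma congruence_form:
  fixes A E :: cmat
  assumes c: "A \<in> carrier_mat n n" and E: "E \<in> carrier_mat n n" and v: "v \<in> carrier_vec n"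
  shows "(mat_adjoint E * A * E *\<^sub>v v) \<bullet>c v = (A *\<^sub>v (E *\<^sub>v v)) \<bullet>c (E *\<^sub>v v)"
proof -
  have "mat_adjoint E * A * E *\<^sub>v v = mat_adjoint E *\<^sub>v (A *\<^sub>v (E *\<^sub>v v))"
    by (simp only: assoc_mult_mat_vec[OF mult_carrier_mat[OF mat_adjoint_carrier[OF E] c] E v]
        assoc_mult_mat_vec[OF mat_adjoint_carrier[OF E] c mult_mat_vec_carrier[OF E v]])
  then show ?thesis using adjoint_move[of "mat_adjoint E" n "A *\<^sub>v (E *\<^sub>v v)" v] E c v by simp
qed

lemma psd_congruence:
  assumes A: "psd n A" and E: "E \<in> carrier_mat n n"
  shows "psd n (mat_adjoint E * A * E)"
  unfolding psd_def
proof (intro conjI ballI)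
  note c = psd_carrier[OF A]
  show "mat_adjoint E * A * E \<in> carrier_mat n n" using E c by (meson mult_carrier_mat mat_adjoint_carrier)
  fix v :: "complex vec" assume v: "v \<in> carrier_vec n"
  show "0 \<le> (mat_adjoint E * A * E *\<^sub>v v) \<bullet>c v"
    unfolding congruence_form[OF c E v] using psd_form[OF A] E v by simp
qed

lemma psd_one: "psd n (1\<^sub>m n)"
  unfolding psd_def by (auto simp: cscalar_prod_self[of _ n] complex_nonneg_iff intro: sum_nonneg)

lemma zero_mat_mult_vec [simp]: "v \<in> carrier_vec m \<Longrightarrow> 0\<^sub>m n m *\<^sub>v v = (0\<^sub>v n :: complex vec)"
  by (intro eq_vecI) (auto simp: scalar_prod_def)

lemma psd_zero: "psd n (0\<^sub>m n n)"
  unfolding psd_def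
proof (intro conjI ballI)
  fix v :: "complex vec" assume "v \<in> carrier_vec n"
  then show "0 \<le> (0\<^sub>m n n *\<^sub>v v) \<bullet>c v" by simp
qed simp

lemma trace_smult: "A \<in> carrier_mat n n \<Longrightarrow> trace (c \<cdot>\<^sub>m A) = c * trace A"
  by (simp add: trace_def sum_distrib_left)

lemma trace_mult_commute:
  fixes A B :: cmat
  assumes "A \<in> carrier_mat n n" "B \<in> carrier_mat n n"
  shows "trace (A * B) = trace (B * A)"
proof -
  have "trace (A * B) = (\<Sum>i<n. \<Sum>l<n. A $$ (i, l) * B $$ (l, i))"
    using assms by (simp add: trace_def mult_entry[OF assms] del: index_mult_mat(1))
  also have "\<dots> = (\<Sum>l<n. \<Sum>i<n. A $$ (i, l) * B $$ (l, i))" by (rule sum.swap)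
  also have "\<dots> = trace (B * A)"
    using assms by (simp add: trace_def mult_entry[OF assms(2,1)] mult.commute del: index_mult_mat(1))
  finally show ?thesis .
qed

text \<open>In a triangular form of \<open>A\<close> the trace is the sum of the eigenvalues, so they cannot all be zero.\<close>

lemma eigenvector_of_nonzero_eigenvalue:
  fixes A :: cmat
  assumes A: "A \<in> carrier_mat n n" and t: "trace A \<noteq> 0"
  obtains l v where "l \<noteq> 0" "v \<in> carrier_vec n" "v \<bullet>c v = 1" "A *\<^sub>v v = l \<cdot>\<^sub>v v"
proof -
  obtain es where es: "char_poly A = (\<Prod>e\<leftarrow>es. [:- e, 1:])" using char_poly_factorized[OF A] by blast
  obtain B P Q where BPQ: "schur_decomposition A es = (B, P, Q)" by (metis prod_cases3)
  have sim: "similar_mat_wit A B P Q" and diag: "diag_mat B = es"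
    using schur_decomposition[OF A es BPQ] by auto
  note w = similar_mat_witD2[OF A sim]
  have "trace A = trace (P * (B * Q))" using w by (simp add: assoc_mult_mat[of _ n n _ n _ n])
  also have "\<dots> = trace ((B * Q) * P)" using w(5-7) by (intro trace_mult_commute[of _ n]) auto
  also have "(B * Q) * P = B" using w by (simp add: assoc_mult_mat[of _ n n _ n _ n])
  also have "trace B = sum_list es"
    unfolding diag[symmetric] diag_mat_def trace_def
    by (simp add: interv_sum_list_conv_sum_set_nat lessThan_atLeast0)
  finally have "sum_list es \<noteq> 0" using t by simp
  then obtain l where l: "l \<in> set es" "l \<noteq> 0" by (metis sum_list_neutral)
  have "poly (char_poly A) l = 0" unfolding es using l(1) by (auto simp: poly_prod_list prod_list_zero_iff)
  then have "eigenvalue A l" using eigenvalue_root_char_poly[OF A] by simp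
  then obtain v where v: "v \<in> carrier_vec n" "v \<noteq> 0\<^sub>v n" "A *\<^sub>v v = l \<cdot>\<^sub>v v"
    using A unfolding eigenvalue_def eigenvector_def by auto
  define r where "r = (\<Sum>i<n. (cmod (v $ i))\<^sup>2)"
  have vv: "v \<bullet>c v = complex_of_real r" unfolding r_def by (rule cscalar_prod_self[OF v(1)])
  have "r \<noteq> 0" using cscalar_prod_self_eq_0[OF v(1)] v(2) vv by auto
  moreover have "r \<ge> 0" unfolding r_def by (intro sum_nonneg) auto
  ultimately have r: "r > 0" by simp
  let ?c = "complex_of_real (1 / sqrt r)"
  let ?u = "?c \<cdot>\<^sub>v v"
  have u: "?u \<in> carrier_vec n" using v by simp
  have "?u \<bullet>c ?u = ?c * (?c * (v \<bullet>c v))"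
    using v by (simp add: cscalar_prod_sum[of _ n] sum_distrib_left mult_ac)
  also have "\<dots> = complex_of_real (1 / sqrt r * (1 / sqrt r * r))" unfolding vv by (simp only: of_real_mult)
  also have "1 / sqrt r * (1 / sqrt r * r) = 1" using r by (simp add: field_simps)
  finally have "?u \<bullet>c ?u = 1" by simp
  moreover have "A *\<^sub>v ?u = l \<cdot>\<^sub>v ?u"
    using A v by (simp add: mult_mat_vec[OF A v(1)] smult_smult_assoc mult.commute)
  ultimately show ?thesis using that[OF l(2) u] by blast
qed


section \<open>Square roots of positive semidefinite matrices\<close>

definition outer :: "nat \<Rightarrow> complex vec \<Rightarrow> cmat" where
  "outer n v = mat n n (\<lambda>(i, j). v $ i * cnj (v $ j))"

lemma outer_carrier [simp]: "outer n v \<in> carrier_mat n n"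
  by (simp add: outer_def)

lemma outer_adjoint: "mat_adjoint (outer n v) = outer n v"
  by (rule eq_matI) (auto simp: outer_def mult.commute)

lemma one_smult_mat [simp]: "(1::'a::semiring_1) \<cdot>\<^sub>m A = A"
  by (rule eq_matI) auto

lemma smult_smult_mat: "a \<cdot>\<^sub>m (b \<cdot>\<^sub>m A) = (a * b) \<cdot>\<^sub>m (A::cmat)"
  by (rule eq_matI) (auto simp: mult.assoc)

lemma smult_mult_mat_vec:
  fixes A :: cmat
  assumes "A \<in> carrier_mat n m" "v \<in> carrier_vec m"
  shows "(c \<cdot>\<^sub>m A) *\<^sub>v v = c \<cdot>\<^sub>v (A *\<^sub>v v)"
  using assms by (intro eq_vecI) (auto simp: scalar_prod_def sum_distrib_left mult.assoc)

lemma mult_outer: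
  assumes A: "A \<in> carrier_mat n n" and v: "v \<in> carrier_vec n" and Av: "A *\<^sub>v v = l \<cdot>\<^sub>v v"
  shows "A * outer n v = l \<cdot>\<^sub>m outer n v"
proof (rule eq_matI)
  fix i j assume "i < dim_row (l \<cdot>\<^sub>m outer n v)" "j < dim_col (l \<cdot>\<^sub>m outer n v)"
  then have i: "i < n" and j: "j < n" by (auto simp: outer_def)
  have "(A * outer n v) $$ (i, j) = (\<Sum>k<n. A $$ (i, k) * v $ k) * cnj (v $ j)"
    using mult_entry[OF A outer_carrier i j] i j by (simp add: outer_def sum_distrib_right mult.assoc)
  also have "(\<Sum>k<n. A $$ (i, k) * v $ k) = l * v $ i"
    using mult_vec_entry[OF A v i] Av v i by simp
  finally show "(A * outer n v) $$ (i, j) = (l \<cdot>\<^sub>m outer n v) $$ (i, j)"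
    using i j by (simp add: outer_def)
qed (use A in \<open>auto simp: outer_def\<close>)

lemma outer_mult:
  assumes A: "A \<in> carrier_mat n n" and h: "mat_adjoint A = A" and v: "v \<in> carrier_vec n"
    and Av: "A *\<^sub>v v = complex_of_real l \<cdot>\<^sub>v v"
  shows "outer n v * A = complex_of_real l \<cdot>\<^sub>m outer n v"
proof -
  have "mat_adjoint (A * outer n v) = mat_adjoint (complex_of_real l \<cdot>\<^sub>m outer n v)"
    using mult_outer[OF A v Av] by simp
  moreover have "mat_adjoint (complex_of_real l \<cdot>\<^sub>m outer n v) = complex_of_real l \<cdot>\<^sub>m outer n v"
    by (rule eq_matI) (auto simp: outer_def mult.commute)
  ultimately show ?thesis using mat_adjoint_mult[OF A outer_carrier] h by (simp add: outer_adjoint)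
qed

lemma outer_mult_vec:
  assumes v: "v \<in> carrier_vec n" and vv: "v \<bullet>c v = 1"
  shows "outer n v *\<^sub>v v = v"
proof (rule eq_vecI)
  fix i assume "i < dim_vec v"
  then have i: "i < n" using v by simp
  have "(outer n v *\<^sub>v v) $ i = v $ i * (v \<bullet>c v)"
    using mult_vec_entry[OF outer_carrier v i, of v] i v
    by (simp add: outer_def cscalar_prod_sum[OF v v] sum_distrib_left mult_ac del: index_mult_mat_vec)
  then show "(outer n v *\<^sub>v v) $ i = v $ i" by (simp only: vv mult_1_right)
qed (use v in \<open>auto simp: outer_def\<close>)

lemma outer_mult_self:
  assumes v: "v \<in> carrier_vec n" and vv: "v \<bullet>c v = 1"
  shows "outer n v * outer n v = outer n v"
  using mult_outer[OF outer_carrier v, of v 1] outer_mult_vec[OF v vv] v by simp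

lemma trace_outer:
  assumes v: "v \<in> carrier_vec n" and vv: "v \<bullet>c v = 1"
  shows "trace (outer n v) = 1"
  using vv by (simp add: trace_def outer_def cscalar_prod_sum[OF v v])

lemma psd_outer: "psd n (outer n v)" if v: "v \<in> carrier_vec n" and vv: "v \<bullet>c v = 1"
  using psd_congruence[OF psd_one outer_carrier, of n v] right_mult_one_mat[OF outer_carrier, of n v]
    outer_mult_self[OF v vv] by (simp add: outer_adjoint)

lemma psd_add: "psd n A \<Longrightarrow> psd n B \<Longrightarrow> psd n (A + B)"
  unfolding psd_def by (auto simp: add_mult_distrib_mat_vec[of _ n n] add_scalar_prod_distrib[of _ n])

lemma psd_smult: "psd n A \<Longrightarrow> 0 \<le> c \<Longrightarrow> psd n (complex_of_real c \<cdot>\<^sub>m A)"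
  unfolding psd_def by (auto simp: smult_mult_mat_vec[of _ n n] complex_nonneg_iff)

text \<open>Subtracting \<open>l v v\<^sup>*\<close> for a unit eigenvector \<open>v\<close> with eigenvalue \<open>l\<close> leaves a positive
  semidefinite matrix annihilating \<open>v\<close>.  The process ends because the range of \<open>A\<close> stays inside the
  range of a projection \<open>Pr\<close> whose trace drops by one each time.\<close>

lemma psd_sqrt_exists_deflation:
  assumes "psd n A" "Pr \<in> carrier_mat n n" "mat_adjoint Pr = Pr" "Pr * Pr = Pr" "A * Pr = A" "trace Pr = of_nat m"
  shows "\<exists>B. psd n B \<and> B * B = A"
  using assms
proof (induction m arbitrary: A Pr)
  case 0
  have "psd n Pr" using psd_congruence[OF psd_one 0(2)] 0(2-4) by simp
  then have "Pr = 0\<^sub>m n n" using psd_trace_zero 0(6) by simp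
  then have "A = 0\<^sub>m n n" using 0(5) psd_carrier[OF 0(1)] by simp
  then show ?case using psd_zero by (intro exI[of _ "0\<^sub>m n n"]) auto
next
  case (Suc m)
  note Ac = psd_carrier[OF Suc.prems(1)] and Prc = Suc.prems(2)
  note Ah = psd_hermitian[OF Suc.prems(1)]
  show ?case
  proof (cases "A = 0\<^sub>m n n")
    case True then show ?thesis using psd_zero by (intro exI[of _ "0\<^sub>m n n"]) auto
  next
    case False
    then have "trace A \<noteq> 0" using psd_trace_zero[OF Suc.prems(1)] by blast
    then obtain l0 v where l0: "l0 \<noteq> 0" and v: "v \<in> carrier_vec n" and vv: "v \<bullet>c v = 1"
      and Av0: "A *\<^sub>v v = l0 \<cdot>\<^sub>v v"
      using eigenvector_of_nonzero_eigenvalue[OF Ac] by blast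
    have "0 \<le> l0" using psd_form[OF Suc.prems(1) v] v vv by (simp add: Av0)
    then obtain l where l: "l0 = complex_of_real l" "0 \<le> l"
      by (metis complex_nonneg_iff complex_eq_iff Re_complex_of_real Im_complex_of_real)
    then have l_pos: "0 < l" using l0 by simp
    note Av = Av0[unfolded l(1)]
    let ?V = "outer n v" and ?l = "complex_of_real l"
    have PrA: "Pr * A = A" using mat_adjoint_mult[OF Ac Prc] Ah Suc.prems(3,5) by simp
    have "Pr *\<^sub>v (?l \<cdot>\<^sub>v v) = ?l \<cdot>\<^sub>v v"
      using PrA assoc_mult_mat_vec[OF Prc Ac v] by (simp add: Av)
    then have "?l \<cdot>\<^sub>v (Pr *\<^sub>v v) = ?l \<cdot>\<^sub>v v" using mult_mat_vec[OF Prc v] by simp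
    then have "(1 / ?l) \<cdot>\<^sub>v (?l \<cdot>\<^sub>v (Pr *\<^sub>v v)) = (1 / ?l) \<cdot>\<^sub>v (?l \<cdot>\<^sub>v v)" by simp
    then have Prv: "Pr *\<^sub>v v = complex_of_real 1 \<cdot>\<^sub>v v" using l_pos by (simp add: smult_smult_assoc)
    note AV = mult_outer[OF Ac v Av] and VA = outer_mult[OF Ac Ah v Av]
    have PrV: "Pr * ?V = ?V" and VPr: "?V * Pr = ?V"
      using mult_outer[OF Prc v Prv] outer_mult[OF Prc Suc.prems(3) v Prv] by simp_all
    note VV = outer_mult_self[OF v vv]
    let ?A' = "A - ?l \<cdot>\<^sub>m ?V" and ?Pr' = "Pr - ?V" and ?E = "1\<^sub>m n - ?V"
    have "\<exists>B. psd n B \<and> B * B = ?A'"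
    proof (rule Suc.IH)
      have E: "mat_adjoint ?E = ?E" by (rule eq_matI) (auto simp: outer_def)
      have AE: "A * ?E = ?A'" using Ac by (simp add: mult_minus_distrib_mat[of _ n n _ n] AV)
      have "?V * ?A' = 0\<^sub>m n n"
        using Ac by (simp add: mult_minus_distrib_mat[of _ n n _ n] VA mult_smult_distrib[of _ n n _ n] VV)
      then have "?E * ?A' = ?A'"
      proof -
        assume z: "?V * ?A' = 0\<^sub>m n n"
        have A'c: "?A' \<in> carrier_mat n n" by simp
        have "?E * ?A' = ?A' - 0\<^sub>m n n"
          by (simp only: minus_mult_distrib_mat[OF one_carrier_mat outer_carrier A'c] z left_mult_one_mat[OF A'c])
        also have "\<dots> = ?A'" using A'c by (intro eq_matI) (auto simp: outer_def)
        finally show ?thesis .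
      qed
      moreover have "psd n (mat_adjoint ?E * A * ?E)"
        by (rule psd_congruence[OF Suc.prems(1)]) simp
      moreover have "mat_adjoint ?E * A * ?E = ?E * ?A'"
        unfolding E AE[symmetric] using Ac by (intro assoc_mult_mat[of _ n n _ n _ n]) auto
      ultimately show "psd n ?A'" by simp
      show "?Pr' \<in> carrier_mat n n" by simp
      show "mat_adjoint ?Pr' = ?Pr'"
      proof (rule eq_matI)
        fix i j assume "i < dim_row ?Pr'" "j < dim_col ?Pr'"
        then have ij: "i < n" "j < n" by (auto simp: outer_def)
        have "cnj (Pr $$ (j, i)) = Pr $$ (i, j)"
          using arg_cong[OF Suc.prems(3), of "\<lambda>M. M $$ (i, j)"] Prc ij by simp
        then show "mat_adjoint ?Pr' $$ (i, j) = ?Pr' $$ (i, j)" using ij Prc by (simp add: outer_def)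
      qed (use Prc in \<open>auto simp: outer_def\<close>)
      have "?Pr' * ?Pr' = (Pr - ?V) - (?V - ?V)"
        using Prc by (simp add: mult_minus_distrib_mat[of _ n n _ n] minus_mult_distrib_mat[of _ n n _ _ n]
            PrV VPr VV Suc.prems(4))
      also have "\<dots> = ?Pr'" using Prc by (intro eq_matI) (auto simp: outer_def)
      finally show "?Pr' * ?Pr' = ?Pr'" .
      have "?A' * ?Pr' = (A - ?l \<cdot>\<^sub>m ?V) - (?l \<cdot>\<^sub>m ?V - ?l \<cdot>\<^sub>m ?V)"
        using Prc Ac by (simp add: mult_minus_distrib_mat[of _ n n _ n] minus_mult_distrib_mat[of _ n n _ _ n]
            mult_smult_assoc_mat[of _ n n _ n] VPr VV AV Suc.prems(5))
      also have "\<dots> = ?A'" using Ac by (intro eq_matI) (auto simp: outer_def)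
      finally show "?A' * ?Pr' = ?A'" .
      have "trace ?Pr' = trace Pr - trace ?V" using Prc by (simp add: trace_def sum_subtractf outer_def)
      then show "trace ?Pr' = of_nat m" using Suc.prems(6) trace_outer[OF v vv] by simp
    qed
    then obtain B where B: "psd n B" "B * B = ?A'" by blast
    note Bc = psd_carrier[OF B(1)] and Bh = psd_hermitian[OF B(1)]
    have "?A' *\<^sub>v v = 0\<^sub>v n"
      using Ac v outer_mult_vec[OF v vv] Av
      by (simp add: minus_mult_distrib_mat_vec[of _ n n] smult_mult_mat_vec[of _ n n])
    then have "B *\<^sub>v (B *\<^sub>v v) = 0\<^sub>v n" using assoc_mult_mat_vec[OF Bc Bc v] B(2) by simp
    then have "(B *\<^sub>v v) \<bullet>c (B *\<^sub>v v) = 0"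
      using adjoint_move[OF Bc v, of "B *\<^sub>v v"] Bc v Bh by simp
    then have "B *\<^sub>v v = 0\<^sub>v n" using cscalar_prod_self_eq_0[of "B *\<^sub>v v" n] Bc v by simp
    then have Bv: "B *\<^sub>v v = complex_of_real 0 \<cdot>\<^sub>v v" using v by (intro eq_vecI) auto
    have BV: "B * ?V = 0\<^sub>m n n" using mult_outer[OF Bc v Bv] by (simp, intro eq_matI) (auto simp: outer_def)
    have VB: "?V * B = 0\<^sub>m n n" using outer_mult[OF Bc Bh v Bv] by (simp, intro eq_matI) (auto simp: outer_def)
    let ?s = "complex_of_real (sqrt l)"
    have ss: "?s * ?s = ?l" using l by (simp flip: of_real_mult)
    let ?R = "B + ?s \<cdot>\<^sub>m ?V"
    have "?R * ?R = (?A' + 0\<^sub>m n n) + (0\<^sub>m n n + ?l \<cdot>\<^sub>m ?V)"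
      using Bc ss by (simp add: add_mult_distrib_mat[of _ n n _ _ n] mult_add_distrib_mat[of _ n n _ n]
          mult_smult_assoc_mat[of _ n n _ n] mult_smult_distrib[of _ n n _ n] BV VB VV B(2) smult_smult_mat)
    also have "\<dots> = A" using Ac by (intro eq_matI) (auto simp: outer_def)
    finally have "?R * ?R = A" .
    moreover have "psd n ?R" using psd_add[OF B(1) psd_smult[OF psd_outer[OF v vv]]] l by simp
    ultimately show ?thesis by blast
  qed
qed

lemma psd_sqrt_exists: "psd n A \<Longrightarrow> \<exists>B. psd n B \<and> B * B = A"
  by (rule psd_sqrt_exists_deflation[of n A "1\<^sub>m n" n])
    (auto simp: right_mult_one_mat[OF psd_carrier] trace_def intro!: eq_matI)

lemma psd_null:
  assumes A: "psd n A" and v: "v \<in> carrier_vec n" and z: "(A *\<^sub>v v) \<bullet>c v = 0"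
  shows "A *\<^sub>v v = 0\<^sub>v n"
proof -
  obtain B where B: "psd n B" "B * B = A" using psd_sqrt_exists[OF A] by blast
  note Bc = psd_carrier[OF B(1)]
  have "(B *\<^sub>v v) \<bullet>c (B *\<^sub>v v) = 0"
    using adjoint_move[OF Bc mult_mat_vec_carrier[OF Bc v] v] psd_hermitian[OF B(1)] B(2) z
      assoc_mult_mat_vec[OF Bc Bc v] by simp
  then have "B *\<^sub>v v = 0\<^sub>v n" using cscalar_prod_self_eq_0[of "B *\<^sub>v v" n] Bc v by simp
  moreover have "B *\<^sub>v 0\<^sub>v n = 0\<^sub>v n" using Bc by (intro eq_vecI) auto
  ultimately show ?thesis using assoc_mult_mat_vec[OF Bc Bc v] B(2) Bc by simp
qed

text \<open>\<open>D = B - C\<close> and \<open>E = B + C\<close> anticommute when \<open>B\<^sup>2 = C\<^sup>2\<close>, so cyclicity of the trace gives \<open>tr (D E D) = 0\<close>.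
  As \<open>D E D\<close> is positive semidefinite it vanishes, so \<open>B\<close> and \<open>C\<close> annihilate the range of \<open>D\<close> and \<open>D\<^sup>2 = 0\<close>.\<close>

lemma psd_sqrt_unique:
  assumes B: "psd n B" and C: "psd n C" and eq: "B * B = C * C"
  shows "B = C"
proof -
  note Bc = psd_carrier[OF B] and Cc = psd_carrier[OF C]
  let ?D = "B - C" and ?E = "B + C"
  have Dc: "?D \<in> carrier_mat n n" and Ec: "?E \<in> carrier_mat n n" using Bc Cc by simp_all
  note EDc = mult_carrier_mat[OF Ec Dc]
  have Dh: "mat_adjoint ?D = ?D"
  proof (rule eq_matI)
    fix i j assume "i < dim_row ?D" "j < dim_col ?D"
    then have ij: "i < n" "j < n" using Cc by auto
    show "mat_adjoint ?D $$ (i, j) = ?D $$ (i, j)"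
      using ij Bc Cc psd_hermitian_entry[OF B ij] psd_hermitian_entry[OF C ij] by simp
  qed (use Bc Cc in auto)
  have anti: "?D * ?E = (-1) \<cdot>\<^sub>m (?E * ?D)"
    using Bc Cc eq by (simp add: mult_minus_distrib_mat[of _ n n _ n] minus_mult_distrib_mat[of _ n n _ _ n]
        mult_add_distrib_mat[of _ n n _ n] add_mult_distrib_mat[of _ n n _ _ n])
      (intro eq_matI, auto)
  have "trace (?D * ?E * ?D) = - trace (?E * ?D * ?D)"
    unfolding anti using EDc Dc by (simp add: mult_smult_assoc_mat[of _ n n _ n] trace_smult[of _ n])
  also have "trace (?E * ?D * ?D) = trace (?D * (?E * ?D))" by (rule trace_mult_commute[OF EDc Dc])
  also have "?D * (?E * ?D) = ?D * ?E * ?D" using Dc Ec by simp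
  finally have tr: "trace (mat_adjoint ?D * ?E * ?D) = 0" unfolding Dh by simp
  have DED: "mat_adjoint ?D * ?E * ?D = 0\<^sub>m n n"
    by (rule psd_trace_zero[OF psd_congruence[OF psd_add[OF B C] Dc] tr])
  have Dv: "?D *\<^sub>v v = 0\<^sub>v n" if v: "v \<in> carrier_vec n" for v
  proof -
    let ?w = "?D *\<^sub>v v"
    have w: "?w \<in> carrier_vec n" using Dc v by simp
    have "(?E *\<^sub>v ?w) \<bullet>c ?w = 0" using congruence_form[OF Ec Dc v] DED v by simp
    then have "(B *\<^sub>v ?w) \<bullet>c ?w + (C *\<^sub>v ?w) \<bullet>c ?w = 0"
      using Bc Cc w by (simp add: add_mult_distrib_mat_vec[of _ n n] add_scalar_prod_distrib[of _ n])
    then have "(B *\<^sub>v ?w) \<bullet>c ?w = 0" "(C *\<^sub>v ?w) \<bullet>c ?w = 0"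
      using psd_form[OF B w] psd_form[OF C w] by (simp_all only: add_nonneg_eq_0_iff)
    then have "B *\<^sub>v ?w = 0\<^sub>v n" "C *\<^sub>v ?w = 0\<^sub>v n" using psd_null[OF B w] psd_null[OF C w] by auto
    then have "?D *\<^sub>v ?w = 0\<^sub>v n" using w by (simp add: minus_mult_distrib_mat_vec[OF Bc Cc])
    then have "?w \<bullet>c ?w = 0" using adjoint_move[OF Dc v w] v Dh by simp
    then show ?thesis using cscalar_prod_self_eq_0[OF w] by simp
  qed
  show ?thesis
  proof (rule eq_matI)
    fix i j assume "i < dim_row C" "j < dim_col C"
    then have i: "i < n" and j: "j < n" using Cc by auto
    have "?D $$ (i, j) = 0" using Dv[of "unit_vec n j"] i mult_unit_vec[OF Dc i j] by simp
    then show "B $$ (i, j) = C $$ (i, j)" using i j Bc Cc by simp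
  qed (use Bc Cc in auto)
qed

lemma mat_sqrt_props:
  assumes "psd n A"
  shows psd_mat_sqrt: "psd n (mat_sqrt n A)" and mat_sqrt_square: "mat_sqrt n A * mat_sqrt n A = A"
proof -
  obtain B where B: "psd n B" "B * B = A" using psd_sqrt_exists[OF assms] by blast
  have "psd n (mat_sqrt n A) \<and> mat_sqrt n A * mat_sqrt n A = A"
    unfolding mat_sqrt_def
  proof (rule theI[of _ B])
    show "psd n B \<and> B * B = A" using B by blast
    fix C assume "psd n C \<and> C * C = A"
    then show "C = B" using psd_sqrt_unique[of n C B] B by metis
  qed
  then show "psd n (mat_sqrt n A)" "mat_sqrt n A * mat_sqrt n A = A" by auto
qed

section \<open>Finitely supported functions as an inner product space\<close>

text \<open>The matrix size is a number, whereas inner product spaces form a type class.  The finitely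
  supported functions on pairs of indices are one type that contains the matrices of every size.\<close>

instantiation poly_mapping :: (type, real_vector) real_vector
begin

lift_definition scaleR_poly_mapping :: "real \<Rightarrow> ('a \<Rightarrow>\<^sub>0 'b) \<Rightarrow> ('a \<Rightarrow>\<^sub>0 'b)" is "\<lambda>r f k. r *\<^sub>R f k"
  by (erule finite_subset[rotated]) auto

instance
proof
  fix f g :: "'a \<Rightarrow>\<^sub>0 'b" and r s :: real
  show "r *\<^sub>R (f + g) = r *\<^sub>R f + r *\<^sub>R g" by transfer (simp add: fun_eq_iff scaleR_add_right)
  show "(r + s) *\<^sub>R f = r *\<^sub>R f + s *\<^sub>R f" by transfer (simp add: fun_eq_iff scaleR_add_left)
  show "r *\<^sub>R s *\<^sub>R f = (r * s) *\<^sub>R f" by transfer simp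
  show "1 *\<^sub>R f = f" by transfer simp
qed

end

instantiation poly_mapping :: (type, real_inner) real_inner
begin

definition inner_poly_mapping :: "('a \<Rightarrow>\<^sub>0 'b) \<Rightarrow> ('a \<Rightarrow>\<^sub>0 'b) \<Rightarrow> real" where
  "inner_poly_mapping f g = (\<Sum>k\<in>Poly_Mapping.keys f. inner (Poly_Mapping.lookup f k) (Poly_Mapping.lookup g k))"
definition norm_poly_mapping :: "('a \<Rightarrow>\<^sub>0 'b) \<Rightarrow> real" where
  "norm_poly_mapping f = sqrt (inner f f)"
definition sgn_poly_mapping :: "('a \<Rightarrow>\<^sub>0 'b) \<Rightarrow> ('a \<Rightarrow>\<^sub>0 'b)" where
  "sgn_poly_mapping f = f /\<^sub>R norm f"
definition dist_poly_mapping :: "('a \<Rightarrow>\<^sub>0 'b) \<Rightarrow> ('a \<Rightarrow>\<^sub>0 'b) \<Rightarrow> real" where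
  "dist_poly_mapping f g = norm (f - g)"
definition uniformity_poly_mapping :: "(('a \<Rightarrow>\<^sub>0 'b) \<times> ('a \<Rightarrow>\<^sub>0 'b)) filter" where
  "uniformity_poly_mapping = (INF e\<in>{0<..}. principal {(x, y). dist x y < e})"
definition open_poly_mapping :: "('a \<Rightarrow>\<^sub>0 'b) set \<Rightarrow> bool" where
  "open_poly_mapping U \<longleftrightarrow> (\<forall>x\<in>U. eventually (\<lambda>(x', y). x' = x \<longrightarrow> y \<in> U) uniformity)"

lemma inner_poly_mapping_superset:
  fixes f g :: "'a \<Rightarrow>\<^sub>0 'b"
  assumes "finite T" "Poly_Mapping.keys f \<subseteq> T"
  shows "inner f g = (\<Sum>k\<in>T. inner (Poly_Mapping.lookup f k) (Poly_Mapping.lookup g k))"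
  unfolding inner_poly_mapping_def
  by (rule sum.mono_neutral_left[OF assms]) (auto simp: in_keys_iff)

instance
proof
  fix f g h :: "'a \<Rightarrow>\<^sub>0 'b" and r s :: real
  let ?T = "Poly_Mapping.keys f \<union> Poly_Mapping.keys g"
  show "inner f g = inner g f"
  proof -
    have "inner f g = (\<Sum>k\<in>?T. inner (Poly_Mapping.lookup f k) (Poly_Mapping.lookup g k))"
      by (rule inner_poly_mapping_superset) auto
    also have "\<dots> = (\<Sum>k\<in>?T. inner (Poly_Mapping.lookup g k) (Poly_Mapping.lookup f k))"
      by (simp only: inner_commute)
    also have "\<dots> = inner g f" by (rule inner_poly_mapping_superset[symmetric]) auto
    finally show ?thesis .
  qed
  have "Poly_Mapping.keys (f + g) \<subseteq> ?T" by (rule Poly_Mapping.keys_add)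
  then show "inner (f + g) h = inner f h + inner g h"
    by (simp add: inner_poly_mapping_superset[of ?T] lookup_add inner_add_left sum.distrib)
  have "Poly_Mapping.keys (r *\<^sub>R f) \<subseteq> Poly_Mapping.keys f" by (auto simp: in_keys_iff scaleR_poly_mapping.rep_eq)
  then show "inner (r *\<^sub>R f) g = r * inner f g"
    by (simp add: inner_poly_mapping_superset[of "Poly_Mapping.keys f"] scaleR_poly_mapping.rep_eq sum_distrib_left)
  show "0 \<le> inner f f" unfolding inner_poly_mapping_def by (intro sum_nonneg) auto
  show "inner f f = 0 \<longleftrightarrow> f = 0"
    unfolding inner_poly_mapping_def
    by (subst sum_nonneg_eq_0_iff) (auto simp: in_keys_iff intro: poly_mapping_eqI)
  show "norm f = sqrt (inner f f)" by (rule norm_poly_mapping_def)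
  show "sgn f = f /\<^sub>R norm f" by (rule sgn_poly_mapping_def)
  show "dist f g = norm (f - g)" by (rule dist_poly_mapping_def)
  show "(uniformity :: (('a \<Rightarrow>\<^sub>0 'b) \<times> ('a \<Rightarrow>\<^sub>0 'b)) filter) = (INF e\<in>{0<..}. principal {(x, y). dist x y < e})"
    by (rule uniformity_poly_mapping_def)
  show "open U \<longleftrightarrow> (\<forall>x\<in>U. eventually (\<lambda>(x', y). x' = x \<longrightarrow> y \<in> U) uniformity)" for U :: "('a \<Rightarrow>\<^sub>0 'b) set"
    by (rule open_poly_mapping_def)
qed

end

lemma norm_single: "norm (Poly_Mapping.single k c) = norm (c::'b::real_inner)"
  by (cases "c = 0") (simp_all add: norm_poly_mapping_def inner_poly_mapping_def norm_eq_sqrt_inner)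

lemma bounded_linear_single: "bounded_linear (Poly_Mapping.single k :: 'b::real_inner \<Rightarrow> _)"
proof (rule bounded_linear_intro[where K = 1])
  show "Poly_Mapping.single k (x + y) = Poly_Mapping.single k x + Poly_Mapping.single k y" for x y :: 'b
    by (rule single_add)
  show "Poly_Mapping.single k (r *\<^sub>R x) = r *\<^sub>R Poly_Mapping.single k x" for r and x :: 'b
    by (rule poly_mapping_eqI) (simp add: lookup_single when_def scaleR_poly_mapping.rep_eq)
qed (simp add: norm_single)

section \<open>The KMS inner product as a real inner product\<close>

text \<open>For \<open>R = \<sigma>\<^bsup>1/4\<^esup>\<close> this is the matrix \<open>\<sigma>\<^bsup>1/4\<^esup> X \<sigma>\<^bsup>1/4\<^esup>\<close> read as a function of its index pair, which turns the
  KMS inner product into the standard one.\<close>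

definition emb :: "nat \<Rightarrow> cmat \<Rightarrow> cmat \<Rightarrow> nat \<times> nat \<Rightarrow>\<^sub>0 complex" where
  "emb n R X = (\<Sum>i<n. \<Sum>j<n. Poly_Mapping.single (i, j) ((R * X * R) $$ (i, j)))"

lemma lookup_emb: "Poly_Mapping.lookup (emb n R X) (i, j) = (if i < n \<and> j < n then (R * X * R) $$ (i, j) else 0)"
proof -
  have "Poly_Mapping.lookup (emb n R X) (i, j) =
      (\<Sum>k<n. \<Sum>l<n. if k = i \<and> l = j then (R * X * R) $$ (k, l) else 0)"
    unfolding emb_def by (simp add: lookup_sum lookup_single when_def)
  also have "\<dots> = (\<Sum>k<n. if k = i then (\<Sum>l<n. if l = j then (R * X * R) $$ (k, l) else 0) else 0)"
    by (intro sum.cong) auto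
  also have "\<dots> = (if i < n \<and> j < n then (R * X * R) $$ (i, j) else 0)"
    by (simp add: sum.delta)
  finally show ?thesis .
qed

lemma inner_emb_sum:
  "inner (emb n R X) (emb n R Y) = (\<Sum>i<n. \<Sum>j<n. Re (cnj ((R * X * R) $$ (i, j)) * (R * Y * R) $$ (i, j)))"
proof -
  have "Poly_Mapping.keys (emb n R X) \<subseteq> {..<n} \<times> {..<n}"
  proof
    fix k assume "k \<in> Poly_Mapping.keys (emb n R X)"
    then have "Poly_Mapping.lookup (emb n R X) (fst k, snd k) \<noteq> 0" by (simp add: in_keys_iff)
    then show "k \<in> {..<n} \<times> {..<n}" unfolding lookup_emb by (auto simp: mem_Times_iff split: if_splits)
  qed
  then have "inner (emb n R X) (emb n R Y)
      = (\<Sum>k\<in>{..<n} \<times> {..<n}. inner (Poly_Mapping.lookup (emb n R X) k) (Poly_Mapping.lookup (emb n R Y) k))"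
    by (intro inner_poly_mapping_superset) auto
  also have "\<dots> = (\<Sum>i<n. \<Sum>j<n. inner (Poly_Mapping.lookup (emb n R X) (i, j)) (Poly_Mapping.lookup (emb n R Y) (i, j)))"
    by (simp add: sum.cartesian_product)
  also have "\<dots> = (\<Sum>i<n. \<Sum>j<n. Re (cnj ((R * X * R) $$ (i, j)) * (R * Y * R) $$ (i, j)))"
    by (intro sum.cong refl) (simp add: lookup_emb inner_complex_def)
  finally show ?thesis .
qed

locale state_space =
  fixes n :: nat and M :: "cmat set" and \<sigma> :: cmat
  assumes vn: "von_neumann_algebra n M" and state: "\<sigma> \<in> full_rank_densities n M"
begin

definition s :: cmat where "s = mat_sqrt n \<sigma>"
definition R :: cmat where "R = mat_sqrt n s"

lemma sigma_psd: "psd n \<sigma>" and sigma_inv: "invertible_mat \<sigma>"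
  using state by (auto simp: full_rank_densities_def)

lemma s_psd: "psd n s" and s_square: "s * s = \<sigma>" and R_psd: "psd n R" and R_square: "R * R = s"
  using mat_sqrt_props[OF sigma_psd] mat_sqrt_props[of n s] unfolding s_def R_def by auto

lemma carr [simp]: "\<sigma> \<in> carrier_mat n n" "s \<in> carrier_mat n n" "R \<in> carrier_mat n n"
  using psd_carrier sigma_psd s_psd R_psd by auto

lemma square_mult_carrier [simp]: "A \<in> carrier_mat n n \<Longrightarrow> B \<in> carrier_mat n n \<Longrightarrow> A * B \<in> carrier_mat n n" for A B :: cmat
  by (rule mult_carrier_mat)

lemma R_dim [simp]: "dim_row R = n" "dim_col R = n"
  using carr(3) by (simp_all only: carrier_matD)

lemma R_hermitian: "mat_adjoint R = R"
  using psd_hermitian R_psd by auto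

lemma R_inverse:
  obtains Q where "Q \<in> carrier_mat n n" "Q * R = 1\<^sub>m n" "R * Q = 1\<^sub>m n"
proof -
  obtain B where B: "B * \<sigma> = 1\<^sub>m (dim_row B)" "\<sigma> * B = 1\<^sub>m n"
    using sigma_inv carr(1) unfolding invertible_mat_def inverts_mat_def by auto
  have "dim_row B = n" "dim_col B = n"
    using arg_cong[OF B(1), of dim_col] arg_cong[OF B(2), of dim_col] carr(1) by simp_all
  then have Bc: "B \<in> carrier_mat n n" by auto
  let ?Q = "B * (s * R)"
  have Q: "?Q \<in> carrier_mat n n" using Bc by simp
  have "?Q * R = B * (s * (R * R))" using Bc by (simp add: assoc_mult_mat[of _ n n _ n _ n])
  then have "?Q * R = 1\<^sub>m n" using B(1) \<open>dim_row B = n\<close> by (simp add: R_square s_square)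
  then show ?thesis using that[OF Q] mat_mult_left_right_inverse[OF Q carr(3)] by simp
qed

lemma M_carrier: "X \<in> M \<Longrightarrow> X \<in> carrier_mat n n"
  using vn by (auto simp: von_neumann_algebra_def)

lemma M_adjoint: "X \<in> M \<Longrightarrow> mat_adjoint X \<in> M"
  using vn by (auto simp: von_neumann_algebra_def)

lemma M_iff: "X \<in> M \<longleftrightarrow> X \<in> carrier_mat n n \<and> (\<forall>Y\<in>commutant n M. Y * X = X * Y)"
  using vn unfolding von_neumann_algebra_def commutant_def by blast

lemma M_one: "1\<^sub>m n \<in> M"
  unfolding M_iff by (auto simp: commutant_def)

lemma emb_add:
  assumes "X \<in> carrier_mat n n" "Y \<in> carrier_mat n n"
  shows "emb n R (X + Y) = emb n R X + emb n R Y"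
proof -
  have "R * (X + Y) * R = R * X * R + R * Y * R"
    using assms by (simp add: mult_add_distrib_mat[of _ n n _ n] add_mult_distrib_mat[of _ n n _ _ n])
  moreover have "(R * X * R + R * Y * R) $$ (i, j) = (R * X * R) $$ (i, j) + (R * Y * R) $$ (i, j)"
    if "i < n" "j < n" for i j
    using that assms carr(3) by (intro index_add_mat(1)) auto
  ultimately show ?thesis by (simp add: emb_def single_add sum.distrib del: index_mult_mat)
qed

lemma emb_scaleR:
  assumes X: "X \<in> carrier_mat n n"
  shows "emb n R (of_real c \<cdot>\<^sub>m X) = c *\<^sub>R emb n R X"
proof -
  have "R * (of_real c \<cdot>\<^sub>m X) * R = of_real c \<cdot>\<^sub>m (R * X * R)"
    using X by (simp add: mult_smult_distrib[of _ n n _ n] mult_smult_assoc_mat[of _ n n _ n])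
  moreover have "(of_real c \<cdot>\<^sub>m (R * X * R)) $$ (i, j) = of_real c * (R * X * R) $$ (i, j)"
    if "i < n" "j < n" for i j
    using that X carr(3) by (intro index_smult_mat(1)) auto
  ultimately show ?thesis
    by (intro poly_mapping_eqI)
      (auto simp: lookup_emb scaleR_poly_mapping.rep_eq scaleR_conv_of_real simp del: index_mult_mat)
qed

lemma emb_inj:
  assumes "X \<in> carrier_mat n n" "Y \<in> carrier_mat n n" "emb n R X = emb n R Y"
  shows "X = Y"
proof -
  obtain Q where Q: "Q \<in> carrier_mat n n" "Q * R = 1\<^sub>m n" "R * Q = 1\<^sub>m n" using R_inverse .
  have e: "R * X * R = R * Y * R"
  proof (rule eq_matI)
    fix i j assume "i < dim_row (R * Y * R)" "j < dim_col (R * Y * R)"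
    then have "i < n" "j < n" using carr(3) by auto
    then show "(R * X * R) $$ (i, j) = (R * Y * R) $$ (i, j)"
      using arg_cong[OF assms(3), of "\<lambda>f. Poly_Mapping.lookup f (i, j)"] by (simp add: lookup_emb)
  qed auto
  have c: "Q * (R * Z * R) * Q = Z" if Z: "Z \<in> carrier_mat n n" for Z
  proof -
    have "Q * (R * Z * R) * Q = (Q * R) * Z * (R * Q)"
      by (simp add: assoc_mult_mat[of _ n n _ n _ n] Q(1) Z)
    also have "\<dots> = Z"
      unfolding Q(2,3) left_mult_one_mat[OF Z] by (rule right_mult_one_mat[OF Z])
    finally show ?thesis .
  qed
  have "X = Q * (R * Y * R) * Q" using c[OF assms(1)] unfolding e by (rule sym)
  also have "\<dots> = Y" by (rule c[OF assms(2)])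
  finally show ?thesis .
qed

lemma inner_emb:
  assumes X: "X \<in> carrier_mat n n" and Y: "Y \<in> carrier_mat n n"
  shows "inner (emb n R X) (emb n R Y) = Re (kms_inner n \<sigma> X Y)"
proof -
  let ?X = "R * X * R" and ?Y = "R * Y * R"
  have c: "?X \<in> carrier_mat n n" "?Y \<in> carrier_mat n n" "mat_adjoint X \<in> carrier_mat n n" using X Y by auto
  have adj: "mat_adjoint ?X = R * mat_adjoint X * R"
    using X mat_adjoint_mult[of "R * X" n n R n] mat_adjoint_mult[of R n n X n] mat_adjoint_carrier[OF X]
    by (simp add: R_hermitian assoc_mult_mat[of _ n n _ n _ n])
  have "trace (mat_adjoint ?X * ?Y) = trace (R * (mat_adjoint X * (s * (Y * R))))"
    unfolding adj R_square[symmetric] using c X Y by (simp add: assoc_mult_mat[of _ n n _ n _ n])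
  also have "\<dots> = trace ((mat_adjoint X * (s * (Y * R))) * R)"
    using c Y by (intro trace_mult_commute[of _ n]) auto
  also have "\<dots> = trace ((mat_adjoint X * (s * Y)) * s)"
    unfolding R_square[symmetric] using c X Y by (simp add: assoc_mult_mat[of _ n n _ n _ n])
  also have "\<dots> = trace (s * (mat_adjoint X * (s * Y)))"
    using c Y by (intro trace_mult_commute[of _ n]) auto
  also have "\<dots> = kms_inner n \<sigma> X Y"
    unfolding kms_inner_def s_def[symmetric] using c Y by (simp add: assoc_mult_mat[of _ n n _ n _ n])
  finally have k: "kms_inner n \<sigma> X Y = trace (mat_adjoint ?X * ?Y)" ..
  have "trace (mat_adjoint ?X * ?Y) = (\<Sum>j<n. \<Sum>i<n. cnj (?X $$ (i, j)) * ?Y $$ (i, j))"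
  proof -
    have "dim_row (mat_adjoint ?X * ?Y) = n" using carr(3) by simp
    moreover have "(mat_adjoint ?X * ?Y) $$ (j, j) = (\<Sum>i<n. cnj (?X $$ (i, j)) * ?Y $$ (i, j))" if "j < n" for j
      using mult_entry[OF mat_adjoint_carrier[OF c(1)] c(2) that that] that c(1)
      by (simp only:) (intro sum.cong, auto simp del: index_mult_mat(1))
    ultimately show ?thesis unfolding trace_def by (intro sum.cong) auto
  qed
  also have "\<dots> = (\<Sum>i<n. \<Sum>j<n. cnj (?X $$ (i, j)) * ?Y $$ (i, j))" by (rule sum.swap)
  finally show ?thesis unfolding inner_emb_sum k by (simp del: index_mult_mat(1))
qed

lemma kms_norm_emb: "X \<in> carrier_mat n n \<Longrightarrow> kms_norm n \<sigma> X = norm (emb n R X)"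
  by (simp add: kms_norm_def norm_eq_sqrt_inner inner_emb)

end

section \<open>Projections, adjoints and pseudoinverses on the algebra\<close>

context state_space
begin

abbreviation \<iota> :: "cmat \<Rightarrow> nat \<times> nat \<Rightarrow>\<^sub>0 complex" where "\<iota> \<equiv> emb n R"

definition csub :: "cmat set \<Rightarrow> bool" where
  "csub V \<longleftrightarrow> V \<subseteq> carrier_mat n n \<and> 0\<^sub>m n n \<in> V \<and> (\<forall>X\<in>V. \<forall>Y\<in>V. X + Y \<in> V) \<and> (\<forall>c. \<forall>X\<in>V. c \<cdot>\<^sub>m X \<in> V)"

lemma csubD:
  assumes "csub V"
  shows csub_carrier: "X \<in> V \<Longrightarrow> X \<in> carrier_mat n n" and csub_zero: "0\<^sub>m n n \<in> V"
    and csub_add: "X \<in> V \<Longrightarrow> Y \<in> V \<Longrightarrow> X + Y \<in> V" and csub_smult: "X \<in> V \<Longrightarrow> c \<cdot>\<^sub>m X \<in> V"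
  using assms by (auto simp: csub_def)

lemma uminus_smult: "X \<in> carrier_mat n n \<Longrightarrow> - X = of_real (-1) \<cdot>\<^sub>m X"
  by (intro eq_matI) auto

lemma minus_add_smult:
  "X \<in> carrier_mat n n \<Longrightarrow> Y \<in> carrier_mat n n \<Longrightarrow> X - Y = X + of_real (-1) \<cdot>\<^sub>m Y"
  by (intro eq_matI) auto

lemma csub_uminus: "csub V \<Longrightarrow> X \<in> V \<Longrightarrow> - X \<in> V"
  using uminus_smult csubD by metis

lemma csub_M: "csub M"
  unfolding csub_def
proof (intro conjI ballI allI)
  show "M \<subseteq> carrier_mat n n" using M_carrier by blast
  show "0\<^sub>m n n \<in> M"
    unfolding M_iff by (auto simp: commutant_def)
  fix X assume X: "X \<in> M"
  show "X + Y \<in> M" if Y: "Y \<in> M" for Y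
    using X Y unfolding M_iff
    by (auto simp: commutant_def mult_add_distrib_mat[of _ n n _ n] add_mult_distrib_mat[of _ n n _ _ n])
  show "c \<cdot>\<^sub>m X \<in> M" for c
    using X unfolding M_iff
    by (auto simp: commutant_def mult_smult_distrib[of _ n n _ n] mult_smult_assoc_mat[of _ n n _ n])
qed

lemma linear_onD:
  assumes "linear_on V L"
  shows lin_in: "X \<in> V \<Longrightarrow> L X \<in> V" and lin_add: "X \<in> V \<Longrightarrow> Y \<in> V \<Longrightarrow> L (X + Y) = L X + L Y"
    and lin_smult: "X \<in> V \<Longrightarrow> L (c \<cdot>\<^sub>m X) = c \<cdot>\<^sub>m L X"
  using assms by (auto simp: linear_on_def)

lemma linear_on_zero:
  assumes V: "csub V" and L: "linear_on V L"
  shows "L (0\<^sub>m n n) = 0\<^sub>m n n"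
proof -
  have "L (0 \<cdot>\<^sub>m 0\<^sub>m n n) = 0 \<cdot>\<^sub>m L (0\<^sub>m n n)" by (rule lin_smult[OF L csub_zero[OF V]])
  moreover have "L (0\<^sub>m n n) \<in> carrier_mat n n" using csub_carrier[OF V] lin_in[OF L] csub_zero[OF V] by blast
  moreover have "0 \<cdot>\<^sub>m 0\<^sub>m n n = (0\<^sub>m n n :: cmat)" by (intro eq_matI) auto
  moreover have "0 \<cdot>\<^sub>m Z = 0\<^sub>m n n" if "Z \<in> carrier_mat n n" for Z :: cmat using that by (intro eq_matI) auto
  ultimately show ?thesis by metis
qed

lemma csub_fixed:
  assumes V: "csub V" and L: "linear_on V L"
  shows "csub (fixed_algebra n V L)"
  unfolding csub_def fixed_algebra_def
proof (intro conjI ballI allI)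
  show "{X \<in> V. L X = 0\<^sub>m n n} \<subseteq> carrier_mat n n" using csub_carrier[OF V] by blast
  show "0\<^sub>m n n \<in> {X \<in> V. L X = 0\<^sub>m n n}" using linear_on_zero[OF V L] csub_zero[OF V] by simp
  fix X assume X: "X \<in> {X \<in> V. L X = 0\<^sub>m n n}"
  show "X + Y \<in> {X \<in> V. L X = 0\<^sub>m n n}" if "Y \<in> {X \<in> V. L X = 0\<^sub>m n n}" for Y
    using X that lin_add[OF L, of X Y] csub_add[OF V] by simp
  show "c \<cdot>\<^sub>m X \<in> {X \<in> V. L X = 0\<^sub>m n n}" for c
    using X lin_smult[OF L, of X c] csub_smult[OF V] by simp
qed

lemma emb_uminus: "X \<in> carrier_mat n n \<Longrightarrow> \<iota> (- X) = - \<iota> X"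
  using emb_scaleR[of X "-1"] by (simp only: uminus_smult) simp

lemma emb_minus: "X \<in> carrier_mat n n \<Longrightarrow> Y \<in> carrier_mat n n \<Longrightarrow> \<iota> (X - Y) = \<iota> X - \<iota> Y"
  using emb_scaleR[of Y "-1"] emb_add[of X "of_real (-1) \<cdot>\<^sub>m Y"] by (simp only: minus_add_smult) simp

lemma emb_zero: "\<iota> (0\<^sub>m n n) = 0"
  using emb_add[of "0\<^sub>m n n" "0\<^sub>m n n"] by simp

lemma emb_eq_0: "X \<in> carrier_mat n n \<Longrightarrow> \<iota> X = 0 \<longleftrightarrow> X = 0\<^sub>m n n"
  using emb_inj[of X "0\<^sub>m n n"] emb_zero by auto

lemma emb_fin_dim:
  assumes V: "csub V"
  shows "fin_dim (\<iota> ` V)"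
  unfolding fin_dim_def
proof
  note D = csubD[OF V]
  show "subspace (\<iota> ` V)"
    unfolding subspace_def
  proof (intro conjI ballI allI)
    show "0 \<in> \<iota> ` V" using emb_zero D(2) by (intro image_eqI[of _ _ "0\<^sub>m n n"]) auto
  next
    fix x y assume "x \<in> \<iota> ` V" "y \<in> \<iota> ` V"
    then obtain X Y where "X \<in> V" "x = \<iota> X" "Y \<in> V" "y = \<iota> Y" by blast
    then show "x + y \<in> \<iota> ` V" using D by (intro image_eqI[of _ _ "X + Y"]) (auto simp: emb_add)
  next
    fix c x assume "x \<in> \<iota> ` V"
    then obtain X where "X \<in> V" "x = \<iota> X" by blast
    then show "c *\<^sub>R x \<in> \<iota> ` V" using D
      by (intro image_eqI[of _ _ "of_real c \<cdot>\<^sub>m X"]) (auto simp: emb_scaleR)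
  qed
  let ?B = "(\<lambda>(k, c). Poly_Mapping.single k c) ` (({..<n} \<times> {..<n}) \<times> {1, \<i>})"
  have single: "Poly_Mapping.single (i, j) c \<in> span ?B" if "i < n" "j < n" for i j and c :: complex
  proof -
    have "Poly_Mapping.single (i, j) c
        = Re c *\<^sub>R Poly_Mapping.single (i, j) 1 + Im c *\<^sub>R Poly_Mapping.single (i, j) \<i>"
      by (rule poly_mapping_eqI)
        (simp add: lookup_single lookup_add when_def scaleR_poly_mapping.rep_eq complex_eq_iff)
    moreover have "Poly_Mapping.single (i, j) 1 \<in> ?B" "Poly_Mapping.single (i, j) \<i> \<in> ?B"
      using that by (force simp: image_iff)+
    ultimately show ?thesis by (simp only: span_add span_scale span_base)
  qed
  have "\<iota> X \<in> span ?B" for X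
    unfolding emb_def using single by (intro span_sum) auto
  then show "\<exists>B. finite B \<and> \<iota> ` V \<subseteq> span B" by (intro exI[of _ ?B]) auto
qed

abbreviation S :: "(nat \<times> nat \<Rightarrow>\<^sub>0 complex) set" where "S \<equiv> \<iota> ` M"

lemma S_fin_dim: "fin_dim S"
  by (rule emb_fin_dim[OF csub_M])

lemma kms_smult:
  assumes X: "X \<in> carrier_mat n n" and Y: "Y \<in> carrier_mat n n"
  shows "kms_inner n \<sigma> X (c \<cdot>\<^sub>m Y) = c * kms_inner n \<sigma> X Y"
    and "kms_inner n \<sigma> (c \<cdot>\<^sub>m X) Y = cnj c * kms_inner n \<sigma> X Y"
proof -
  have Xc: "mat_adjoint X \<in> carrier_mat n n" using X by simp
  show "kms_inner n \<sigma> X (c \<cdot>\<^sub>m Y) = c * kms_inner n \<sigma> X Y"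
    unfolding kms_inner_def s_def[symmetric] using Xc Y
    by (simp add: mult_smult_distrib[of _ n n _ n] trace_smult[of _ n] del: mat_adjoint_carrier)
  have "mat_adjoint (c \<cdot>\<^sub>m X) = cnj c \<cdot>\<^sub>m mat_adjoint X"
    using X by (intro eq_matI) auto
  then show "kms_inner n \<sigma> (c \<cdot>\<^sub>m X) Y = cnj c * kms_inner n \<sigma> X Y"
    unfolding kms_inner_def s_def[symmetric] using Xc Y
    by (simp add: mult_smult_distrib[of _ n n _ n] mult_smult_assoc_mat[of _ n n _ n] trace_smult[of _ n] del: mat_adjoint_carrier)
qed

text \<open>Replacing \<open>X\<close> by \<open>\<i> X\<close>, or \<open>Y\<close> by \<open>- \<i> Y\<close>, rotates the imaginary part into the real part.  On complex
  subspaces, orthogonality and adjoints for the KMS inner product are therefore the same as for its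
  real part.\<close>

lemma kms_complex:
  assumes "X \<in> carrier_mat n n" "Y \<in> carrier_mat n n"
  shows "kms_inner n \<sigma> X Y = Complex (inner (\<iota> X) (\<iota> Y)) (inner (\<iota> X) (\<iota> (- \<i> \<cdot>\<^sub>m Y)))"
    and "kms_inner n \<sigma> X Y = Complex (inner (\<iota> X) (\<iota> Y)) (inner (\<iota> (\<i> \<cdot>\<^sub>m X)) (\<iota> Y))"
  using assms by (simp_all add: inner_emb kms_smult complex_eq_iff)

lemma kms_orth_iff:
  assumes V: "csub V" and Z: "Z \<in> carrier_mat n n"
  shows "(\<forall>Y\<in>V. kms_inner n \<sigma> Y Z = 0) \<longleftrightarrow> (\<forall>y\<in>\<iota> ` V. inner y (\<iota> Z) = 0)"
proof
  assume "\<forall>Y\<in>V. kms_inner n \<sigma> Y Z = 0"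
  then show "\<forall>y\<in>\<iota> ` V. inner y (\<iota> Z) = 0" using inner_emb csub_carrier[OF V] Z by auto
next
  assume a: "\<forall>y\<in>\<iota> ` V. inner y (\<iota> Z) = 0"
  show "\<forall>Y\<in>V. kms_inner n \<sigma> Y Z = 0"
  proof
    fix Y assume Y: "Y \<in> V"
    then have "inner (\<iota> Y) (\<iota> Z) = 0" "inner (\<iota> (\<i> \<cdot>\<^sub>m Y)) (\<iota> Z) = 0"
      using a csub_smult[OF V] by auto
    then show "kms_inner n \<sigma> Y Z = 0"
      using kms_complex(2)[OF csub_carrier[OF V Y] Z] by (simp add: complex_eq_iff)
  qed
qed

lemma cond_exp_eqI:
  assumes V: "csub V" and X: "X \<in> carrier_mat n n"
    and Z: "Z \<in> V" "\<And>Y. Y \<in> V \<Longrightarrow> kms_inner n \<sigma> Y (X - Z) = 0"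
  shows "cond_exp n \<sigma> V X = Z" "\<iota> Z = oproj (\<iota> ` V) (\<iota> X)"
proof -
  have o: "oproj (\<iota> ` V) (\<iota> X) = \<iota> W"
    if W: "W \<in> V \<and> (\<forall>Y\<in>V. kms_inner n \<sigma> Y (X - W) = 0)" for W
    using W kms_orth_iff[OF V, of "X - W"] emb_minus[OF X, of W] csub_carrier[OF V, of W] X
    by (intro oproj_eqI fin_dim_subspace emb_fin_dim[OF V]) auto
  show "\<iota> Z = oproj (\<iota> ` V) (\<iota> X)" using o[of Z] Z by simp
  show "cond_exp n \<sigma> V X = Z"
    unfolding cond_exp_def
  proof (rule the_equality)
    fix W assume W: "W \<in> V \<and> (\<forall>Y\<in>V. kms_inner n \<sigma> Y (X - W) = 0)"
    then have "\<iota> W = \<iota> Z" using o[OF W] o[of Z] Z by simp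
    then show "W = Z" using W Z(1) by (intro emb_inj csub_carrier[OF V]) auto
  qed (use Z in blast)
qed

lemma cond_exp_transfer:
  assumes V: "csub V" and X: "X \<in> carrier_mat n n"
  shows cond_exp_in: "cond_exp n \<sigma> V X \<in> V"
    and cond_exp_orth: "Y \<in> V \<Longrightarrow> kms_inner n \<sigma> Y (X - cond_exp n \<sigma> V X) = 0"
    and cond_exp_emb: "\<iota> (cond_exp n \<sigma> V X) = oproj (\<iota> ` V) (\<iota> X)"
proof -
  note f = emb_fin_dim[OF V]
  obtain Z where Z: "oproj (\<iota> ` V) (\<iota> X) = \<iota> Z" "Z \<in> V" using oproj_in[OF f, of "\<iota> X"] by (rule imageE)
  have "\<forall>y\<in>\<iota> ` V. inner y (\<iota> (X - Z)) = 0"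
    using oproj_orth[OF f, of _ "\<iota> X"] Z emb_minus[OF X csub_carrier[OF V Z(2)]] by simp
  then have "\<forall>Y\<in>V. kms_inner n \<sigma> Y (X - Z) = 0"
    using kms_orth_iff[OF V, of "X - Z"] csub_carrier[OF V Z(2)] by simp
  then show "cond_exp n \<sigma> V X \<in> V" "\<iota> (cond_exp n \<sigma> V X) = oproj (\<iota> ` V) (\<iota> X)"
    "Y \<in> V \<Longrightarrow> kms_inner n \<sigma> Y (X - cond_exp n \<sigma> V X) = 0"
    using Z cond_exp_eqI[OF V X Z(2)] by auto
qed

text \<open>An operator on \<open>M\<close> as an operator on the image of \<open>M\<close>; its values outside that image are arbitrary.\<close>

definition hat :: "superop \<Rightarrow> (nat \<times> nat \<Rightarrow>\<^sub>0 complex) \<Rightarrow> (nat \<times> nat \<Rightarrow>\<^sub>0 complex)" where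
  "hat L x = \<iota> (L (inv_into M \<iota> x))"

lemma inv_emb: "X \<in> M \<Longrightarrow> inv_into M \<iota> (\<iota> X) = X"
  by (rule inv_into_f_f) (auto simp: inj_on_def dest: emb_inj[OF M_carrier M_carrier])

lemma hat_emb: "X \<in> M \<Longrightarrow> hat L (\<iota> X) = \<iota> (L X)"
  by (simp add: hat_def inv_emb)

lemma hat_in: "linear_on M L \<Longrightarrow> x \<in> S \<Longrightarrow> hat L x \<in> S"
  using hat_emb lin_in by auto

lemma hat_lin:
  assumes L: "linear_on M L"
  shows "lin_on S (hat L)"
  unfolding lin_on_def
proof (intro conjI ballI allI)
  fix x y assume "x \<in> S" "y \<in> S"
  then obtain X Y where X: "X \<in> M" "x = \<iota> X" and Y: "Y \<in> M" "y = \<iota> Y" by blast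
  then have "hat L (x + y) = hat L (\<iota> (X + Y))" by (simp add: emb_add M_carrier)
  also have "\<dots> = \<iota> (L X + L Y)" using X Y by (simp add: hat_emb csub_add[OF csub_M] lin_add[OF L])
  also have "\<dots> = hat L x + hat L y" using X Y by (simp add: hat_emb emb_add M_carrier lin_in[OF L])
  finally show "hat L (x + y) = hat L x + hat L y" .
next
  fix c x assume "x \<in> S"
  then obtain X where X: "X \<in> M" "x = \<iota> X" by blast
  then have "hat L (c *\<^sub>R x) = hat L (\<iota> (of_real c \<cdot>\<^sub>m X))" by (simp add: emb_scaleR M_carrier)
  also have "\<dots> = \<iota> (of_real c \<cdot>\<^sub>m L X)" using X by (simp add: hat_emb csub_smult[OF csub_M] lin_smult[OF L])
  also have "\<dots> = c *\<^sub>R hat L x" using X by (simp add: hat_emb emb_scaleR M_carrier lin_in[OF L])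
  finally show "hat L (c *\<^sub>R x) = c *\<^sub>R hat L x" .
qed

lemma emb_fixed: "linear_on M L \<Longrightarrow> \<iota> ` fixed_algebra n M L = ker_on S (hat L)"
  using lin_in M_carrier by (auto simp: fixed_algebra_def ker_on_def hat_emb emb_eq_0 emb_zero)

lemma kms_adjoint_transfer:
  assumes L: "linear_on M L" and X: "X \<in> M"
  shows kms_adjoint_in: "kms_adjoint n \<sigma> M L X \<in> M"
    and kms_adjoint_inner: "Y \<in> M \<Longrightarrow> inner (\<iota> (kms_adjoint n \<sigma> M L X)) (\<iota> Y) = inner (\<iota> X) (\<iota> (L Y))"
proof -
  have "lin_on S (\<lambda>y. inner (\<iota> X) (hat L y))"
    using hat_lin[OF L] by (simp add: lin_on_def inner_add_right)
  then obtain z where z: "z \<in> S" "\<And>y. y \<in> S \<Longrightarrow> inner z y = inner (\<iota> X) (hat L y)"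
    using riesz_on[OF S_fin_dim] by blast
  from z(1) obtain Z where Z: "Z \<in> M" "z = \<iota> Z" by blast
  have ZY: "inner (\<iota> Z) (\<iota> Y) = inner (\<iota> X) (\<iota> (L Y))" if "Y \<in> M" for Y
    using z(2)[of "\<iota> Y"] Z(2) that by (simp add: hat_emb)
  have "kms_adjoint n \<sigma> M L X = Z"
    unfolding adjoint_on_def
  proof (rule the_equality)
    have "kms_inner n \<sigma> Z Y = kms_inner n \<sigma> X (L Y)" if Y: "Y \<in> M" for Y
      using ZY[OF Y] ZY[OF csub_smult[OF csub_M Y], of "- \<i>"] lin_smult[OF L Y, of "- \<i>"]
      by (simp add: kms_complex(1) M_carrier X Y Z(1) lin_in[OF L])
    then show "Z \<in> M \<and> (\<forall>Y\<in>M. kms_inner n \<sigma> Z Y = kms_inner n \<sigma> X (L Y))" using Z by blast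
  next
    fix W assume W: "W \<in> M \<and> (\<forall>Y\<in>M. kms_inner n \<sigma> W Y = kms_inner n \<sigma> X (L Y))"
    then have "inner (\<iota> W) (\<iota> Y) = inner (\<iota> Z) (\<iota> Y)" if "Y \<in> M" for Y
      using ZY[OF that] that by (simp add: inner_emb M_carrier X lin_in[OF L])
    from this[of W] this[of Z] have "inner (\<iota> W - \<iota> Z) (\<iota> W - \<iota> Z) = 0"
      using W Z by (simp add: inner_diff_left inner_diff_right)
    then show "W = Z" using emb_inj W Z M_carrier by simp
  qed
  then show "kms_adjoint n \<sigma> M L X \<in> M"
    "Y \<in> M \<Longrightarrow> inner (\<iota> (kms_adjoint n \<sigma> M L X)) (\<iota> Y) = inner (\<iota> X) (\<iota> (L Y))"
    using Z ZY by auto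
qed

text \<open>For a self-adjoint map, the least squares condition says that \<open>X - L Z\<close> is the kernel component of
  \<open>X\<close>.\<close>

lemma pseudoinverse_transfer:
  assumes L: "linear_on M L" and N: "sym_nonneg S (hat L)" and X: "X \<in> M"
  shows pseudoinverse_in: "pseudoinverse n \<sigma> M L X \<in> M"
    and pseudoinverse_emb: "\<iota> (pseudoinverse n \<sigma> M L X) = pinv S (hat L) (\<iota> X)"
proof -
  let ?N = "hat L" and ?K = "fixed_algebra n M L"
  note K = emb_fixed[OF L] and cK = csub_fixed[OF csub_M L] and KF = ker_fin_dim[OF N]
  have x: "\<iota> X \<in> S" using X by blast
  obtain Z where Z: "Z \<in> M" "pinv S ?N (\<iota> X) = \<iota> Z" using pinv_in[OF N x] by (rule imageE)
  have rng: "csub (L ` M)"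
    unfolding csub_def
  proof (intro conjI ballI allI)
    show "L ` M \<subseteq> carrier_mat n n" using lin_in[OF L] M_carrier by blast
    show "0\<^sub>m n n \<in> L ` M" using linear_on_zero[OF csub_M L, symmetric] csub_zero[OF csub_M] by (rule image_eqI)
    fix Y assume "Y \<in> L ` M" then obtain Y' where Y: "Y' \<in> M" "Y = L Y'" by blast
    show "Y + W \<in> L ` M" if WL: "W \<in> L ` M" for W
    proof -
      obtain W' where W: "W' \<in> M" "W = L W'" using WL by blast
      then have "Y + W = L (Y' + W')" using Y lin_add[OF L] by simp
      then show ?thesis using csub_add[OF csub_M Y(1) W(1)] by (rule image_eqI)
    qed
    show "c \<cdot>\<^sub>m Y \<in> L ` M" for c
    proof -
      have "c \<cdot>\<^sub>m Y = L (c \<cdot>\<^sub>m Y')" using Y lin_smult[OF L] by simp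
      then show ?thesis using csub_smult[OF csub_M Y(1)] by (rule image_eqI)
    qed
  qed
  have o1: "(\<forall>Y\<in>?K. kms_inner n \<sigma> Y W = 0) \<longleftrightarrow> (\<forall>y\<in>ker_on S ?N. inner y (\<iota> W) = 0)" if "W \<in> M" for W
    using kms_orth_iff[OF cK M_carrier[OF that]] K by simp
  have o2: "(\<forall>W\<in>M. kms_inner n \<sigma> (L W) (X - L V) = 0) \<longleftrightarrow> (\<forall>w\<in>S. inner (?N w) (\<iota> X - ?N (\<iota> V)) = 0)"
    if V: "V \<in> M" for V
  proof -
    have c: "X - L V \<in> carrier_mat n n" using X V lin_in[OF L] M_carrier by simp
    have "\<iota> ` (L ` M) = ?N ` S" by (auto simp: image_image hat_emb)
    then show ?thesis using kms_orth_iff[OF rng c] X V lin_in[OF L] M_carrier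
      by (simp add: emb_minus hat_emb)
  qed
  have S0: "subspace S" using S_fin_dim by (simp add: fin_dim_def)
  have "pseudoinverse n \<sigma> M L X = Z"
    unfolding pseudoinverse_def
  proof (rule the_equality)
    have "inner (?N w) (\<iota> X - ?N (\<iota> Z)) = 0" if "w \<in> S" for w
      using pinv_apply_general[OF N x] ker_orth_range[OF N that oproj_in[OF KF]]
      by (simp add: Z(2) inner_commute)
    moreover have "inner y (\<iota> Z) = 0" if "y \<in> ker_on S ?N" for y
      using pinv_orth[OF N x that] by (simp add: Z(2))
    ultimately show "Z \<in> M \<and> (\<forall>Y\<in>?K. kms_inner n \<sigma> Y Z = 0) \<and> (\<forall>W\<in>M. kms_inner n \<sigma> (L W) (X - L Z) = 0)"
      unfolding o1[OF Z(1)] o2[OF Z(1)] using Z(1) by blast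
  next
    fix W assume W: "W \<in> M \<and> (\<forall>Y\<in>?K. kms_inner n \<sigma> Y W = 0) \<and> (\<forall>V\<in>M. kms_inner n \<sigma> (L V) (X - L W) = 0)"
    then have WM: "W \<in> M" by blast
    have W1: "inner y (\<iota> W) = 0" if "y \<in> ker_on S ?N" for y
      using W that o1[OF WM] by blast
    have W2: "inner (?N w) (\<iota> X - ?N (\<iota> W)) = 0" if "w \<in> S" for w
      using W that o2[OF WM] by blast
    let ?e = "\<iota> X - ?N (\<iota> W)"
    have eS: "?e \<in> S" using x sym_nonneg_in[OF N] WM S0 by (intro subspace_diff) auto
    have "inner (?N ?e) (?N ?e) = inner (?N (?N ?e)) ?e"
      using sym_nonneg_sym[OF N sym_nonneg_in[OF N eS] eS] by simp
    also have "\<dots> = 0" by (rule W2[OF sym_nonneg_in[OF N eS]])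
    finally have eK: "?e \<in> ker_on S ?N" using eS by (simp add: ker_on_def)
    have "oproj (ker_on S ?N) (\<iota> X) = ?e"
      using eK ker_orth_range[OF N, of "\<iota> W"] WM
      by (intro oproj_eqI) (auto intro: fin_dim_subspace[OF KF])
    then have "?N (\<iota> W) = \<iota> X - oproj (ker_on S ?N) (\<iota> X)" by simp
    then have "pinv S ?N (\<iota> X) = \<iota> W" using WM W1 by (intro pinv_eqI[OF N]) auto
    then show "W = Z" using Z WM emb_inj M_carrier by metis
  qed
  then show "pseudoinverse n \<sigma> M L X \<in> M" "\<iota> (pseudoinverse n \<sigma> M L X) = pinv S ?N (\<iota> X)" using Z by auto
qed

end

context state_space
begin

section \<open>The semigroup as a curve in the real inner product space\<close>

abbreviation entry_term :: "nat \<Rightarrow> nat \<Rightarrow> nat \<Rightarrow> nat \<Rightarrow> complex \<Rightarrow> nat \<times> nat \<Rightarrow>\<^sub>0 complex" where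
  "entry_term i j k l c \<equiv> Poly_Mapping.single (i, j) (R $$ (i, k) * c * R $$ (l, j))"

lemma bounded_linear_entry_term: "bounded_linear (entry_term i j k l)"
  by (intro bounded_linear_compose[OF bounded_linear_single] bounded_linear_compose[OF bounded_linear_mult_left]
      bounded_linear_mult_right)

text \<open>A finite linear combination of the entries, so that limits and derivatives can be taken entrywise.\<close>

lemma emb_entries:
  assumes Y: "Y \<in> carrier_mat n n"
  shows "\<iota> Y = (\<Sum>i<n. \<Sum>j<n. \<Sum>k<n. \<Sum>l<n. entry_term i j k l (Y $$ (k, l)))"
proof -
  have e: "(R * Y * R) $$ (i, j) = (\<Sum>k<n. \<Sum>l<n. R $$ (i, k) * Y $$ (k, l) * R $$ (l, j))"
    if i: "i < n" and j: "j < n" for i j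
  proof -
    have "(R * Y * R) $$ (i, j) = (\<Sum>l<n. (\<Sum>k<n. R $$ (i, k) * Y $$ (k, l)) * R $$ (l, j))"
      using mult_entry[of "R * Y" n n R n i j] mult_entry[of R n n Y n i] i j Y
      by (simp del: index_mult_mat)
    also have "\<dots> = (\<Sum>l<n. \<Sum>k<n. R $$ (i, k) * Y $$ (k, l) * R $$ (l, j))"
      by (simp add: sum_distrib_right)
    also have "\<dots> = (\<Sum>k<n. \<Sum>l<n. R $$ (i, k) * Y $$ (k, l) * R $$ (l, j))" by (rule sum.swap)
    finally show ?thesis .
  qed
  have single: "Poly_Mapping.single k (\<Sum>a\<in>A. f a) = (\<Sum>a\<in>A. Poly_Mapping.single k (f a))"
    for k and f :: "nat \<Rightarrow> complex" and A
    using linear_sum[OF bounded_linear.linear[OF bounded_linear_single]] .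
  show ?thesis unfolding emb_def by (simp add: e single del: index_mult_mat)
qed

lemma emb_norm_entries:
  obtains K where "\<And>Y B. Y \<in> carrier_mat n n \<Longrightarrow> (\<And>i j. i < n \<Longrightarrow> j < n \<Longrightarrow> cmod (Y $$ (i, j)) \<le> B) \<Longrightarrow> norm (\<iota> Y) \<le> K * B"
proof -
  let ?K = "\<Sum>i<n. \<Sum>j<n. \<Sum>k<n. \<Sum>l<n. cmod (R $$ (i, k)) * cmod (R $$ (l, j))"
  have "norm (\<iota> Y) \<le> ?K * B"
    if Y: "Y \<in> carrier_mat n n" and B: "\<And>i j. i < n \<Longrightarrow> j < n \<Longrightarrow> cmod (Y $$ (i, j)) \<le> B" for Y B
  proof -
    have "norm (\<iota> Y) \<le> (\<Sum>i<n. \<Sum>j<n. \<Sum>k<n. \<Sum>l<n. cmod (R $$ (i, k)) * cmod (R $$ (l, j)) * B)"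
      unfolding emb_entries[OF Y]
    proof (intro sum_norm_le)
      fix i j k l assume "i \<in> {..<n}" "j \<in> {..<n}" "k \<in> {..<n}" "l \<in> {..<n}"
      then have "cmod (R $$ (i, k) * Y $$ (k, l) * R $$ (l, j)) \<le> cmod (R $$ (i, k)) * B * cmod (R $$ (l, j))"
        using B[of k l] by (simp add: norm_mult mult_left_mono mult_right_mono)
      then show "norm (entry_term i j k l (Y $$ (k, l)))
          \<le> cmod (R $$ (i, k)) * cmod (R $$ (l, j)) * B"
        by (simp add: norm_single mult_ac)
    qed
    also have "\<dots> = ?K * B" by (simp add: sum_distrib_right)
    finally show ?thesis .
  qed
  then show ?thesis using that by blast
qed

lemma iterate_in: "linear_on M L \<Longrightarrow> X \<in> M \<Longrightarrow> (L ^^ m) X \<in> M"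
  by (induction m) (auto intro: lin_in)

text \<open>In finite dimension \<open>L\<close> is bounded for the KMS norm, and the entries are bounded functionals; this
  makes the exponential series converge.\<close>

lemma iterate_entry_bound:
  assumes L: "linear_on M L" and X: "X \<in> M" and ij: "i < n" "j < n"
  obtains a b where "\<And>m. cmod ((L ^^ m) X $$ (i, j)) \<le> a * b ^ m"
proof -
  obtain b where b: "b > 0" "\<And>x. x \<in> S \<Longrightarrow> norm (hat L x) \<le> b * norm x"
    using lin_on_bound[OF S_fin_dim hat_lin[OF L]] by blast
  have it: "norm (\<iota> ((L ^^ m) X)) \<le> b ^ m * norm (\<iota> X)" for m
  proof (induction m)
    case (Suc m)
    have "norm (\<iota> ((L ^^ Suc m) X)) = norm (hat L (\<iota> ((L ^^ m) X)))"
      using iterate_in[OF L X] by (simp add: hat_emb)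
    also have "\<dots> \<le> b * norm (\<iota> ((L ^^ m) X))" using iterate_in[OF L X] by (intro b(2)) blast
    also have "\<dots> \<le> b * (b ^ m * norm (\<iota> X))" using Suc b(1) by (intro mult_left_mono) auto
    finally show ?case by (simp add: mult.assoc)
  qed simp
  let ?f = "\<lambda>x. inv_into M \<iota> x $$ (i, j)"
  have "lin_on S ?f"
    unfolding lin_on_def
  proof (intro conjI ballI allI)
    fix x y assume "x \<in> S" "y \<in> S"
    then obtain X Y where X: "X \<in> M" "x = \<iota> X" and Y: "Y \<in> M" "y = \<iota> Y" by blast
    then have "x + y = \<iota> (X + Y)" by (simp add: emb_add M_carrier)
    then have "?f (x + y) = (X + Y) $$ (i, j)" using X Y inv_emb csub_add[OF csub_M] by simp
    then show "?f (x + y) = ?f x + ?f y" using X Y ij M_carrier[of X] M_carrier[of Y] by (simp add: inv_emb)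
  next
    fix c x assume "x \<in> S"
    then obtain X where X: "X \<in> M" "x = \<iota> X" by blast
    then have "c *\<^sub>R x = \<iota> (of_real c \<cdot>\<^sub>m X)" by (simp add: emb_scaleR M_carrier)
    then have "?f (c *\<^sub>R x) = (of_real c \<cdot>\<^sub>m X) $$ (i, j)" using X inv_emb csub_smult[OF csub_M] by simp
    then show "?f (c *\<^sub>R x) = c *\<^sub>R ?f x" using X ij M_carrier[of X] by (simp add: inv_emb scaleR_conv_of_real)
  qed
  then obtain K where K: "K > 0" "\<And>x. x \<in> S \<Longrightarrow> norm (?f x) \<le> K * norm x"
    using lin_on_bound[OF S_fin_dim] by blast
  have "cmod ((L ^^ m) X $$ (i, j)) \<le> (K * norm (\<iota> X)) * b ^ m" for m
  proof -
    have "cmod ((L ^^ m) X $$ (i, j)) \<le> K * norm (\<iota> ((L ^^ m) X))"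
      using K(2) iterate_in[OF L X] inv_emb by (metis imageI)
    also have "\<dots> \<le> K * (b ^ m * norm (\<iota> X))" using it K(1) by (intro mult_left_mono) auto
    finally show ?thesis by (simp add: mult_ac)
  qed
  then show ?thesis using that by blast
qed

lemma exp_series_entry_summable:
  assumes L: "linear_on M L" and X: "X \<in> M" and ij: "i < n" "j < n"
  shows "summable (\<lambda>m. (L ^^ m) X $$ (i, j) / fact m * (z::complex) ^ m)"
proof -
  obtain a b where ab: "\<And>m. cmod ((L ^^ m) X $$ (i, j)) \<le> a * b ^ m"
    using iterate_entry_bound[OF L X ij] by blast
  have "summable (\<lambda>m. a * ((b * cmod z) ^ m /\<^sub>R fact m))"
    by (intro summable_mult summable_exp_generic)
  then show ?thesis
  proof (rule summable_comparison_test')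
    fix m :: nat
    have "norm ((L ^^ m) X $$ (i, j) / fact m * z ^ m) = cmod ((L ^^ m) X $$ (i, j)) * (cmod z ^ m / fact m)"
      by (simp add: norm_mult norm_divide norm_power)
    also have "\<dots> \<le> a * b ^ m * (cmod z ^ m / fact m)" using ab by (intro mult_right_mono) auto
    finally show "norm ((L ^^ m) X $$ (i, j) / fact m * z ^ m) \<le> a * ((b * cmod z) ^ m /\<^sub>R fact m)"
      by (simp add: power_mult_distrib divide_inverse mult_ac)
  qed
qed

lemma super_exp_carrier [simp]: "super_exp n t L X \<in> carrier_mat n n"
  by (simp add: super_exp_def)

lemma super_exp_dim [simp]: "dim_row (super_exp n t L X) = n" "dim_col (super_exp n t L X) = n"
  by (simp_all add: super_exp_def)

lemma super_exp_entry:
  assumes "i < n" "j < n"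
  shows "super_exp n t L X $$ (i, j) = suminf (\<lambda>m. (L ^^ m) X $$ (i, j) / fact m * (of_real t) ^ m)"
  using assms by (simp add: super_exp_def mult_ac divide_inverse)

lemma super_exp_entry_sums:
  assumes "linear_on M L" "X \<in> M" "i < n" "j < n"
  shows "(\<lambda>m. (L ^^ m) X $$ (i, j) / fact m * (of_real t) ^ m) sums (super_exp n t L X $$ (i, j))"
  unfolding super_exp_entry[OF assms(3,4)] by (rule summable_sums[OF exp_series_entry_summable[OF assms]])

lemma super_exp_zero: "X \<in> carrier_mat n n \<Longrightarrow> super_exp n 0 L X = X"
proof (rule eq_matI)
  fix i j assume X: "X \<in> carrier_mat n n" and ij: "i < dim_row X" "j < dim_col X"
  then have ij: "i < n" "j < n" by auto
  show "super_exp n 0 L X $$ (i, j) = X $$ (i, j)"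
    unfolding super_exp_entry[OF ij] by (simp only: of_real_0 powser_zero) simp
qed (auto simp: super_exp_def)

lemma super_exp_sums:
  assumes L: "linear_on M L" and X: "X \<in> M"
  shows "(\<lambda>m. (t ^ m / fact m) *\<^sub>R \<iota> ((L ^^ m) X)) sums \<iota> (super_exp n t L X)"
proof -
  have "(\<lambda>m. \<Sum>i<n. \<Sum>j<n. \<Sum>k<n. \<Sum>l<n. entry_term i j k l ((L ^^ m) X $$ (k, l) / fact m * (of_real t) ^ m))
      sums (\<Sum>i<n. \<Sum>j<n. \<Sum>k<n. \<Sum>l<n. entry_term i j k l (super_exp n t L X $$ (k, l)))"
    by (intro sums_sum bounded_linear.sums[OF bounded_linear_entry_term] super_exp_entry_sums[OF L X]) auto
  moreover have "(\<Sum>i<n. \<Sum>j<n. \<Sum>k<n. \<Sum>l<n. entry_term i j k l ((L ^^ m) X $$ (k, l) / fact m * (of_real t) ^ m))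
      = (t ^ m / fact m) *\<^sub>R \<iota> ((L ^^ m) X)" for m
  proof -
    have "entry_term i j k l ((L ^^ m) X $$ (k, l) / fact m * (of_real t) ^ m)
        = (t ^ m / fact m) *\<^sub>R entry_term i j k l ((L ^^ m) X $$ (k, l))" for i j k l
      by (simp add: linear_scale[OF bounded_linear.linear[OF bounded_linear_single], symmetric]
          scaleR_conv_of_real divide_inverse mult_ac)
    then show ?thesis
      unfolding emb_entries[OF M_carrier[OF iterate_in[OF L X]]] scaleR_sum_right by simp
  qed
  ultimately show ?thesis by (simp only: emb_entries[OF super_exp_carrier, symmetric])
qed

lemma super_exp_derivative:
  assumes L: "linear_on M L" and X: "X \<in> M"
  shows "((\<lambda>t. \<iota> (super_exp n t L X)) has_vector_derivative \<iota> (super_exp n t L (L X))) (at t)"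
proof -
  have entry: "((\<lambda>t. super_exp n t L X $$ (k, l)) has_vector_derivative super_exp n t L (L X) $$ (k, l)) (at t)"
    if kl: "k < n" "l < n" for k l
  proof -
    let ?a = "\<lambda>m. (L ^^ m) X $$ (k, l) / fact m"
    have "((\<lambda>z. suminf (\<lambda>m. ?a m * z ^ m)) has_field_derivative suminf (\<lambda>m. diffs ?a m * (of_real t) ^ m)) (at (of_real t))"
      by (rule termdiffs_strong_converges_everywhere[OF exp_series_entry_summable[OF L X kl]])
    moreover have "diffs ?a m = (L ^^ m) (L X) $$ (k, l) / fact m" for m
    proof -
      have "(L ^^ Suc m) X = (L ^^ m) (L X)" by (simp add: funpow_swap1)
      then show ?thesis by (simp add: diffs_def del: of_nat_Suc funpow.simps)
    qed
    ultimately have "((\<lambda>z. suminf (\<lambda>m. ?a m * z ^ m)) has_field_derivative super_exp n t L (L X) $$ (k, l)) (at (of_real t))"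
      by (simp add: super_exp_entry[OF kl])
    from has_vector_derivative_real_field[OF this] show ?thesis by (simp add: super_exp_entry[OF kl])
  qed
  have "((\<lambda>t. \<Sum>i<n. \<Sum>j<n. \<Sum>k<n. \<Sum>l<n. entry_term i j k l (super_exp n t L X $$ (k, l))) has_vector_derivative
      (\<Sum>i<n. \<Sum>j<n. \<Sum>k<n. \<Sum>l<n. entry_term i j k l (super_exp n t L (L X) $$ (k, l)))) (at t)"
    by (intro has_vector_derivative_sum bounded_linear.has_vector_derivative[OF bounded_linear_entry_term] entry) auto
  then show ?thesis by (simp only: emb_entries[OF super_exp_carrier, symmetric])
qed

lemma super_exp_commute:
  assumes L: "linear_on M L" and X: "X \<in> M" and m: "super_exp n t L X \<in> M"
  shows "\<iota> (super_exp n t L (L X)) = hat L (\<iota> (super_exp n t L X))"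
proof -
  obtain g where g: "bounded_linear g" "\<And>x. x \<in> S \<Longrightarrow> g x = hat L x"
    using lin_on_extends[OF S_fin_dim hat_lin[OF L]] by blast
  have "(\<lambda>k. g ((t ^ k / fact k) *\<^sub>R \<iota> ((L ^^ k) X))) sums g (\<iota> (super_exp n t L X))"
    by (rule bounded_linear.sums[OF g(1) super_exp_sums[OF L X]])
  moreover have "g ((t ^ k / fact k) *\<^sub>R \<iota> ((L ^^ k) X)) = (t ^ k / fact k) *\<^sub>R \<iota> ((L ^^ k) (L X))" for k
  proof -
    have "g (\<iota> ((L ^^ k) X)) = \<iota> (L ((L ^^ k) X))"
      using g(2) iterate_in[OF L X] by (simp add: hat_emb)
    also have "L ((L ^^ k) X) = (L ^^ k) (L X)" by (simp add: funpow_swap1)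
    finally show ?thesis using linear_scale[OF bounded_linear.linear[OF g(1)]] by simp
  qed
  ultimately have "(\<lambda>k. (t ^ k / fact k) *\<^sub>R \<iota> ((L ^^ k) (L X))) sums g (\<iota> (super_exp n t L X))" by simp
  from sums_unique2[OF super_exp_sums[OF L lin_in[OF L X]] this] show ?thesis using g(2) m by simp
qed

lemma super_exp_trajectory:
  assumes q: "qms_generator n M L" and X: "X \<in> M"
  shows "0 \<le> t \<Longrightarrow> super_exp n t L X \<in> M"
    and "0 \<le> t \<Longrightarrow> ((\<lambda>t. \<iota> (super_exp n t L X)) has_vector_derivative hat L (\<iota> (super_exp n t L X))) (at t)"
proof -
  have L: "linear_on M L" using q by (simp add: qms_generator_def)
  show m: "super_exp n t L X \<in> M" if "0 \<le> t" for t
  proof -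
    have "linear_on M (super_exp n t L)" using q that by (simp add: qms_generator_def completely_positive_def)
    then show ?thesis using X by (rule lin_in)
  qed
  show "((\<lambda>t. \<iota> (super_exp n t L X)) has_vector_derivative hat L (\<iota> (super_exp n t L X))) (at t)" if "0 \<le> t"
    using super_exp_derivative[OF L X, of t] super_exp_commute[OF L X m[OF that]] by simp
qed

section \<open>Uniform bounds for unital positive maps\<close>

lemma cp_positive:
  assumes T: "completely_positive n M T" and A: "A \<in> M" "psd n A"
  shows "psd n (T A)"
proof -
  have lin: "linear_on M T" using T by (simp add: completely_positive_def)
  have "block_psd n 1 (\<lambda>_ _. A)" using A(2) by (auto simp: block_psd_def psd_def)
  moreover have "\<forall>k A. (\<forall>i<k. \<forall>j<k. A i j \<in> M) \<longrightarrow> block_psd n k A \<longrightarrow> block_psd n k (\<lambda>i j. T (A i j))"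
    using T unfolding completely_positive_def by (rule conjunct2)
  from this[rule_format, of 1 "\<lambda>_ _. A"] have "block_psd n 1 (\<lambda>_ _. A) \<Longrightarrow> block_psd n 1 (\<lambda>_ _. T A)"
    using A(1) by simp
  ultimately have "block_psd n 1 (\<lambda>_ _. T A)" by simp
  then have "0 \<le> (T A *\<^sub>v v) \<bullet>c v" if "v \<in> carrier_vec n" for v
    using that unfolding block_psd_def by (auto dest: spec[of _ "\<lambda>_. v"])
  then show ?thesis using M_carrier[OF lin_in[OF lin A(1)]] by (simp add: psd_def)
qed

lemma hermitian_shift_psd:
  assumes H: "H \<in> carrier_mat n n" and adj: "mat_adjoint H = H"
    and c: "c = (\<Sum>i<n. \<Sum>j<n. cmod (H $$ (i, j)))"
  shows "psd n (of_real c \<cdot>\<^sub>m 1\<^sub>m n + H)"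
  unfolding psd_def
proof (intro conjI ballI)
  show "of_real c \<cdot>\<^sub>m 1\<^sub>m n + H \<in> carrier_mat n n" using H by simp
  fix v :: "complex vec" assume v: "v \<in> carrier_vec n"
  let ?r = "\<Sum>k<n. (cmod (v $ k))\<^sup>2"
  have e: "((of_real c \<cdot>\<^sub>m 1\<^sub>m n + H) *\<^sub>v v) \<bullet>c v = of_real (c * ?r) + (H *\<^sub>v v) \<bullet>c v"
  proof -
    have "(of_real c \<cdot>\<^sub>m 1\<^sub>m n + H) *\<^sub>v v = of_real c \<cdot>\<^sub>v v + H *\<^sub>v v"
      using H v by (simp add: add_mult_distrib_mat_vec[of _ n n] smult_mult_mat_vec[of _ n n])
    then show ?thesis using H v cscalar_prod_self[OF v] by (simp add: add_scalar_prod_distrib[of _ n])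
  qed
  have real: "Im ((H *\<^sub>v v) \<bullet>c v) = 0"
  proof -
    have "(H *\<^sub>v v) \<bullet>c v = v \<bullet>c (H *\<^sub>v v)" using adjoint_move[OF H v v] adj by simp
    also have "\<dots> = cnj ((H *\<^sub>v v) \<bullet>c v)"
      using v H by (simp add: cscalar_prod_sum[of _ n] mult.commute del: index_mult_mat_vec)
    finally show ?thesis by (simp add: complex_eq_iff)
  qed
  have "cmod ((H *\<^sub>v v) \<bullet>c v) \<le> c * ?r"
  proof -
    have pair: "cmod (v $ j) * cmod (v $ i) \<le> ?r" if "i < n" "j < n" for i j
    proof -
      have le: "(cmod (v $ k))\<^sup>2 \<le> ?r" if "k < n" for k
        using that by (intro member_le_sum) auto
      have "2 * (cmod (v $ j) * cmod (v $ i)) \<le> (cmod (v $ j))\<^sup>2 + (cmod (v $ i))\<^sup>2"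
        using zero_le_power2[of "cmod (v $ j) - cmod (v $ i)"] by (simp add: power2_diff)
      then show ?thesis using le[OF that(1)] le[OF that(2)] by linarith
    qed
    have "cmod ((H *\<^sub>v v) \<bullet>c v) \<le> (\<Sum>i<n. \<Sum>j<n. cmod (H $$ (i, j)) * ?r)"
      unfolding quadratic_form[OF H v]
    proof (intro sum_norm_le)
      fix i j assume "i \<in> {..<n}" "j \<in> {..<n}"
      then show "cmod (H $$ (i, j) * v $ j * cnj (v $ i)) \<le> cmod (H $$ (i, j)) * ?r"
        using mult_left_mono[OF pair, of i j "cmod (H $$ (i, j))"] by (simp add: norm_mult mult.assoc)
    qed
    then show ?thesis by (simp add: c sum_distrib_right)
  qed
  then have "- (c * ?r) \<le> Re ((H *\<^sub>v v) \<bullet>c v)"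
    using abs_Re_le_cmod[of "(H *\<^sub>v v) \<bullet>c v"] by linarith
  then show "0 \<le> ((of_real c \<cdot>\<^sub>m 1\<^sub>m n + H) *\<^sub>v v) \<bullet>c v"
    unfolding e complex_nonneg_iff using real by simp
qed

text \<open>A unital positive map preserves \<open>- c \<le> H \<le> c\<close>, and positive semidefinite matrices between \<open>0\<close> and \<open>2 c\<close>
  have entries of size at most \<open>2 c\<close>.\<close>

lemma hermitian_image_bound:
  assumes H: "H \<in> M" and adj: "mat_adjoint H = H"
  obtains c where "\<And>T i j. completely_positive n M T \<Longrightarrow> T (1\<^sub>m n) = 1\<^sub>m n \<Longrightarrow> i < n \<Longrightarrow> j < n \<Longrightarrow>
    cmod (T H $$ (i, j)) \<le> c"
proof -
  define c where "c = (\<Sum>i<n. \<Sum>j<n. cmod (H $$ (i, j)))"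
  have c0: "0 \<le> c" unfolding c_def by (intro sum_nonneg) auto
  note Hc = M_carrier[OF H]
  let ?u = "of_real c \<cdot>\<^sub>m 1\<^sub>m n"
  have plus: "psd n (?u + H)" by (rule hermitian_shift_psd[OF Hc adj c_def])
  have minus: "psd n (?u + (- H))"
  proof (rule hermitian_shift_psd)
    show "mat_adjoint (- H) = - H"
    proof (rule eq_matI)
      fix i j assume "i < dim_row (- H)" "j < dim_col (- H)"
      then have ij: "i < n" "j < n" using Hc by auto
      have "cnj (H $$ (j, i)) = H $$ (i, j)"
        using arg_cong[OF adj, of "\<lambda>A. A $$ (i, j)"] ij Hc by simp
      then show "mat_adjoint (- H) $$ (i, j) = (- H) $$ (i, j)" using ij Hc by simp
    qed (use Hc in auto)
    show "c = (\<Sum>i<n. \<Sum>j<n. cmod ((- H) $$ (i, j)))" using Hc by (simp add: c_def)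
  qed (use Hc in simp)
  have "cmod (T H $$ (i, j)) \<le> 3 * c"
    if T: "completely_positive n M T" and unit: "T (1\<^sub>m n) = 1\<^sub>m n" and i: "i < n" and j: "j < n" for T i j
  proof -
    have L: "linear_on M T" using T by (simp add: completely_positive_def)
    note D = csubD[OF csub_M]
    have uM: "?u \<in> M" using D(4) M_one by blast
    have THc: "T H \<in> carrier_mat n n" using M_carrier[OF lin_in[OF L H]] .
    have Tu: "T ?u = ?u" using lin_smult[OF L M_one] unit by simp
    have nH: "- H = of_real (-1) \<cdot>\<^sub>m H" by (rule uminus_smult[OF Hc])
    have "T (?u + H) = ?u + T H" using lin_add[OF L uM H] Tu by simp
    then have p: "psd n (?u + T H)" using cp_positive[OF T D(3)[OF uM H] plus] by simp
    have "T (?u + (- H)) = ?u + of_real (-1) \<cdot>\<^sub>m T H"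
      unfolding nH using lin_add[OF L uM D(4)[OF H, of "of_real (-1)"]] lin_smult[OF L H] Tu by metis
    then have m: "psd n (?u + of_real (-1) \<cdot>\<^sub>m T H)"
      using cp_positive[OF T _ minus] D(3)[OF uM csub_uminus[OF csub_M H]] by simp
    have diag: "Re ((?u + T H) $$ (k, k)) \<le> 2 * c" if k: "k < n" for k
      using psd_diag[OF m k] k THc by (simp add: complex_nonneg_iff)
    have "2 * cmod ((?u + T H) $$ (i, j)) \<le> 4 * c"
      using psd_entry_bound[OF p i j] diag[OF i] diag[OF j] by simp
    moreover have "cmod (?u $$ (i, j)) \<le> c" using i j c0 by simp
    moreover have "T H $$ (i, j) = (?u + T H) $$ (i, j) - ?u $$ (i, j)" using i j THc by simp
    then have "cmod (T H $$ (i, j)) \<le> cmod ((?u + T H) $$ (i, j)) + cmod (?u $$ (i, j))"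
      by (simp only: norm_triangle_ineq4)
    ultimately show ?thesis by linarith
  qed
  then show ?thesis using that by blast
qed

text \<open>The bound does not depend on the semigroup, so it holds for all \<open>\<gamma>\<close> at once; this is what the sign of
  \<open>LS\<close> comes from.\<close>

lemma qms_uniformly_bounded:
  assumes X: "X \<in> M"
  obtains K where "\<And>L t. qms_generator n M L \<Longrightarrow> 0 \<le> t \<Longrightarrow> norm (\<iota> (super_exp n t L X)) \<le> K"
proof -
  note D = csubD[OF csub_M] and Xc = M_carrier[OF X] and XM = M_adjoint[OF X]
  note Xa = M_carrier[OF XM]
  \<comment> \<open>Cartesian decomposition into Hermitian parts.\<close>
  define H1 where "H1 = (1/2) \<cdot>\<^sub>m (X + mat_adjoint X)"
  define H2 where "H2 = (- \<i> / 2) \<cdot>\<^sub>m (X + (-1) \<cdot>\<^sub>m mat_adjoint X)"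
  have H1: "H1 \<in> M" "mat_adjoint H1 = H1"
    unfolding H1_def using D(3)[OF X XM] D(4) Xc by (auto intro!: eq_matI simp: algebra_simps)
  have H2: "H2 \<in> M"
    unfolding H2_def using D(3)[OF X D(4)[OF XM]] D(4) by blast
  have H2': "mat_adjoint H2 = H2"
    unfolding H2_def using Xc by (auto intro!: eq_matI simp: algebra_simps)
  have X_eq: "X = H1 + \<i> \<cdot>\<^sub>m H2"
    unfolding H1_def H2_def using Xc by (intro eq_matI) (auto simp: algebra_simps)
  obtain c1 where c1: "\<And>T i j. completely_positive n M T \<Longrightarrow> T (1\<^sub>m n) = 1\<^sub>m n \<Longrightarrow> i < n \<Longrightarrow> j < n \<Longrightarrow>
    cmod (T H1 $$ (i, j)) \<le> c1" using hermitian_image_bound[OF H1] by blast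
  obtain c2 where c2: "\<And>T i j. completely_positive n M T \<Longrightarrow> T (1\<^sub>m n) = 1\<^sub>m n \<Longrightarrow> i < n \<Longrightarrow> j < n \<Longrightarrow>
    cmod (T H2 $$ (i, j)) \<le> c2" using hermitian_image_bound[OF H2 H2'] by blast
  obtain K where K: "\<And>Y B. Y \<in> carrier_mat n n \<Longrightarrow> (\<And>i j. i < n \<Longrightarrow> j < n \<Longrightarrow> cmod (Y $$ (i, j)) \<le> B) \<Longrightarrow>
    norm (\<iota> Y) \<le> K * B" using emb_norm_entries by blast
  have "norm (\<iota> (super_exp n t L X)) \<le> K * (c1 + c2)" if q: "qms_generator n M L" and t: "0 \<le> t" for L t
  proof (rule K)
    let ?T = "super_exp n t L"
    have T: "completely_positive n M ?T" "?T (1\<^sub>m n) = 1\<^sub>m n" using q t by (auto simp: qms_generator_def)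
    have lin: "linear_on M ?T" using T by (simp add: completely_positive_def)
    fix i j assume ij: "i < n" "j < n"
    have "?T X = ?T H1 + \<i> \<cdot>\<^sub>m ?T H2"
      unfolding X_eq using lin_add[OF lin H1(1) D(4)[OF H2]] lin_smult[OF lin H2] by simp
    then have "?T X $$ (i, j) = ?T H1 $$ (i, j) + \<i> * ?T H2 $$ (i, j)" using ij by simp
    then show "cmod (?T X $$ (i, j)) \<le> c1 + c2"
      using c1[OF T ij] c2[OF T ij] norm_triangle_ineq[of "?T H1 $$ (i, j)" "\<i> * ?T H2 $$ (i, j)"]
      by (simp add: norm_mult)
  qed simp
  then show ?thesis using that by blast
qed

end

section \<open>Second-order lifts\<close>

context state_space
begin

text \<open>Subtracting the kernel component from \<open>X\<close> changes neither the numerator nor the denominator of the quotient, so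
  the infimum is over the complement of the kernel, where finite dimension provides a positive lower
  bound.  An \<open>X\<close> with \<open>\<Phi> X \<noteq> 0\<close> ensures that the infimum is not over the empty set.\<close>

lemma spectral_gap_transfer:
  assumes V: "csub V" and lin: "linear_on V \<Phi>"
    and N: "sym_nonneg (\<iota> ` V) N" and \<Phi>N: "\<And>X. X \<in> V \<Longrightarrow> \<iota> (\<Phi> X) = - N (\<iota> X)"
    and nz: "\<exists>X\<in>V. \<Phi> X \<noteq> 0\<^sub>m n n"
  shows spectral_gap_pos: "0 < spectral_gap n \<sigma> V \<Phi>"
    and spectral_gap_bound: "x \<in> \<iota> ` V \<Longrightarrow> (\<And>v. v \<in> ker_on (\<iota> ` V) N \<Longrightarrow> inner v x = 0) \<Longrightarrow>
      spectral_gap n \<sigma> V \<Phi> * (norm x)\<^sup>2 \<le> inner x (N x)"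
proof -
  let ?K = "fixed_algebra n V \<Phi>" and ?k = "ker_on (\<iota> ` V) N"
  let ?E = "cond_exp n \<sigma> ?K"
  note K = csub_fixed[OF V lin] and kf = ker_fin_dim[OF N]
  have Vc: "X \<in> carrier_mat n n" if "X \<in> V" for X using csub_carrier[OF V that] .
  have \<Phi>0: "\<Phi> X = 0\<^sub>m n n \<longleftrightarrow> N (\<iota> X) = 0" if "X \<in> V" for X
    using emb_eq_0[OF Vc[OF lin_in[OF lin that]]] \<Phi>N[OF that] by simp
  have Kk: "\<iota> ` ?K = ?k" using \<Phi>0 by (auto simp: fixed_algebra_def ker_on_def)
  have dir: "dirichlet_form n \<sigma> \<Phi> X = inner (\<iota> X) (N (\<iota> X))" if X: "X \<in> V" for X
    using inner_emb[OF Vc[OF X] Vc[OF lin_in[OF lin X]]] \<Phi>N[OF X] by (simp add: dirichlet_form_def)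
  have E: "?E X \<in> ?K" "\<iota> (?E X) = oproj ?k (\<iota> X)" if "X \<in> V" for X
    using cond_exp_transfer[OF K Vc[OF that]] Kk by auto
  have EV: "?E X \<in> V" if "X \<in> V" for X using E(1)[OF that] by (simp add: fixed_algebra_def)
  have nrm: "kms_norm n \<sigma> (X - ?E X) = norm (\<iota> X - oproj ?k (\<iota> X))" if X: "X \<in> V" for X
    using kms_norm_emb[of "X - ?E X"] emb_minus[OF Vc[OF X] Vc[OF EV[OF X]]] E(2)[OF X] Vc[OF X] Vc[OF EV[OF X]]
    by simp
  obtain d where d: "d > 0"
    "\<And>x. x \<in> \<iota> ` V \<Longrightarrow> (\<And>y. y \<in> ?k \<Longrightarrow> inner y x = 0) \<Longrightarrow> d * (norm x)\<^sup>2 \<le> inner x (N x)"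
    using sym_nonneg_gap[OF N] by blast
  let ?Q = "{dirichlet_form n \<sigma> \<Phi> X / (kms_norm n \<sigma> (X - ?E X))\<^sup>2 | X. X \<in> V \<and> X \<noteq> ?E X}"
  have gap: "spectral_gap n \<sigma> V \<Phi> = Inf ?Q" by (simp add: spectral_gap_def Let_def)
  have low: "d \<le> q" if qQ: "q \<in> ?Q" for q
  proof -
    obtain X where X: "X \<in> V" "X \<noteq> ?E X" and q: "q = dirichlet_form n \<sigma> \<Phi> X / (kms_norm n \<sigma> (X - ?E X))\<^sup>2"
      using qQ by blast
    let ?x = "\<iota> X" and ?p = "oproj ?k (\<iota> X)"
    have xV: "?x \<in> \<iota> ` V" using X by blast
    have pk: "?p \<in> ?k" by (rule oproj_in[OF kf])
    then have pV: "?p \<in> \<iota> ` V" and Np: "N ?p = 0" by (auto simp: ker_on_def)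
    have sub: "subspace (\<iota> ` V)" by (rule fin_dim_subspace[OF emb_fin_dim[OF V]])
    have zV: "?x - ?p \<in> \<iota> ` V" by (rule subspace_diff[OF sub xV pV])
    have Nz: "N (?x - ?p) = N ?x" using lin_on_diff[OF sub sym_nonneg_lin[OF N] xV pV] Np by simp
    have "d * (norm (?x - ?p))\<^sup>2 \<le> inner (?x - ?p) (N (?x - ?p))"
      by (rule d(2)[OF zV oproj_orth[OF kf]])
    also have "\<dots> = inner ?x (N ?x)"
      using ker_orth_range[OF N xV pk] by (simp add: Nz inner_diff_left)
    finally have le: "d * (norm (?x - ?p))\<^sup>2 \<le> inner ?x (N ?x)" .
    have "?x \<noteq> ?p" using X emb_inj[OF Vc[OF X(1)] Vc[OF EV[OF X(1)]]] E(2)[OF X(1)] by auto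
    then have "0 < (norm (?x - ?p))\<^sup>2" by simp
    then show ?thesis unfolding q dir[OF X(1)] nrm[OF X(1)] using le by (simp add: pos_le_divide_eq)
  qed
  have "?Q \<noteq> {}"
  proof -
    obtain X where X: "X \<in> V" "\<Phi> X \<noteq> 0\<^sub>m n n" using nz by blast
    then have "X \<noteq> ?E X" using E(1)[OF X(1)] by (auto simp: fixed_algebra_def)
    then show ?thesis using X(1) by blast
  qed
  then have "d \<le> Inf ?Q" using low by (rule cInf_greatest)
  then show "0 < spectral_gap n \<sigma> V \<Phi>" using d(1) gap by simp
  show "spectral_gap n \<sigma> V \<Phi> * (norm x)\<^sup>2 \<le> inner x (N x)"
    if x: "x \<in> \<iota> ` V" and o: "\<And>v. v \<in> ?k \<Longrightarrow> inner v x = 0"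
  proof (cases "x = 0")
    case True then show ?thesis by simp
  next
    case False
    obtain X where X: "X \<in> V" "x = \<iota> X" using x by blast
    have p0: "oproj ?k (\<iota> X) = 0" using oproj_zero[OF kf] o X(2) by blast
    have "\<iota> X \<noteq> \<iota> (?E X)" using False X p0 E(2)[OF X(1)] by simp
    then have "X \<noteq> ?E X" by metis
    then have "dirichlet_form n \<sigma> \<Phi> X / (kms_norm n \<sigma> (X - ?E X))\<^sup>2 \<in> ?Q" using X(1) by blast
    then have "Inf ?Q \<le> dirichlet_form n \<sigma> \<Phi> X / (kms_norm n \<sigma> (X - ?E X))\<^sup>2"
      using low by (intro cInf_lower bdd_belowI[of _ d]) auto
    also have "\<dots> = inner x (N x) / (norm x)\<^sup>2" using dir[OF X(1)] nrm[OF X(1)] p0 X(2) by simp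
    finally show ?thesis using False gap by (simp add: pos_le_divide_eq)
  qed
qed

end

locale lifted_semigroup = state_space +
  fixes LA LS :: superop
  assumes lift: "second_order_lift n \<sigma> M LA LS"
begin

abbreviation "FS \<equiv> fixed_algebra n M LS"
abbreviation "ES \<equiv> cond_exp n \<sigma> FS"
abbreviation "LO \<equiv> overdamped n \<sigma> M LA LS"
abbreviation "NS \<equiv> \<lambda>X. - LS X"
abbreviation "A \<equiv> hat LA"
abbreviation "N \<equiv> hat NS"

lemma lift_facts:
  shows LA: "linear_on M LA" and LS: "linear_on M LS"
    and qms: "0 < \<gamma> \<Longrightarrow> qms_generator n M (lifted LA LS \<gamma>)"
    and LS_sym: "X \<in> M \<Longrightarrow> LS X = kms_adjoint n \<sigma> M LS X"
    and LA_anti: "X \<in> M \<Longrightarrow> LA X = - kms_adjoint n \<sigma> M LA X"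
    and dims: "0 < \<gamma> \<Longrightarrow> cdim n (fixed_algebra n M (lifted LA LS \<gamma>)) < cdim n FS"
    and drift0: "X \<in> M \<Longrightarrow> ES (LA (ES X)) = 0\<^sub>m n n"
    and LO_lin: "linear_on FS LO"
  using lift unfolding second_order_lift_def Let_def kms_detailed_balanced_def qms_generator_def by auto

lemma NS_lin: "linear_on M NS"
  unfolding linear_on_def
proof (intro conjI ballI allI)
  fix X assume X: "X \<in> M"
  show "- LS X \<in> M" by (rule csub_uminus[OF csub_M lin_in[OF LS X]])
  show "- LS (X + Y) = - LS X + - LS Y" if Y: "Y \<in> M" for Y
    unfolding lin_add[OF LS X Y] using M_carrier[OF lin_in[OF LS X]] M_carrier[OF lin_in[OF LS Y]]
    by (intro eq_matI) auto
  show "- LS (c \<cdot>\<^sub>m X) = c \<cdot>\<^sub>m - LS X" for c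
    unfolding lin_smult[OF LS X] using M_carrier[OF lin_in[OF LS X]] by (intro eq_matI) auto
qed

lemma hat_LS: "x \<in> S \<Longrightarrow> hat LS x = - N x"
  using emb_uminus M_carrier lin_in[OF LS] by (auto simp: hat_emb)

lemma A_anti: "x \<in> S \<Longrightarrow> y \<in> S \<Longrightarrow> inner (A x) y = - inner x (A y)"
proof -
  assume "x \<in> S" "y \<in> S"
  then obtain X Y where X: "X \<in> M" "x = \<iota> X" and Y: "Y \<in> M" "y = \<iota> Y" by blast
  have "A x = - \<iota> (kms_adjoint n \<sigma> M LA X)"
    using X LA_anti[OF X(1)] emb_uminus[OF M_carrier[OF kms_adjoint_in[OF LA X(1)]]] by (simp add: hat_emb)
  then show ?thesis using kms_adjoint_inner[OF LA X(1) Y(1)] X Y by (simp add: hat_emb)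
qed

lemma LS_hat_sym: "x \<in> S \<Longrightarrow> y \<in> S \<Longrightarrow> inner (hat LS x) y = inner x (hat LS y)"
proof -
  assume "x \<in> S" "y \<in> S"
  then obtain X Y where X: "X \<in> M" "x = \<iota> X" and Y: "Y \<in> M" "y = \<iota> Y" by blast
  have "hat LS x = \<iota> (kms_adjoint n \<sigma> M LS X)" using X LS_sym[OF X(1)] by (simp add: hat_emb)
  then show ?thesis using kms_adjoint_inner[OF LS X(1) Y(1)] X Y by (simp add: hat_emb)
qed

lemma hat_lifted: "x \<in> S \<Longrightarrow> hat (lifted LA LS \<gamma>) x = A x + \<gamma> *\<^sub>R hat LS x"
  using M_carrier lin_in[OF LS] lin_in[OF LA] by (auto simp: hat_emb lifted_def emb_add emb_scaleR)

text \<open>Detailed balance makes \<open>LS\<close> symmetric but says nothing about its sign, which comes from the uniform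
  boundedness of the trajectories of \<open>LA + \<gamma> LS\<close>.\<close>

lemma LS_nonpos:
  assumes "x \<in> S"
  shows "inner x (hat LS x) \<le> 0"
proof -
  obtain X where X: "X \<in> M" "x = \<iota> X" using assms by blast
  obtain K where K: "\<And>L t. qms_generator n M L \<Longrightarrow> 0 \<le> t \<Longrightarrow> norm (\<iota> (super_exp n t L X)) \<le> K"
    using qms_uniformly_bounded[OF X(1)] by blast
  show ?thesis
  proof (rule nonpositive_if_trajectories_bounded[OF S_fin_dim hat_lin[OF LA] hat_in[OF LA] _
        hat_lin[OF LS] hat_in[OF LS] LS_hat_sym assms])
    show "inner y (A y) = 0" if "y \<in> S" for y
      using A_anti[OF that that] by (simp add: inner_commute)
    fix \<gamma> :: real assume \<gamma>: "0 < \<gamma>"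
    let ?L = "lifted LA LS \<gamma>"
    let ?x = "\<lambda>t. \<iota> (super_exp n t ?L X)"
    have "?x 0 = x" using super_exp_zero[OF M_carrier[OF X(1)]] X(2) by simp
    moreover have "?x t \<in> S \<and> norm (?x t) \<le> K \<and> (?x has_vector_derivative A (?x t) + \<gamma> *\<^sub>R hat LS (?x t)) (at t)"
      if t: "0 \<le> t" for t
    proof -
      have s: "?x t \<in> S" using super_exp_trajectory(1)[OF qms[OF \<gamma>] X(1) t] by blast
      show ?thesis using s K[OF qms[OF \<gamma>] t] super_exp_trajectory(2)[OF qms[OF \<gamma>] X(1) t]
        by (simp add: hat_lifted[OF s])
    qed
    ultimately show "\<exists>y. y 0 = x \<and> (\<forall>t\<ge>0. y t \<in> S \<and> norm (y t) \<le> K \<and>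
        (y has_vector_derivative A (y t) + \<gamma> *\<^sub>R hat LS (y t)) (at t))"
      by (intro exI[of _ ?x] conjI allI impI) auto
  qed
qed

lemma N_sym_nonneg: "sym_nonneg S N"
  unfolding sym_nonneg_def
  using S_fin_dim hat_lin[OF NS_lin] hat_in[OF NS_lin] LS_hat_sym LS_nonpos hat_LS by auto

lemma FS_NS: "fixed_algebra n M NS = FS"
proof -
  have "- Z = 0\<^sub>m n n \<longleftrightarrow> Z = 0\<^sub>m n n" if "Z \<in> M" for Z
    using emb_eq_0[OF M_carrier[OF that]] emb_eq_0[OF M_carrier[OF csub_uminus[OF csub_M that]]]
      emb_uminus[OF M_carrier[OF that]] by simp
  then show ?thesis using lin_in[OF LS] by (auto simp: fixed_algebra_def)
qed

lemma FS_csub: "csub FS" by (rule csub_fixed[OF csub_M LS])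

lemma FS_ker: "\<iota> ` FS = ker_on S N"
  using emb_fixed[OF NS_lin] FS_NS by simp

lemma FS_M: "X \<in> FS \<Longrightarrow> X \<in> M" by (simp add: fixed_algebra_def)

lemma ES_props:
  assumes "X \<in> M"
  shows "ES X \<in> FS" "ES X \<in> M" "\<iota> (ES X) = oproj (ker_on S N) (\<iota> X)"
  using cond_exp_transfer[OF FS_csub M_carrier[OF assms]] FS_ker FS_M by auto

sublocale hypocoercive S A N
proof
  show "sym_nonneg S N" by (rule N_sym_nonneg)
  show "lin_on S A" by (rule hat_lin[OF LA])
  show "A x \<in> S" if "x \<in> S" for x using hat_in[OF LA that] .
  show "inner (A x) y = - inner x (A y)" if "x \<in> S" "y \<in> S" for x y using A_anti[OF that] .
  fix x y assume x: "x \<in> ker_on S N" and y: "y \<in> ker_on S N"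
  note f = ker_fin_dim[OF N_sym_nonneg]
  obtain X where X: "X \<in> FS" "x = \<iota> X" using x FS_ker by blast
  have XM: "X \<in> M" by (rule FS_M[OF X(1)])
  have "\<iota> (ES X) = \<iota> X" using ES_props(3)[OF XM] oproj_id[OF f x] X(2) by simp
  then have "ES X = X" using emb_inj M_carrier ES_props(2)[OF XM] XM by metis
  then have "oproj (ker_on S N) (\<iota> (LA X)) = 0"
    using ES_props(3)[OF lin_in[OF LA XM]] drift0[OF XM] emb_zero by simp
  then have "inner y (\<iota> (LA X)) = 0" using oproj_inner[OF f y, of "\<iota> (LA X)"] by simp
  then show "inner y (A x) = 0" using X XM by (simp add: hat_emb)
qed

lemma neg_inverse_emb:
  assumes "X \<in> M"
  shows "neg_inverse n \<sigma> M LS X \<in> M" "\<iota> (neg_inverse n \<sigma> M LS X) = J (\<iota> X)"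
  using pseudoinverse_transfer[OF NS_lin N_sym_nonneg assms] by auto

lemma ES_id: "X \<in> FS \<Longrightarrow> ES X = X"
proof -
  assume X: "X \<in> FS"
  have "\<iota> X \<in> F" using X FS_ker by blast
  then have "\<iota> (ES X) = \<iota> X" using ES_props(3)[OF FS_M[OF X]] oproj_id[OF F_fin_dim] by simp
  then show ?thesis using emb_inj M_carrier ES_props(2)[OF FS_M[OF X]] FS_M[OF X] by metis
qed

lemma LA_ES_lin: "linear_on M (LA \<circ> ES)"
proof -
  have c: "ES X \<in> carrier_mat n n" if "X \<in> M" for X using ES_props(2)[OF that] M_carrier by blast
  have add: "ES (X + Y) = ES X + ES Y" if X: "X \<in> M" and Y: "Y \<in> M" for X Y
  proof (rule emb_inj)
    show "\<iota> (ES (X + Y)) = \<iota> (ES X + ES Y)"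
      using ES_props(3) csub_add[OF csub_M X Y] X Y c M_carrier
      by (simp add: emb_add oproj_add[OF F_fin_dim])
  qed (use c[OF csub_add[OF csub_M X Y]] c[OF X] c[OF Y] in auto)
  have smult: "ES (d \<cdot>\<^sub>m X) = d \<cdot>\<^sub>m ES X" if X: "X \<in> M" for X d
  proof -
    have "d \<cdot>\<^sub>m X - d \<cdot>\<^sub>m ES X = d \<cdot>\<^sub>m (X - ES X)"
      using M_carrier[OF X] c[OF X] by (intro eq_matI) (auto simp: right_diff_distrib)
    then show ?thesis
      using ES_props(1)[OF X] csub_smult[OF FS_csub] cond_exp_orth[OF FS_csub M_carrier[OF X]]
        kms_smult(1)[OF csub_carrier[OF FS_csub], of _ "X - ES X" d] M_carrier[OF X] c[OF X]
      by (intro cond_exp_eqI[OF FS_csub]) auto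
  qed
  show ?thesis
    unfolding linear_on_def using ES_props(2) lin_in[OF LA] lin_add[OF LA] lin_smult[OF LA]
    by (simp add: add smult)
qed

lemma eq_by_inner:
  assumes "x \<in> S" "y \<in> S" "\<And>v. v \<in> S \<Longrightarrow> inner x v = inner y v"
  shows "x = y"
proof -
  have "x - y \<in> S" using assms(1,2) S_sub by (simp add: subspace_diff)
  then have "inner (x - y) (x - y) = 0" using assms(3)[of "x - y"] by (simp add: inner_diff_left)
  then show ?thesis by simp
qed

text \<open>The adjoint of \<open>LA \<circ> ES\<close> is \<open>- ES \<circ> LA\<close>, since \<open>LA\<close> is skew and \<open>ES\<close> is an orthogonal projection.\<close>

lemma LO_emb:
  assumes Y: "Y \<in> FS"
  shows "LO Y \<in> FS" "\<iota> (LO Y) = - D (\<iota> Y)"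
proof -
  have YM: "Y \<in> M" by (rule FS_M[OF Y])
  have y: "\<iota> Y \<in> F" using Y FS_ker by blast
  show LO: "LO Y \<in> FS" by (rule lin_in[OF LO_lin Y])
  let ?W = "neg_inverse n \<sigma> M LS (LA Y)"
  let ?Z = "kms_adjoint n \<sigma> M (LA \<circ> ES) ?W"
  have W: "?W \<in> M" "\<iota> ?W = J (A (\<iota> Y))"
    using neg_inverse_emb[OF lin_in[OF LA YM]] YM by (auto simp: hat_emb)
  have Z: "?Z \<in> M" by (rule kms_adjoint_in[OF LA_ES_lin W(1)])
  have "\<iota> ?Z = D (\<iota> Y)"
  proof (rule eq_by_inner)
    show "\<iota> ?Z \<in> S" using Z by blast
    show "D (\<iota> Y) \<in> S" using sym_nonneg_in[OF D_sym_nonneg y] F_in_S by blast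
    fix v assume "v \<in> S"
    then obtain V where V: "V \<in> M" "v = \<iota> V" by blast
    have "inner (\<iota> ?Z) v = inner (J (A (\<iota> Y))) (A (P v))"
      using kms_adjoint_inner[OF LA_ES_lin W(1) V(1)] W(2) V ES_props[OF V(1)] hat_emb[OF ES_props(2)[OF V(1)], of LA]
      by simp
    also have "\<dots> = inner (P v) (D (\<iota> Y))" using D_form[OF y P_in] by simp
    also have "\<dots> = inner (D (\<iota> Y)) v"
      using oproj_inner[OF F_fin_dim sym_nonneg_in[OF D_sym_nonneg y], of v] by (simp add: inner_commute)
    finally show "inner (\<iota> ?Z) v = inner (D (\<iota> Y)) v" .
  qed
  moreover have "LO Y = - ?Z" using ES_id[OF Y] by (simp add: overdamped_def Let_def)
  ultimately show "\<iota> (LO Y) = - D (\<iota> Y)" using emb_uminus[OF M_carrier[OF Z]] by simp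
qed

text \<open>If \<open>A x = \<gamma> N x\<close>, then pairing with \<open>x\<close> kills the skew term, so \<open>x\<close> has no energy for \<open>N\<close> and both terms
  vanish.  In particular the fixed points do not depend on \<open>\<gamma>\<close>.\<close>

lemma emb_fixed_lifted:
  assumes \<gamma>: "0 < \<gamma>"
  shows "\<iota> ` fixed_algebra n M (lifted LA LS \<gamma>) = ker_on F D"
proof -
  have lin: "linear_on M (lifted LA LS \<gamma>)" using qms[OF \<gamma>] by (simp add: qms_generator_def)
  have "x \<in> ker_on F D" if x: "x \<in> S" and z: "A x + \<gamma> *\<^sub>R hat LS x = 0" for x
  proof -
    have "inner x (A x) + \<gamma> * inner x (hat LS x) = 0"
      using arg_cong[OF z, of "inner x"] by (simp add: inner_add_right)
    then have "inner x (N x) = 0" using A_anti[OF x x] hat_LS[OF x] \<gamma> by (simp add: inner_commute)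
    then have "N x = 0" using sym_nonneg_null[OF N_sym_nonneg x] by simp
    then show ?thesis using x z hat_LS[OF x] unfolding ker_D by (simp add: ker_on_def)
  qed
  moreover have "A x + \<gamma> *\<^sub>R hat LS x = 0" if "x \<in> ker_on F D" for x
    using that F_in_S[of x] N_F[of x] hat_LS[of x] unfolding ker_D by auto
  moreover have "ker_on F D \<subseteq> S" by (auto simp: ker_on_def)
  ultimately show ?thesis
    unfolding emb_fixed[OF lin] ker_on_def[of S "hat (lifted LA LS \<gamma>)"] using hat_lifted by auto
qed

text \<open>Otherwise \<open>LS\<close> and the lifted generator would have the same fixed points, against the strict
  inequality of the dimensions.  This is what keeps both spectral gaps from being infima over the
  empty set.\<close>

lemma A_nontrivial: "\<exists>y\<in>F. A y \<noteq> 0"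
proof (rule ccontr)
  assume "\<not> (\<exists>y\<in>F. A y \<noteq> 0)"
  then have "ker_on F D = F" unfolding ker_D by auto
  then have "\<iota> ` fixed_algebra n M (lifted LA LS 1) = \<iota> ` FS" using emb_fixed_lifted[of 1] FS_ker by simp
  moreover have "inj_on \<iota> M" using emb_inj M_carrier by (auto simp: inj_on_def)
  ultimately have "fixed_algebra n M (lifted LA LS 1) = FS"
    by (rule inj_on_image_eq_iff[THEN iffD1, rotated -1]) (auto simp: fixed_algebra_def)
  then show False using dims[of 1] by simp
qed

lemma gap_S:
  shows "0 < spectral_gap n \<sigma> M LS"
    and "x \<in> S \<Longrightarrow> (\<And>v. v \<in> F \<Longrightarrow> inner v x = 0) \<Longrightarrow> spectral_gap n \<sigma> M LS * (norm x)\<^sup>2 \<le> inner x (N x)"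
proof -
  have eq: "\<iota> (LS X) = - N (\<iota> X)" if "X \<in> M" for X
    using hat_LS[of "\<iota> X"] that by (simp add: hat_emb)
  have nz: "\<exists>X\<in>M. LS X \<noteq> 0\<^sub>m n n"
  proof (rule ccontr)
    assume "\<not> (\<exists>X\<in>M. LS X \<noteq> 0\<^sub>m n n)"
    then have "FS = M" by (auto simp: fixed_algebra_def)
    then have FS_S: "F = S" using FS_ker by simp
    obtain y where y: "y \<in> F" "A y \<noteq> 0" using A_nontrivial by blast
    have "A y \<in> F" using hat_in[OF LA F_in_S[OF y(1)]] FS_S by simp
    then show False using no_drift[OF y(1), of "A y"] y(2) by simp
  qed
  show "0 < spectral_gap n \<sigma> M LS" by (rule spectral_gap_pos[OF csub_M LS N_sym_nonneg eq nz])
  show "x \<in> S \<Longrightarrow> (\<And>v. v \<in> F \<Longrightarrow> inner v x = 0) \<Longrightarrow> spectral_gap n \<sigma> M LS * (norm x)\<^sup>2 \<le> inner x (N x)"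
    by (rule spectral_gap_bound[OF csub_M LS N_sym_nonneg eq nz])
qed

lemma gap_O:
  shows "0 < spectral_gap n \<sigma> FS LO"
    and "y \<in> F \<Longrightarrow> (\<And>v. v \<in> ker_on F D \<Longrightarrow> inner v y = 0) \<Longrightarrow> spectral_gap n \<sigma> FS LO * (norm y)\<^sup>2 \<le> inner y (D y)"
proof -
  have D: "sym_nonneg (\<iota> ` FS) D" using D_sym_nonneg FS_ker by simp
  have nz: "\<exists>X\<in>FS. LO X \<noteq> 0\<^sub>m n n"
  proof -
    obtain y where y: "y \<in> F" "A y \<noteq> 0" using A_nontrivial by blast
    then have "y \<notin> ker_on F D" unfolding ker_D by simp
    then have "D y \<noteq> 0" using y(1) by (simp add: ker_on_def)
    moreover obtain Y where Y: "Y \<in> FS" "y = \<iota> Y" using y(1) FS_ker by blast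
    ultimately have "LO Y \<noteq> 0\<^sub>m n n" using LO_emb(2)[OF Y(1)] emb_zero by auto
    then show ?thesis using Y by blast
  qed
  show "0 < spectral_gap n \<sigma> FS LO" by (rule spectral_gap_pos[OF FS_csub LO_lin D LO_emb(2) nz])
  show "y \<in> F \<Longrightarrow> (\<And>v. v \<in> ker_on F D \<Longrightarrow> inner v y = 0) \<Longrightarrow> spectral_gap n \<sigma> FS LO * (norm y)\<^sup>2 \<le> inner y (D y)"
    using spectral_gap_bound[OF FS_csub LO_lin D LO_emb(2) nz, of y] unfolding FS_ker by blast
qed

lemma second_order_term:
  assumes Y: "Y \<in> FS"
  defines "Z \<equiv> kms_adjoint n \<sigma> M LA (neg_inverse n \<sigma> M LS (LA Y))"
  shows "kms_norm n \<sigma> (Z - ES Z) = norm (A (J (A (\<iota> Y))) - P (A (J (A (\<iota> Y)))))"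
    and "kms_norm n \<sigma> (LO Y) = norm (D (\<iota> Y))"
    and "dirichlet_form n \<sigma> LO Y = inner (\<iota> Y) (D (\<iota> Y))"
proof -
  have YM: "Y \<in> M" by (rule FS_M[OF Y])
  have y: "\<iota> Y \<in> F" using Y FS_ker by blast
  let ?W = "neg_inverse n \<sigma> M LS (LA Y)" and ?a = "A (J (A (\<iota> Y)))"
  have W: "?W \<in> M" "\<iota> ?W = J (A (\<iota> Y))"
    using neg_inverse_emb[OF lin_in[OF LA YM]] YM by (auto simp: hat_emb)
  have Z: "Z \<in> M" unfolding Z_def by (rule kms_adjoint_in[OF LA W(1)])
  have aS: "?a \<in> S" using JA(1)[OF y] hat_in[OF LA] by blast
  have Za: "\<iota> Z = - ?a"
  proof (rule eq_by_inner)
    show "\<iota> Z \<in> S" using Z by blast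
    show "- ?a \<in> S" using aS S_sub by (simp add: subspace_neg)
    fix v assume v: "v \<in> S"
    then obtain V where V: "V \<in> M" "v = \<iota> V" by blast
    have "inner (\<iota> Z) v = inner (J (A (\<iota> Y))) (A v)"
      unfolding Z_def using kms_adjoint_inner[OF LA W(1) V(1)] W(2) V by (simp add: hat_emb)
    then show "inner (\<iota> Z) v = inner (- ?a) v" using A_anti[OF JA(1)[OF y] v] by simp
  qed
  have "\<iota> (Z - ES Z) = - (?a - P ?a)"
    using emb_minus[OF M_carrier[OF Z] M_carrier[OF ES_props(2)[OF Z]]] ES_props(3)[OF Z] Za
    by (simp add: oproj_minus[OF F_fin_dim])
  moreover have "Z - ES Z \<in> carrier_mat n n" using M_carrier[OF ES_props(2)[OF Z]] by simp
  ultimately show "kms_norm n \<sigma> (Z - ES Z) = norm (?a - P ?a)"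
    by (simp only: kms_norm_emb norm_minus_cancel)
  have c: "LO Y \<in> carrier_mat n n" using FS_M[OF LO_emb(1)[OF Y]] M_carrier by blast
  show "kms_norm n \<sigma> (LO Y) = norm (D (\<iota> Y))" using kms_norm_emb[OF c] LO_emb(2)[OF Y] by simp
  show "dirichlet_form n \<sigma> LO Y = inner (\<iota> Y) (D (\<iota> Y))"
    using inner_emb[OF M_carrier[OF YM] c] LO_emb(2)[OF Y] by (simp add: dirichlet_form_def)
qed

theorem lift_decay:
  assumes K1: "0 \<le> K1" and K2: "0 \<le> K2"
    and bound: "\<And>Y. Y \<in> FS \<Longrightarrow>
      (let Z = kms_adjoint n \<sigma> M LA (neg_inverse n \<sigma> M LS (LA Y)) in kms_norm n \<sigma> (Z - ES Z)
        \<le> K1 * kms_norm n \<sigma> (LO Y) + K2 * sqrt (dirichlet_form n \<sigma> LO Y))"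
    and \<gamma>: "0 < \<gamma>" and X: "X \<in> M" and t: "0 \<le> t"
    and EF: "cond_exp n \<sigma> (fixed_algebra n M (lifted LA LS \<gamma>)) X = 0\<^sub>m n n"
  defines "lO \<equiv> spectral_gap n \<sigma> FS LO" and "lS \<equiv> spectral_gap n \<sigma> M LS"
  shows "kms_norm n \<sigma> (super_exp n t (lifted LA LS \<gamma>) X)
    \<le> 2 * exp (- (\<gamma> / (\<gamma>\<^sup>2 * (6 / lO) + 6 * (1 / lS + 1 + 1 / sqrt lS * (K1 + K2 / sqrt lO))\<^sup>2)) * t) * kms_norm n \<sigma> X"
proof -
  let ?L = "lifted LA LS \<gamma>"
  interpret gaps: hypocoercive_gaps S A N lS lO K1 K2
  proof
    show "0 < lS" "0 < lO" unfolding lS_def lO_def by (rule gap_S(1), rule gap_O(1))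
    show "0 \<le> K1" "0 \<le> K2" by (fact K1, fact K2)
    show "lS * (norm x)\<^sup>2 \<le> inner x (N x)" if "x \<in> S" "\<And>v. v \<in> F \<Longrightarrow> inner v x = 0" for x
      unfolding lS_def using gap_S(2)[of x] that by blast
    show "lO * (norm y)\<^sup>2 \<le> inner y (D y)" if "y \<in> F" "\<And>v. v \<in> ker_on F D \<Longrightarrow> inner v y = 0" for y
      unfolding lO_def using gap_O(2)[of y] that by blast
    show "norm (A (J (A y)) - P (A (J (A y)))) \<le> K1 * norm (D y) + K2 * sqrt (inner y (D y))" if "y \<in> F" for y
    proof -
      obtain Y where Y: "Y \<in> FS" "y = \<iota> Y" using \<open>y \<in> F\<close> FS_ker by blast
      show ?thesis using bound[OF Y(1)] second_order_term[OF Y(1)] Y(2) by (simp add: Let_def)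
    qed
  qed
  let ?x = "\<lambda>t. \<iota> (super_exp n t ?L X)"
  have traj: "?x t \<in> S" "(?x has_vector_derivative A (?x t) - \<gamma> *\<^sub>R N (?x t)) (at t)" if t: "0 \<le> t" for t
  proof -
    show s: "?x t \<in> S" using super_exp_trajectory(1)[OF qms[OF \<gamma>] X t] by blast
    show "(?x has_vector_derivative A (?x t) - \<gamma> *\<^sub>R N (?x t)) (at t)"
      using super_exp_trajectory(2)[OF qms[OF \<gamma>] X t] hat_lifted[OF s] hat_LS[OF s] by simp
  qed
  have x0: "?x 0 = \<iota> X" using super_exp_zero[OF M_carrier[OF X]] by simp
  have orth: "inner v (?x 0) = 0" if v: "v \<in> ker_on F D" for v
  proof -
    have lin: "linear_on M ?L" using qms[OF \<gamma>] by (simp add: qms_generator_def)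
    have "oproj (ker_on F D) (\<iota> X) = 0"
      using cond_exp_emb[OF csub_fixed[OF csub_M lin] M_carrier[OF X]] EF emb_fixed_lifted[OF \<gamma>] emb_zero by simp
    then show ?thesis
      using oproj_inner[OF ker_fin_dim[OF D_sym_nonneg] v, of "\<iota> X"] x0 by simp
  qed
  have "norm (?x t) \<le> 2 * exp (- (\<gamma> / (\<gamma>\<^sup>2 * (6 / lO) + 6 * (1 / lS + 1 + gaps.drift)\<^sup>2)) * t) * norm (?x 0)"
    by (rule gaps.decay[OF \<gamma> t traj orth])
  moreover have "gaps.drift = 1 / sqrt lS * (K1 + K2 / sqrt lO)" by (simp add: gaps.drift_def)
  ultimately show ?thesis
    using kms_norm_emb[OF super_exp_carrier, of t ?L X] kms_norm_emb[OF M_carrier[OF X]] x0 by simp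
qed

end

lemma l2_rate_lower_bound:
  assumes "\<And>X t. X \<in> M \<Longrightarrow> 0 \<le> t \<Longrightarrow> cond_exp n \<sigma> (fixed_algebra n M L) X = 0\<^sub>m n n \<Longrightarrow>
    kms_norm n \<sigma> (super_exp n t L X) \<le> C * exp (- \<nu> * t) * kms_norm n \<sigma> X"
  shows "ereal \<nu> \<le> l2_rate C n \<sigma> M L"
  unfolding l2_rate_def using assms by (intro Sup_upper) blast

lemma optimal_rate:
  fixes l R :: real
  assumes l: "0 < l" and R: "0 < R"
  defines "\<gamma> \<equiv> sqrt ((6 * R\<^sup>2) / (6 / l))"
  shows "\<gamma> / (\<gamma>\<^sup>2 * (6 / l) + 6 * R\<^sup>2) = 1 / 12 * (sqrt l / R)"
proof -
  have "\<gamma> = R * sqrt l" using l R by (simp add: \<gamma>_def real_sqrt_mult)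
  moreover have "(R * sqrt l)\<^sup>2 * (6 / l) + 6 * R\<^sup>2 = 12 * R * R"
  proof -
    have "(R * sqrt l)\<^sup>2 = R\<^sup>2 * l" using l by (simp add: power_mult_distrib)
    then have "(R * sqrt l)\<^sup>2 * (6 / l) = 6 * R\<^sup>2" using l by simp
    then show ?thesis by (simp add: power2_eq_square)
  qed
  ultimately show ?thesis using R by simp
qed

theorem theorem2p17:
  shows "\<exists>a0 b0 a1 b1 C c :: real. 0 < a0 \<and> 0 < b0 \<and> 0 < a1 \<and> 0 < b1 \<and> 0 < C \<and> 0 < c \<and>
    (\<forall>(n :: nat) (M :: complex mat set) (\<sigma> :: complex mat)
       (LA :: complex mat \<Rightarrow> complex mat) (LS :: complex mat \<Rightarrow> complex mat) (K1 :: real) (K2 :: real).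
      let FS = fixed_algebra n M LS;
          ES = cond_exp n \<sigma> FS;
          L = lifted LA LS;
          EF = (\<lambda>\<gamma>. cond_exp n \<sigma> (fixed_algebra n M (L \<gamma>)));
          LO = overdamped n \<sigma> M LA LS;
          lambdaO = spectral_gap n \<sigma> FS LO;
          lambdaS = spectral_gap n \<sigma> M LS;
          R = 1 / lambdaS + 1 + 1 / sqrt lambdaS * (K1 + K2 / sqrt lambdaO);
          \<nu> = (\<lambda>\<gamma>. l2_rate C n \<sigma> M (L \<gamma>))
      in
        von_neumann_algebra n M \<longrightarrow>
        second_order_lift n \<sigma> M LA LS \<longrightarrow>
        0 \<le> K1 \<longrightarrow> 0 \<le> K2 \<longrightarrow>
        (\<forall>Y\<in>FS.
           (let Z = kms_adjoint n \<sigma> M LA (neg_inverse n \<sigma> M LS (LA Y))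
            in kms_norm n \<sigma> (Z - ES Z)
               \<le> K1 * kms_norm n \<sigma> (LO Y) + K2 * sqrt (dirichlet_form n \<sigma> LO Y))) \<longrightarrow>
        (\<exists>C0 C1 :: real. 0 < C0 \<and> 0 < C1 \<and>
           a0 / lambdaO \<le> C0 \<and> C0 \<le> b0 / lambdaO \<and>
           a1 * R\<^sup>2 \<le> C1 \<and> C1 \<le> b1 * R\<^sup>2 \<and>
           (\<forall>\<gamma>>0. \<forall>X\<in>M. \<forall>t\<ge>0. EF \<gamma> X = 0\<^sub>m n n \<longrightarrow>
              kms_norm n \<sigma> (super_exp n t (L \<gamma>) X)
              \<le> C * exp (- (\<gamma> / (\<gamma>\<^sup>2 * C0 + C1)) * t) * kms_norm n \<sigma> X) \<and>
           (SUP \<gamma>\<in>{0<..}. \<nu> \<gamma>) \<ge> \<nu> (sqrt (C1 / C0)) \<and>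
           \<nu> (sqrt (C1 / C0)) \<ge> ereal (c * (sqrt lambdaO / R))))"
proof (rule exI[of _ 6], rule exI[of _ 6], rule exI[of _ 6], rule exI[of _ 6], rule exI[of _ 2],
    rule exI[of _ "1 / 12"], unfold Let_def, intro conjI allI impI, goal_cases)
  case (7 n M \<sigma> LA LS K1 K2)
  let ?FS = "fixed_algebra n M LS" and ?LO = "overdamped n \<sigma> M LA LS"
  define lO where "lO = spectral_gap n \<sigma> ?FS ?LO"
  define lS where "lS = spectral_gap n \<sigma> M LS"
  define r where "r = 1 / lS + 1 + 1 / sqrt lS * (K1 + K2 / sqrt lO)"
  note vn = 7(1) and lift = 7(2) and K1 = 7(3) and K2 = 7(4) and bound = 7(5)
  interpret lifted_semigroup n M \<sigma> LA LS
    by unfold_locales (use vn lift in \<open>auto simp: second_order_lift_def Let_def\<close>)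
  have lO: "0 < lO" and lS: "0 < lS" unfolding lO_def lS_def by (rule gap_O(1), rule gap_S(1))
  have "0 \<le> 1 / sqrt lS * (K1 + K2 / sqrt lO)" using K1 K2 lO lS by simp
  then have r: "0 < r" using lS unfolding r_def by (intro add_pos_nonneg) auto
  have decay: "kms_norm n \<sigma> (super_exp n t (lifted LA LS \<gamma>) X)
      \<le> 2 * exp (- (\<gamma> / (\<gamma>\<^sup>2 * (6 / lO) + 6 * r\<^sup>2)) * t) * kms_norm n \<sigma> X"
    if "0 < \<gamma>" "X \<in> M" "0 \<le> t" "cond_exp n \<sigma> (fixed_algebra n M (lifted LA LS \<gamma>)) X = 0\<^sub>m n n" for \<gamma> X t
    unfolding r_def lO_def lS_def using bound by (intro lift_decay[OF K1 K2 _ that]) (simp add: Let_def)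
  let ?\<gamma> = "sqrt ((6 * r\<^sup>2) / (6 / lO))"
  have \<gamma>: "0 < ?\<gamma>" using r lO by simp
  have sup: "l2_rate 2 n \<sigma> M (lifted LA LS ?\<gamma>) \<le> (SUP \<gamma>\<in>{0<..}. l2_rate 2 n \<sigma> M (lifted LA LS \<gamma>))"
    using \<gamma> by (intro SUP_upper) simp
  have rate: "ereal (1 / 12 * (sqrt lO / r)) \<le> l2_rate 2 n \<sigma> M (lifted LA LS ?\<gamma>)"
    unfolding optimal_rate[OF lO r, symmetric] by (rule l2_rate_lower_bound) (rule decay[OF \<gamma>])
  show ?case
    unfolding lO_def[symmetric] lS_def[symmetric] r_def[symmetric]
    by (rule exI[of _ "6 / lO"], rule exI[of _ "6 * r\<^sup>2"]) (use lO r decay sup rate in auto)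
qed simp_all

end
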